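(* Let $\beta_0\in(0,1)$ and $\kappa_0,\delta_0,b_0\in(0,\infty)$ be constants. For each dimension $d$ let $(\boldsymbol\mu,\Sigma,R)$ be parameters of a $d$-dimensional reflected Brownian motion such that: $R=I-Q^T$ with $Q$ substochastic and $\|\mathbf 1^TQ^n\|_\infty\le\kappa_0(1-\beta_0)^n$ for all $n\ge0$; $R^{-1}\boldsymbol\mu<-\delta_0\mathbf 1$ componentwise; and $b_0^{-1}\le\Sigma_{i,i}\le b_0$ for all $1\le i\le d$. Then there exist constants $C_2>0$ and $\xi_1>0$, independent of $d$ and $t$, such that for all $d\ge2$ and $t\ge0$, $$E\big[\|\mathbf Y(t;\mathbf Y(\infty),\mathbf X_{0:t})-\mathbf Y(t;0,\mathbf X_{0:t})\|_\infty^2\big]\le C_2\,d^3\exp\Big(-\xi_1\frac{t}{\log(d)}\Big).$$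
   Context: $Q\ge0$ is a $d\times d$ matrix with row sums $\le1$, and $R=I-Q^T$ is such that $R^{-1}$ exists and has nonnegative entries. $\mathbf X(t)=\boldsymbol\mu t+C\mathbf B(t)$ where $\mathbf B$ is a standard $d$-dimensional Brownian motion and $CC^T=\Sigma$; $\mathbf X_{0:t}$ denotes its path on $[0,t]$. For $\mathbf y\in\mathbb R_+^d$, $\mathbf Y(t;\mathbf y,\mathbf X_{0:t})$ is the value at time $t$ of the first component of the unique pair $(\mathbf Y,\mathbf L)$ solving the Skorokhod problem $0\le\mathbf Y(t)=\mathbf y+\mathbf X(t)+R\mathbf L(t)$, $\mathbf L(0)=0$, with each $L_i$ nondecreasing and $\int_0^tY_i(s)\,dL_i(s)=0$; this is the $(\boldsymbol\mu,\Sigma,R)$-reflected Brownian motion started at $\mathbf y$. Under the stated conditions it has a unique stationary distribution, and $\mathbf Y(\infty)$ is a random vector with that distribution, independent of $\mathbf X$. Thus both processes in the claim are driven by the same Brownian path, one started from $\mathbf Y(\infty)$ and one from $0$. *)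

theory Defs
  imports "HOL-Probability.Probability" "Jordan_Normal_Form.Matrix"
begin

unbundle no vec_syntax
no_notation inner (infix \<open>\<bullet>\<close> 70)

text \<open>
  The dimension \<open>d\<close> is a term, so that constants can be chosen before it. Parameters are
  vectors and matrices of type \<open>real vec\<close> and \<open>real mat\<close>. Random vectors and paths take values
  in \<open>nat \<Rightarrow> real\<close>, with coordinates \<open>i < d\<close>, because the product measurable space below
  lives on that type.
\<close>

abbreviation state_space :: "nat \<Rightarrow> (nat \<Rightarrow> real) measure" where
  "state_space d \<equiv> PiM {..<d} (\<lambda>_. borel)"

definition max_norm :: "real vec \<Rightarrow> real" where
  "max_norm v = Max ((\<lambda>i. \<bar>v $ i\<bar>) ` {..<dim_vec v})"

definition substochastic :: "nat \<Rightarrow> real mat \<Rightarrow> bool" where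
  "substochastic d Q \<longleftrightarrow> Q \<in> carrier_mat d d \<and>
     (\<forall>i<d. \<forall>j<d. 0 \<le> Q $$ (i, j)) \<and> (\<forall>i<d. (\<Sum>j<d. Q $$ (i, j)) \<le> 1)"

definition reflection_matrix :: "nat \<Rightarrow> real mat \<Rightarrow> real mat" where
  "reflection_matrix d Q = 1\<^sub>m d - transpose_mat Q"

definition is_mat_inverse :: "nat \<Rightarrow> real mat \<Rightarrow> real mat \<Rightarrow> bool" where
  "is_mat_inverse d A A' \<longleftrightarrow> A' \<in> carrier_mat d d \<and> inverts_mat A A' \<and> inverts_mat A' A"

text \<open>
  In the last clause the independence is joint over time steps \<open>k\<close> and coordinates \<open>i\<close>, so
  it contains both the independence of increments and that of the coordinates.
\<close>

definition standard_brownian_motion ::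
  "'w measure \<Rightarrow> nat \<Rightarrow> ('w \<Rightarrow> real \<Rightarrow> nat \<Rightarrow> real) \<Rightarrow> bool" where
  "standard_brownian_motion M d B \<longleftrightarrow>
     prob_space M \<and>
     (\<forall>i<d. \<forall>t\<ge>0. (\<lambda>\<omega>. B \<omega> t i) \<in> borel_measurable M) \<and>
     (\<forall>i<d. \<forall>\<omega>\<in>space M. B \<omega> 0 i = 0 \<and> continuous_on {0..} (\<lambda>t. B \<omega> t i)) \<and>
     (\<forall>i<d. \<forall>s t. 0 \<le> s \<and> s < t \<longrightarrow>
        distributed M lborel (\<lambda>\<omega>. B \<omega> t i - B \<omega> s i) (normal_density 0 (sqrt (t - s)))) \<and>
     (\<forall>n \<tau>. 0 \<le> \<tau> 0 \<and> strict_mono_on {..n} \<tau> \<longrightarrow>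
        prob_space.indep_vars M (\<lambda>_. borel)
          (\<lambda>(k, i) \<omega>. B \<omega> (\<tau> (Suc k)) i - B \<omega> (\<tau> k) i) ({..<n} \<times> {..<d}))"

definition driving_path ::
  "nat \<Rightarrow> real vec \<Rightarrow> real mat \<Rightarrow> (real \<Rightarrow> nat \<Rightarrow> real) \<Rightarrow> real \<Rightarrow> nat \<Rightarrow> real" where
  "driving_path d \<mu> C b t i = (t \<cdot>\<^sub>v \<mu> + C *\<^sub>v vec d (b t)) $ i"

text \<open>
  The pair \<open>(Y, L)\<close> solves the Skorokhod problem on \<open>[0,T]\<close> for the path \<open>x\<close> started at
  \<open>y\<close>. As \<open>interval_measure\<close> needs a monotone function on the whole line, \<open>L\<close> is
  extended by constants outside \<open>[0,T]\<close>. The complementarity integral is taken over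
  nonnegative \<open>Y\<close>, so the extended-nonnegative integral carries no integrability side condition.
\<close>

definition skorokhod_solution ::
  "nat \<Rightarrow> real mat \<Rightarrow> real \<Rightarrow> (nat \<Rightarrow> real) \<Rightarrow> (real \<Rightarrow> nat \<Rightarrow> real) \<Rightarrow>
     (real \<Rightarrow> nat \<Rightarrow> real) \<Rightarrow> (real \<Rightarrow> nat \<Rightarrow> real) \<Rightarrow> bool" where
  "skorokhod_solution d R T y x Y L \<longleftrightarrow>
     (\<forall>i<d. L 0 i = 0 \<and> continuous_on {0..T} (\<lambda>s. L s i) \<and> mono_on {0..T} (\<lambda>s. L s i)) \<and>
     (\<forall>i<d. \<forall>s\<in>{0..T}. 0 \<le> Y s i \<and> Y s i = y i + x s i + (R *\<^sub>v vec d (L s)) $ i) \<and>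
     (\<forall>i<d. \<forall>s\<in>{0..T}.
        (\<integral>\<^sup>+u\<in>{0..s}. ennreal (Y u i) \<partial>interval_measure (\<lambda>u. L (max 0 (min T u)) i)) = 0)"

text \<open>
  The value at time \<open>t\<close> of the reflected path. It depends only on \<open>x\<close> restricted to
  \<open>[0,t]\<close>, and it is extensional, so that it is a point of \<open>state_space d\<close>.
\<close>

definition reflected_path ::
  "nat \<Rightarrow> real mat \<Rightarrow> real \<Rightarrow> (nat \<Rightarrow> real) \<Rightarrow> (real \<Rightarrow> nat \<Rightarrow> real) \<Rightarrow> nat \<Rightarrow> real" where
  "reflected_path d R t y x =
     (\<lambda>i\<in>{..<d}. THE v. \<exists>Y L. skorokhod_solution d R t y x Y L \<and> Y t i = v)"

text \<open>
  A law \<open>\<pi>\<close> on the nonnegative orthant is stationary if the reflected process started from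
  \<open>\<pi>\<close> independently of the driving process \<open>X\<close> has law \<open>\<pi>\<close> at all times.
\<close>

definition stationary_distribution ::
  "'w measure \<Rightarrow> nat \<Rightarrow> real mat \<Rightarrow> ('w \<Rightarrow> real \<Rightarrow> nat \<Rightarrow> real) \<Rightarrow> (nat \<Rightarrow> real) measure \<Rightarrow> bool"
where
  "stationary_distribution M d R X \<pi> \<longleftrightarrow>
     prob_space \<pi> \<and> sets \<pi> = sets (state_space d) \<and>
     (AE y in \<pi>. \<forall>i<d. 0 \<le> y i) \<and>
     (\<forall>t\<ge>0. distr (\<pi> \<Otimes>\<^sub>M M) (state_space d) (\<lambda>(y, \<omega>). reflected_path d R t y (X \<omega>)) = \<pi>)"

text \<open>
  Independence of the \<open>\<sigma>\<close>-algebras generated by \<open>Z\<close> and by the whole process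
  \<open>(X t)\<close>, \<open>t \<ge> 0\<close>. The library's \<open>indep_var\<close> does not apply since it requires both
  variables to take values in the same type.
\<close>

definition independent_of_process ::
  "'w measure \<Rightarrow> nat \<Rightarrow> ('w \<Rightarrow> nat \<Rightarrow> real) \<Rightarrow> ('w \<Rightarrow> real \<Rightarrow> nat \<Rightarrow> real) \<Rightarrow> bool" where
  "independent_of_process M d Z X \<longleftrightarrow>
     Z \<in> M \<rightarrow>\<^sub>M state_space d \<and>
     prob_space.indep_set M
       {Z -` A \<inter> space M | A. A \<in> sets (state_space d)}
       {(\<lambda>\<omega>. \<lambda>(t, i)\<in>{0..} \<times> {..<d}. X \<omega> t i) -` A \<inter> space M | A.
          A \<in> sets (PiM ({0..} \<times> {..<d}) (\<lambda>_. borel))}"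

end

theory Submission
  imports Defs
begin

text \<open>
  Let \<open>Y\<close> and \<open>Y'\<close> be the solutions started from \<open>y \<ge> 0\<close> and \<open>0\<close>. The difference \<open>L' - L\<close> of the
  pushing terms is nondecreasing, so \<open>R^-1 (Y - Y')\<close> is nonincreasing in time; when \<open>Y\<close> has visited
  zero in every coordinate, it has been multiplied by \<open>Q^T\<close>, which contracts a weighted maximum
  norm by a factor \<open>\<rho> < 1\<close>. The workload \<open>R^-1 Y\<close> drifts down at a rate bounded below as long as
  its coordinate of \<open>Y\<close> is positive, so in a block of length of order \<open>ln d\<close> all coordinates of \<open>Y\<close>
  reach zero unless the workload is large or the noise oscillates too much.

  Both effects combine in the potential \<open>v^2 exp (\<theta> m)\<close>, where \<open>v\<close> and \<open>m\<close> are the weighted maxima of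
  \<open>R^-1 (Y - Y')\<close> and of the workload and \<open>\<theta>\<close> is of order \<open>1 / ln d\<close>: over one block it is multiplied
  by at most a function of the oscillation of the noise in that block, whose mean is below \<open>1\<close>.
  The blocks are independent, which gives the exponential rate, and the same drift bounds
  \<open>exp (\<theta> m)\<close> in stationarity.
\<close>

section \<open>Comparison for the Skorokhod problem\<close>

text \<open>All estimates of the two reflected paths are deterministic; chance enters through the
  starting point and the block oscillations of the noise alone. An oscillation is a maximum over
  \<open>d\<close> coordinates, and the union bound makes its exponential moments as large as a
  power of \<open>d\<close>, that is \<open>exp (c2 * l)\<close> with \<open>l = ln d\<close>. So a
  block needs length of order \<open>l\<close> for the drift to beat this, and
  \<open>\<theta>\<close> has to be of order \<open>1 / l\<close> for Jensen's inequality to bring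
  the moment down to \<open>1 / \<rho>\<close>. This is the origin of the logarithm in the rate. In
  stationarity the initial potential has mean of order \<open>1 / \<theta>^2\<close>, hence
  \<open>(ln d)^2\<close>, and \<open>d^3\<close> is a crude majorant of it.

  Two obstacles shape the probabilistic part. No moment of the stationary law is known to be finite
  beforehand, so the drift inequality is solved for truncated functions. Suprema over uncountably
  many times are not measurable in the product space of paths, so oscillations are handled on finite
  grids and Fatou's lemma passes to the limit.\<close>

lemma zero_bound_of_contraction:
  fixes f :: "'a \<Rightarrow> real"
  assumes "0 < \<rho>" "\<rho> < 1" and bdd: "\<And>x. x \<in> S \<Longrightarrow> f x \<le> e0"
    and step: "\<And>e. 0 \<le> e \<Longrightarrow> (\<And>x. x \<in> S \<Longrightarrow> f x \<le> e) \<Longrightarrow> (\<And>x. x \<in> S \<Longrightarrow> f x \<le> \<rho> * e)"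
    and "x \<in> S"
  shows "f x \<le> 0"
proof -
  \<comment> \<open>Iterating the improvement from an a priori bound replaces an argument with an
    attained supremum. As \<open>f\<close> may be negative and \<open>step\<close> asks for
    \<open>0 \<le> e\<close>, the iteration starts at \<open>max 0 e0\<close>.\<close>
  have *: "\<forall>x\<in>S. f x \<le> \<rho> ^ n * max 0 e0" for n
  proof (induction n)
    case 0 show ?case using bdd by (simp add: le_max_iff_disj)
  next
    case (Suc n)
    then have "f x \<le> \<rho> * (\<rho> ^ n * max 0 e0)" if "x \<in> S" for x
      using that assms(1) by (intro step) auto
    then show ?case by (simp add: mult.assoc)
  qed
  have "(\<lambda>n. \<rho> ^ n * max 0 e0) \<longlonglongrightarrow> 0 * max 0 e0"
    using assms by (intro tendsto_intros LIMSEQ_realpow_zero) auto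
  then have "(\<lambda>n. \<rho> ^ n * max 0 e0) \<longlonglongrightarrow> 0" by simp
  then show ?thesis using * \<open>x \<in> S\<close> by (intro LIMSEQ_le_const) auto
qed

text \<open>The complementarity condition without Stieltjes integrals. For continuous paths and
  nondecreasing \<open>L\<close> it is equivalent to the vanishing integral, by
  \<open>flat_if_complementary\<close> and \<open>complementary_if_flat\<close>.\<close>

definition flat_off_zeros :: "real \<Rightarrow> (real \<Rightarrow> real) \<Rightarrow> (real \<Rightarrow> real) \<Rightarrow> bool" where
  "flat_off_zeros T Y L \<longleftrightarrow>
     (\<forall>a b. 0 \<le> a \<longrightarrow> a \<le> b \<longrightarrow> b \<le> T \<longrightarrow> (\<forall>s\<in>{a..b}. 0 < Y s) \<longrightarrow> L a = L b)"

text \<open>The tool behind all pathwise comparisons: going back from \<open>b\<close> to the last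
  zero of \<open>Y\<close> leaves \<open>L\<close> unchanged. The zeros in \<open>{a..b}\<close>
  form a compact set, so there is a last one unless there is none.\<close>

lemma last_zero:
  fixes Y L :: "real \<Rightarrow> real"
  assumes flat: "flat_off_zeros T Y L"
    and cY: "continuous_on {0..T} Y" and cL: "continuous_on {0..T} L"
    and nonneg: "\<And>s. s \<in> {0..T} \<Longrightarrow> 0 \<le> Y s"
    and ab: "0 \<le> a" "a \<le> b" "b \<le> T"
  obtains (positive) "\<forall>s\<in>{a..b}. 0 < Y s" "L a = L b"
    | (zero) s where "s \<in> {a..b}" "Y s = 0" "L s = L b"
proof (cases "\<forall>s\<in>{a..b}. 0 < Y s")
  case True
  then show ?thesis using flat ab positive unfolding flat_off_zeros_def by blast
next
  case False
  define Z where "Z = {s\<in>{a..b}. Y s = 0}"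
  have "Z \<noteq> {}" using False nonneg ab unfolding Z_def by (force simp: not_less intro: antisym)
  moreover have "compact Z"
  proof -
    have "continuous_on {a..b} Y" using cY by (rule continuous_on_subset) (use ab in auto)
    then have "closed ({a..b} \<inter> Y -` {0})" by (intro continuous_closed_preimage) auto
    moreover have "Z = {a..b} \<inter> Y -` {0}" by (auto simp: Z_def)
    moreover have "bounded Z" by (rule bounded_subset[of "{a..b}"]) (auto simp: Z_def)
    ultimately show ?thesis by (simp add: compact_eq_bounded_closed)
  qed
  ultimately obtain s where s: "s \<in> Z" "\<And>r. r \<in> Z \<Longrightarrow> r \<le> s"
    using compact_attains_sup by metis
  have sab: "s \<in> {a..b}" "Y s = 0" using s(1) by (auto simp: Z_def)
  have pos: "0 < Y r" if "r \<in> {s<..b}" for r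
  proof (rule ccontr)
    assume "\<not> 0 < Y r"
    then have "Y r = 0" using nonneg[of r] that sab ab by force
    then have "r \<in> Z" using that sab by (auto simp: Z_def)
    then show False using s(2)[of r] that by auto
  qed
  have "L s = L b"
  proof (cases "s = b")
    case False
    then have "s < b" using sab by auto
    \<comment> \<open>Flatness applies to \<open>{r..b}\<close> for \<open>r > s\<close> only,
      because \<open>Y s = 0\<close>; continuity of \<open>L\<close> at \<open>s\<close> from the
      right supplies the endpoint.\<close>
    have ev: "L r = L b" if "r \<in> {s<..b}" for r
    proof -
      have "\<forall>q\<in>{r..b}. 0 < Y q" using pos that by auto
      then show ?thesis using flat that sab ab unfolding flat_off_zeros_def by auto
    qed
    have "(L \<longlongrightarrow> L s) (at s within {s..b})"
      using continuous_on_subset[OF cL, of "{s..b}"] sab ab \<open>s < b\<close>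
      by (auto simp: continuous_on_def)
    moreover have "(L \<longlongrightarrow> L b) (at s within {s..b})"
    proof (rule tendsto_eventually)
      show "\<forall>\<^sub>F r in at s within {s..b}. L r = L b"
        unfolding eventually_at_filter
      proof (rule always_eventually, intro allI impI)
        fix r assume "r \<noteq> s" "r \<in> {s..b}"
        then show "L r = L b" by (intro ev) auto
      qed
    qed
    moreover have "at s within {s..b} \<noteq> bot"
      using trivial_limit_at_right_real[of s] by (simp add: at_within_Icc_at_right[OF \<open>s < b\<close>])
    ultimately show ?thesis using tendsto_unique by blast
  qed simp
  then show ?thesis using zero sab by blast
qed

text \<open>\<open>P\<close> stands for \<open>Q^T\<close>. Its row sums are column sums of
  \<open>Q\<close> and may exceed 1, so \<open>P\<close> need not contract the plain maximum norm;
  it contracts the maximum of \<open>\<bar>v i\<bar> / w i\<close>. The lower bound 1 on the weights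
  lets unweighted bounds pass to weighted ones.\<close>

locale contraction_weights =
  fixes d :: nat and P :: "nat \<Rightarrow> nat \<Rightarrow> real" and w :: "nat \<Rightarrow> real" and \<rho> :: real
  assumes P_nonneg: "\<And>i j. i < d \<Longrightarrow> j < d \<Longrightarrow> 0 \<le> P i j"
    and w_ge_1: "\<And>i. i < d \<Longrightarrow> 1 \<le> w i"
    and P_w_le: "\<And>i. i < d \<Longrightarrow> (\<Sum>j<d. P i j * w j) \<le> \<rho> * w i"
    and rho: "0 < \<rho>" "\<rho> < 1"
begin

lemma w_pos: "i < d \<Longrightarrow> 0 < w i"
  using w_ge_1[of i] by linarith

lemma P_sum_le:
  assumes "i < d" "0 \<le> c" "\<And>j. j < d \<Longrightarrow> v j \<le> c * w j"
  shows "(\<Sum>j<d. P i j * v j) \<le> \<rho> * c * w i"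
proof -
  have "(\<Sum>j<d. P i j * v j) \<le> (\<Sum>j<d. P i j * (c * w j))"
    using assms P_nonneg by (intro sum_mono mult_left_mono) auto
  also have "\<dots> = c * (\<Sum>j<d. P i j * w j)"
    by (simp add: sum_distrib_left algebra_simps)
  also have "\<dots> \<le> c * (\<rho> * w i)" using assms P_w_le by (intro mult_left_mono) auto
  finally show ?thesis by (simp add: algebra_simps)
qed

text \<open>The Skorokhod problem in the form used for comparison: \<open>u\<close> is the starting
  point plus the driving path, and complementarity is flatness, which speaks of times instead of
  measures.\<close>

definition reflects :: "real \<Rightarrow> (real \<Rightarrow> nat \<Rightarrow> real) \<Rightarrow> (real \<Rightarrow> nat \<Rightarrow> real) \<Rightarrow> (real \<Rightarrow> nat \<Rightarrow> real) \<Rightarrow> bool"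
where
  "reflects T u Y L \<longleftrightarrow>
     (\<forall>i<d. L 0 i = 0 \<and> continuous_on {0..T} (\<lambda>s. L s i) \<and> continuous_on {0..T} (\<lambda>s. Y s i)
        \<and> mono_on {0..T} (\<lambda>s. L s i) \<and> flat_off_zeros T (\<lambda>s. Y s i) (\<lambda>s. L s i)) \<and>
     (\<forall>i<d. \<forall>s\<in>{0..T}. 0 \<le> Y s i \<and> Y s i = u s i + L s i - (\<Sum>j<d. P i j * L s j))"

lemma reflectsD:
  assumes "reflects T u Y L" "i < d"
  shows "L 0 i = 0" "continuous_on {0..T} (\<lambda>s. L s i)" "continuous_on {0..T} (\<lambda>s. Y s i)"
    "mono_on {0..T} (\<lambda>s. L s i)" "flat_off_zeros T (\<lambda>s. Y s i) (\<lambda>s. L s i)"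
    "s \<in> {0..T} \<Longrightarrow> 0 \<le> Y s i"
    "s \<in> {0..T} \<Longrightarrow> Y s i = u s i + L s i - (\<Sum>j<d. P i j * L s j)"
    "0 \<le> a \<Longrightarrow> a \<le> b \<Longrightarrow> b \<le> T \<Longrightarrow> L a i \<le> L b i"
proof -
  note * = assms(1)[unfolded reflects_def, THEN conjunct1, rule_format, OF assms(2)]
  note ** = assms(1)[unfolded reflects_def, THEN conjunct2, rule_format, OF assms(2)]
  show "L 0 i = 0" "continuous_on {0..T} (\<lambda>s. L s i)" "continuous_on {0..T} (\<lambda>s. Y s i)"
    "mono_on {0..T} (\<lambda>s. L s i)" "flat_off_zeros T (\<lambda>s. Y s i) (\<lambda>s. L s i)"
    using * by simp_all
  show "s \<in> {0..T} \<Longrightarrow> 0 \<le> Y s i"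
    "s \<in> {0..T} \<Longrightarrow> Y s i = u s i + L s i - (\<Sum>j<d. P i j * L s j)"
    using ** by blast+
  show "0 \<le> a \<Longrightarrow> a \<le> b \<Longrightarrow> b \<le> T \<Longrightarrow> L a i \<le> L b i"
    using * by (auto simp: mono_on_def)
qed

lemma reflects_last_zero:
  assumes "reflects T u Y L" "i < d" "0 \<le> a" "a \<le> b" "b \<le> T"
  obtains (positive) "\<forall>s\<in>{a..b}. 0 < Y s i" "L a i = L b i"
    | (zero) s where "s \<in> {a..b}" "Y s i = 0" "L s i = L b i"
  by (rule last_zero[OF reflectsD(5,3,2,6)[OF assms(1,2)] assms(3-5)])

lemma bounded_on_interval:
  fixes f :: "real \<Rightarrow> nat \<Rightarrow> real"
  assumes "\<And>i. i < d \<Longrightarrow> continuous_on {0..T} (\<lambda>s. f s i)"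
  obtains K where "0 \<le> K" "\<And>i s. i < d \<Longrightarrow> s \<in> {0..T} \<Longrightarrow> \<bar>f s i\<bar> \<le> K"
proof -
  have "\<exists>k. \<forall>s\<in>{0..T}. \<bar>f s i\<bar> \<le> k" if "i < d" for i
  proof -
    have "bounded ((\<lambda>s. f s i) ` {0..T})"
      using assms[OF that] by (intro compact_imp_bounded compact_continuous_image) auto
    then show ?thesis by (auto simp: bounded_iff)
  qed
  then obtain k where k: "\<And>i s. i < d \<Longrightarrow> s \<in> {0..T} \<Longrightarrow> \<bar>f s i\<bar> \<le> k i" by metis
  show ?thesis
  proof (rule that[of "\<Sum>i<d. \<bar>k i\<bar>"])
    show "0 \<le> (\<Sum>i<d. \<bar>k i\<bar>)" by (simp add: sum_nonneg)
  next
    fix i s assume ind: "i < d" "s \<in> {0..T}"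
    have "\<bar>k i\<bar> \<le> (\<Sum>i<d. \<bar>k i\<bar>)" using ind by (intro member_le_sum) auto
    then show "\<bar>f s i\<bar> \<le> (\<Sum>i<d. \<bar>k i\<bar>)" using k[OF ind] by linarith
  qed
qed

text \<open>
  Moving the right end of a drawdown of \<open>L' - L\<close> back to a zero of \<open>Y\<close> and the left end back to a
  zero of \<open>Y'\<close> can only increase it, and there the Skorokhod equations bound it by \<open>P\<close> applied to
  the drawdowns of all coordinates. So every bound on the drawdowns improves by the factor \<open>\<rho>\<close>.
\<close>

lemma pushing_difference_mono:
  assumes r: "reflects T u Y L" and r': "reflects T u' Y' L'"
    and uu: "\<And>i s t. i < d \<Longrightarrow> 0 \<le> s \<Longrightarrow> s \<le> t \<Longrightarrow> t \<le> T \<Longrightarrow> u t i - u' t i = u s i - u' s i"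
    and u0: "\<And>i. i < d \<Longrightarrow> u' 0 i \<le> u 0 i"
    and i: "i < d" and st: "0 \<le> s" "s \<le> t" "t \<le> T"
  shows "L' s i - L s i \<le> L' t i - L t i"
proof -
  define D where "D s i = L' s i - L s i" for s i
  define S where "S = {(s, t, i). i < d \<and> 0 \<le> s \<and> s \<le> t \<and> t \<le> T}"
  define f where "f = (\<lambda>(s, t, i). (D s i - D t i) / w i)"
  have "continuous_on {0..T} (\<lambda>s. D s i)" if "i < d" for i
    unfolding D_def using reflectsD(2)[OF r that] reflectsD(2)[OF r' that] by (intro continuous_intros)
  then obtain K where K: "0 \<le> K" "\<And>i s. i < d \<Longrightarrow> s \<in> {0..T} \<Longrightarrow> \<bar>D s i\<bar> \<le> K"
    using bounded_on_interval[of T D] by blast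
  have "f x \<le> 0" if "x \<in> S" for x
  proof (rule zero_bound_of_contraction[of \<rho> S f "2 * K"])
    fix x assume "x \<in> S"
    then obtain s t i where x: "x = (s, t, i)" and *: "i < d" "0 \<le> s" "s \<le> t" "t \<le> T"
      by (auto simp: S_def)
    have "D s i - D t i \<le> 2 * K * 1" using K(2)[of i s] K(2)[of i t] * by auto
    also have "\<dots> \<le> 2 * K * w i" using K(1) w_ge_1[OF *(1)] by (intro mult_left_mono) auto
    finally show "f x \<le> 2 * K" using w_pos[OF *(1)] by (simp add: f_def x field_simps)
  next
    fix e x assume e: "0 \<le> e" and le: "\<And>x. x \<in> S \<Longrightarrow> f x \<le> e" and "x \<in> S"
    then obtain s t i where x: "x = (s, t, i)" and i: "i < d" and st: "0 \<le> s" "s \<le> t" "t \<le> T"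
      by (auto simp: S_def)
    have bound: "D a j - D b j \<le> e * w j" if "j < d" "0 \<le> a" "a \<le> b" "b \<le> T" for a b j
      using le[of "(a, b, j)"] that w_pos[of j] by (auto simp: S_def f_def field_simps)
    have "D s i - D t i \<le> \<rho> * e * w i"
    proof (cases rule: reflects_last_zero[OF r i st])
      case 1
      then have "D s i - D t i \<le> 0" using reflectsD(8)[OF r' i st] by (simp add: D_def)
      also have "0 \<le> \<rho> * e * w i" using rho e w_pos[OF i] by simp
      finally show ?thesis .
    next
      case (2 t')
      then have t': "s \<le> t'" "t' \<le> t" by auto
      have Dt: "D t' i \<le> D t i"
        using 2 reflectsD(8)[OF r' i, of t' t] t' st by (simp add: D_def)
      \<comment> \<open>A time where \<open>Y - Y'\<close> is nonnegative and the drawdown is no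
        smaller. If \<open>Y'\<close> has no zero on \<open>{0..s}\<close>, then \<open>L'\<close>
        is flat there and time 0 serves, since the starting points are ordered. At \<open>t'\<close>
        the difference \<open>Y - Y'\<close> is nonpositive, and \<open>u - u'\<close> cancels
        between the two times.\<close>
      obtain s' where s': "0 \<le> s'" "s' \<le> s" "D s i \<le> D s' i" "Y' s' i \<le> Y s' i"
      proof (cases rule: reflects_last_zero[OF r' i order.refl st(1) order.trans[OF st(2,3)]])
        case 1
        have "Y' 0 i \<le> Y 0 i"
          using reflectsD(7)[OF r i, of 0] reflectsD(7)[OF r' i, of 0] reflectsD(1)[OF r] reflectsD(1)[OF r'] u0[OF i] i st
          by simp
        moreover have "D s i \<le> D 0 i"
          using 1 reflectsD(8)[OF r i, of 0 s] st by (simp add: D_def)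
        ultimately show ?thesis using that[of 0] st by simp
      next
        case (2 s')
        then have "D s i \<le> D s' i" using reflectsD(8)[OF r i, of s' s] st by (simp add: D_def)
        then show ?thesis using that[of s'] 2 reflectsD(6)[OF r i, of s'] st by simp
      qed
      have "Y t' i \<le> Y' t' i" using 2 reflectsD(6)[OF r' i, of t'] st by auto
      then have "(Y t' i - Y' t' i) - (Y s' i - Y' s' i) \<le> 0" using s' by simp
      moreover have "(Y t' i - Y' t' i) - (Y s' i - Y' s' i)
         = (D s' i - D t' i) - (\<Sum>j<d. P i j * (D s' j - D t' j))"
        using reflectsD(7)[OF r i, of t'] reflectsD(7)[OF r i, of s']
          reflectsD(7)[OF r' i, of t'] reflectsD(7)[OF r' i, of s'] uu[OF i, of s' t'] s' t' st
        by (simp add: D_def sum_subtractf sum.distrib algebra_simps)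
      ultimately have "D s' i - D t' i \<le> (\<Sum>j<d. P i j * (D s' j - D t' j))" by simp
      also have "\<dots> \<le> \<rho> * e * w i"
        using i e s' t' st by (intro P_sum_le bound) auto
      finally show ?thesis using s' Dt by simp
    qed
    then show "f x \<le> \<rho> * e" using w_pos[OF i] by (simp add: f_def x field_simps)
  qed (use that rho in auto)
  then have "f (s, t, i) \<le> 0" using i st by (auto simp: S_def)
  then show ?thesis using w_pos[OF i] by (simp add: f_def D_def divide_le_0_iff)
qed

text \<open>Comparison in both directions: \<open>L' - L\<close> and \<open>L - L'\<close> are
  nondecreasing and vanish at 0.\<close>

lemma reflects_unique:
  assumes r: "reflects T u Y L" and r': "reflects T u Y' L'" and i: "i < d" and t: "t \<in> {0..T}"
  shows "L t i = L' t i" "Y t i = Y' t i"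
proof -
  have eq: "L t i = L' t i" if "i < d" for i
    using pushing_difference_mono[OF r r' _ _ that, of 0 t]
      pushing_difference_mono[OF r' r _ _ that, of 0 t]
      reflectsD(1)[OF r that] reflectsD(1)[OF r' that] t by simp
  then show "L t i = L' t i" "Y t i = Y' t i"
    using reflectsD(7)[OF r i t] reflectsD(7)[OF r' i t] i by simp_all
qed

text \<open>From the last zero of \<open>Y'\<close> (or time 0) up to \<open>t\<close>,
  \<open>L'\<close> does not push coordinate \<open>i\<close>, and then neither does
  \<open>L\<close>, because \<open>L' - L\<close> is nondecreasing. So over this period
  \<open>Y - Y'\<close> changes only by \<open>P\<close> applied to the nonnegative increments of
  \<open>L' - L\<close>.\<close>

lemma reflects_state_mono:
  assumes r: "reflects T u Y L" and r': "reflects T u' Y' L'"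
    and uu: "\<And>i s t. i < d \<Longrightarrow> 0 \<le> s \<Longrightarrow> s \<le> t \<Longrightarrow> t \<le> T \<Longrightarrow> u t i - u' t i = u s i - u' s i"
    and u0: "\<And>i. i < d \<Longrightarrow> u' 0 i \<le> u 0 i"
    and i: "i < d" and t: "t \<in> {0..T}"
  shows "Y' t i \<le> Y t i"
proof -
  have t0: "0 \<le> t" "t \<le> T" using t by auto
  obtain s where s: "0 \<le> s" "s \<le> t" "L' s i = L' t i" "Y' s i \<le> Y s i"
  proof (cases rule: reflects_last_zero[OF r' i order.refl t0])
    case 1
    have "Y' 0 i \<le> Y 0 i"
      using reflectsD(7)[OF r i, of 0] reflectsD(7)[OF r' i, of 0] reflectsD(1)[OF r] reflectsD(1)[OF r'] u0[OF i] i t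
      by simp
    then show ?thesis using 1 that[of 0] t by simp
  next
    case (2 s)
    then show ?thesis using that[of s] reflectsD(6)[OF r i, of s] t by simp
  qed
  have mono: "L' s j - L s j \<le> L' t j - L t j" if "j < d" for j
    using pushing_difference_mono[OF r r' uu u0 that] s t by auto
  have "(\<Sum>j<d. P i j * (L' s j - L s j)) \<le> (\<Sum>j<d. P i j * (L' t j - L t j))"
    using mono P_nonneg i by (intro sum_mono mult_left_mono) auto
  moreover have "L s i = L t i"
    using mono[OF i] s(3) reflectsD(8)[OF r i, of s t] s t by simp
  ultimately show ?thesis
    using reflectsD(7)[OF r i, of t] reflectsD(7)[OF r i, of s]
      reflectsD(7)[OF r' i, of t] reflectsD(7)[OF r' i, of s] uu[OF i, of s t] s t
    by (simp add: sum_subtractf algebra_simps)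
qed

end

section \<open>Existence of reflected paths\<close>

text \<open>The explicit one-dimensional solution: \<open>f + reflection_term f\<close> is
  \<open>f\<close> reflected at 0, provided \<open>f\<close> starts at a nonnegative value.\<close>

definition reflection_term :: "(real \<Rightarrow> real) \<Rightarrow> real \<Rightarrow> real" where
  "reflection_term f t = (SUP s\<in>{0..t}. max 0 (- f s))"

context
  fixes f :: "real \<Rightarrow> real" and T :: real
  assumes cont: "continuous_on {0..T} f"
begin

lemma reflection_term_bdd: "t \<le> T \<Longrightarrow> bdd_above ((\<lambda>s. max 0 (- f s)) ` {0..t})"
  using continuous_on_subset[OF cont, of "{0..t}"]
  by (intro bounded_imp_bdd_above compact_imp_bounded compact_continuous_image continuous_intros) auto

lemma reflection_term_upper:
  "0 \<le> s \<Longrightarrow> s \<le> t \<Longrightarrow> t \<le> T \<Longrightarrow> max 0 (- f s) \<le> reflection_term f t"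
  unfolding reflection_term_def by (intro cSUP_upper reflection_term_bdd) auto

lemma reflection_term_mono: "0 \<le> s \<Longrightarrow> s \<le> t \<Longrightarrow> t \<le> T \<Longrightarrow> reflection_term f s \<le> reflection_term f t"
  unfolding reflection_term_def by (intro cSUP_subset_mono reflection_term_bdd) auto

lemma reflection_term_attained:
  assumes "0 \<le> t" "t \<le> T"
  obtains s where "0 \<le> s" "s \<le> t" "reflection_term f t = max 0 (- f s)"
proof -
  have "continuous_on {0..t} (\<lambda>s. max 0 (- f s))"
    using continuous_on_subset[OF cont, of "{0..t}"] assms by (intro continuous_intros) auto
  then obtain s where s: "s \<in> {0..t}" "\<And>r. r \<in> {0..t} \<Longrightarrow> max 0 (- f r) \<le> max 0 (- f s)"
    using continuous_attains_sup[of "{0..t}" "\<lambda>s. max 0 (- f s)"] assms by (auto simp del: max.bounded_iff)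
  have "reflection_term f t \<le> max 0 (- f s)"
    unfolding reflection_term_def using assms s by (intro cSUP_least) auto
  with reflection_term_upper[of s t] s assms show ?thesis by (intro that[of s]) auto
qed

text \<open>Enlarging the supremum from \<open>{0..s}\<close> to \<open>{0..t}\<close> adds at most
  the oscillation of \<open>f\<close> on \<open>{s..t}\<close>.\<close>

lemma reflection_term_continuous: "continuous_on {0..T} (reflection_term f)"
proof -
  have "uniformly_continuous_on {0..T} f"
    using cont by (intro compact_uniformly_continuous) auto
  then have *: "\<exists>\<delta>>0. \<forall>x\<in>{0..T}. \<forall>y\<in>{0..T}. dist y x < \<delta> \<longrightarrow> dist (f y) (f x) < e" if "0 < e" for e
    using that unfolding uniformly_continuous_on_def by blast
  have close: "reflection_term f t \<le> reflection_term f s + e"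
    if e: "0 < e" and st: "0 \<le> s" "s \<le> t" "t \<le> T" and
      \<delta>: "\<forall>x\<in>{0..T}. \<forall>y\<in>{0..T}. dist y x < \<delta> \<longrightarrow> dist (f y) (f x) < e" "dist s t < \<delta>" for s t e \<delta>
  proof -
    obtain r where r: "0 \<le> r" "r \<le> t" "reflection_term f t = max 0 (- f r)"
      using reflection_term_attained[of t] st by auto
    show ?thesis
    proof (cases "r \<le> s")
      case True then show ?thesis using r e reflection_term_upper[of r s] st by linarith
    next
      case False
      then have "dist (f r) (f s) < e" using \<delta> st r by (auto simp: dist_real_def)
      then have "max 0 (- f r) \<le> max 0 (- f s) + e" by (auto simp: dist_real_def)
      then show ?thesis using r reflection_term_upper[of s s] st by linarith
    qed
  qed
  have "\<exists>\<delta>>0. \<forall>y\<in>{0..T}. dist y x < \<delta> \<longrightarrow> dist (reflection_term f y) (reflection_term f x) < e"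
    if x: "x \<in> {0..T}" and e: "0 < e" for x e
  proof -
    obtain \<delta> where \<delta>: "\<delta> > 0" "\<forall>x\<in>{0..T}. \<forall>y\<in>{0..T}. dist y x < \<delta> \<longrightarrow> dist (f y) (f x) < e / 2"
      using *[of "e / 2"] e by auto
    have "dist (reflection_term f y) (reflection_term f x) < e" if y: "y \<in> {0..T}" "dist y x < \<delta>" for y
    proof (cases "x \<le> y")
      case True
      then show ?thesis
        using close[of "e / 2" x y \<delta>] reflection_term_mono[of x y] x y e \<delta>(2)
        by (auto simp: dist_real_def abs_minus_commute)
    next
      case False
      then show ?thesis
        using close[of "e / 2" y x \<delta>] reflection_term_mono[of y x] x y e \<delta>(2)
        by (auto simp: dist_real_def abs_minus_commute)
    qed
    then show ?thesis using \<delta>(1) by blast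
  qed
  then show ?thesis unfolding continuous_on_iff by blast
qed

text \<open>Let \<open>r\<close> attain the supremum over \<open>{0..b}\<close>. If \<open>r\<close>
  lies after \<open>a\<close>, the reflected path is positive at \<open>r\<close>, so
  \<open>- f r\<close> is strictly below the supremum, which can then only be the constant 0 in
  \<open>max 0 (- f r)\<close>.\<close>

lemma reflection_term_flat: "flat_off_zeros T (\<lambda>s. f s + reflection_term f s) (reflection_term f)"
  unfolding flat_off_zeros_def
proof (intro allI impI)
  fix a b :: real
  assume ab: "0 \<le> a" "a \<le> b" "b \<le> T" and pos: "\<forall>s\<in>{a..b}. 0 < f s + reflection_term f s"
  obtain r where r: "0 \<le> r" "r \<le> b" "reflection_term f b = max 0 (- f r)"
    using reflection_term_attained[of b] ab by auto
  show "reflection_term f a = reflection_term f b"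
  proof (cases "r \<le> a")
    case True
    then show ?thesis using reflection_term_upper[of r a] reflection_term_mono[of a b] r ab by linarith
  next
    case False
    then have "r \<in> {a..b}" using r by simp
    then have "- f r < reflection_term f r" using pos by fastforce
    also have "\<dots> \<le> reflection_term f b" using reflection_term_mono[of r b] r ab by simp
    finally have "reflection_term f b = 0" using r(3) by (simp add: max_def split: if_splits)
    then show ?thesis using reflection_term_upper[of a a] reflection_term_mono[of a b] ab by simp
  qed
qed

lemma reflection_term_start: "0 \<le> T \<Longrightarrow> 0 \<le> f 0 \<Longrightarrow> reflection_term f 0 = 0"
  by (simp add: reflection_term_def)

end

text \<open>Each supremum is compared with the other function at its own maximiser. This is the
  Lipschitz constant 1 that lets the factor \<open>\<rho>\<close> of \<open>P\<close> survive in the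
  Picard iteration.\<close>

lemma reflection_term_nonexpansive:
  assumes "continuous_on {0..T} f" "continuous_on {0..T} g" "0 \<le> t" "t \<le> T"
    and le: "\<And>s. s \<in> {0..T} \<Longrightarrow> \<bar>f s - g s\<bar> \<le> c"
  shows "\<bar>reflection_term f t - reflection_term g t\<bar> \<le> c"
proof -
  have *: "reflection_term f t \<le> reflection_term g t + c"
    if c: "continuous_on {0..T} f" "continuous_on {0..T} g"
      and le: "\<And>s. s \<in> {0..T} \<Longrightarrow> \<bar>f s - g s\<bar> \<le> c" for f g
  proof -
    obtain r where r: "0 \<le> r" "r \<le> t" "reflection_term f t = max 0 (- f r)"
      using reflection_term_attained[OF c(1) assms(3,4)] .
    have "max 0 (- f r) \<le> max 0 (- g r) + c" using le[of r] r assms(3,4) by (auto simp: max_def)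
    then show ?thesis using r reflection_term_upper[OF c(2) r(1,2) assms(4)] by linarith
  qed
  have "\<And>s. s \<in> {0..T} \<Longrightarrow> \<bar>g s - f s\<bar> \<le> c" using le by (simp add: abs_minus_commute)
  then show ?thesis using *[OF assms(1,2) le] *[OF assms(2,1)] by fastforce
qed

context contraction_weights
begin

text \<open>Iteration for the fixed point equation \<open>L = reflection_term (u - P L)\<close>:
  each coordinate solves its one-dimensional problem while the pushing of the others is frozen at
  the previous iterate.\<close>

fun picard :: "(real \<Rightarrow> nat \<Rightarrow> real) \<Rightarrow> nat \<Rightarrow> real \<Rightarrow> nat \<Rightarrow> real" where
  "picard u 0 s i = 0"
| "picard u (Suc n) s i = reflection_term (\<lambda>s. u s i - (\<Sum>j<d. P i j * picard u n s j)) s"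

context
  fixes u :: "real \<Rightarrow> nat \<Rightarrow> real" and T :: real
  assumes cont: "\<And>i. i < d \<Longrightarrow> continuous_on {0..T} (\<lambda>s. u s i)" and T: "0 \<le> T"
    and start: "\<And>i. i < d \<Longrightarrow> 0 \<le> u 0 i"
begin

abbreviation (input) picard_free :: "nat \<Rightarrow> nat \<Rightarrow> real \<Rightarrow> real" where
  "picard_free n i s \<equiv> u s i - (\<Sum>j<d. P i j * picard u n s j)"

lemma picard_cont: "i < d \<Longrightarrow> continuous_on {0..T} (\<lambda>s. picard u n s i)"
proof (induction n arbitrary: i)
  case (Suc n)
  have "continuous_on {0..T} (picard_free n i)"
    using Suc cont by (intro continuous_intros) auto
  then show ?case using reflection_term_continuous by simp
qed simp

lemma picard_free_cont: "i < d \<Longrightarrow> continuous_on {0..T} (picard_free n i)"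
  using picard_cont cont by (intro continuous_intros) auto

lemma picard_start: "i < d \<Longrightarrow> picard u n 0 i = 0"
proof (induction n arbitrary: i)
  case (Suc n)
  then show ?case using reflection_term_start[OF picard_free_cont[OF Suc.prems, of n] T] start by simp
qed simp

lemma picard_geometric:
  obtains c where "0 \<le> c"
    "\<And>n i s. i < d \<Longrightarrow> s \<in> {0..T} \<Longrightarrow> \<bar>picard u (Suc n) s i - picard u n s i\<bar> \<le> c * \<rho> ^ n * w i"
proof -
  obtain c where c: "0 \<le> c" "\<And>i s. i < d \<Longrightarrow> s \<in> {0..T} \<Longrightarrow> \<bar>picard u 1 s i\<bar> \<le> c"
    using bounded_on_interval[of T "picard u 1", OF picard_cont] by blast
  have "\<bar>picard u (Suc n) s i - picard u n s i\<bar> \<le> c * \<rho> ^ n * w i" if "i < d" "s \<in> {0..T}" for n i s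
    using that
  proof (induction n arbitrary: i s)
    case 0
    have "\<bar>picard u 1 s i\<bar> \<le> c * 1" using c(2)[OF 0] by simp
    also have "\<dots> \<le> c * w i" using c(1) w_ge_1[OF 0(1)] by (intro mult_left_mono) auto
    finally show ?case by simp
  next
    case (Suc n)
    have "\<bar>picard_free (Suc n) i r - picard_free n i r\<bar> \<le> c * \<rho> ^ Suc n * w i" if "r \<in> {0..T}" for r
    proof -
      have "\<bar>picard_free (Suc n) i r - picard_free n i r\<bar>
          = \<bar>\<Sum>j<d. P i j * (picard u (Suc n) r j - picard u n r j)\<bar>"
        by (simp add: sum_subtractf right_diff_distrib abs_minus_commute del: picard.simps)
      also have "\<dots> \<le> (\<Sum>j<d. P i j * \<bar>picard u (Suc n) r j - picard u n r j\<bar>)"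
        using P_nonneg Suc.prems by (intro order_trans[OF sum_abs] sum_mono) (auto simp: abs_mult)
      also have "\<dots> \<le> \<rho> * (c * \<rho> ^ n) * w i"
        using Suc.IH[OF _ that] c rho by (intro P_sum_le Suc.prems) auto
      finally show ?thesis by (simp add: algebra_simps)
    qed
    then show ?case
      using reflection_term_nonexpansive[OF picard_free_cont[OF Suc.prems(1), of "Suc n"]
          picard_free_cont[OF Suc.prems(1), of n]] Suc.prems(2)
      by (simp only: picard.simps) auto
  qed
  then show ?thesis using c that by blast
qed

lemma picard_converges:
  obtains L where "\<And>i. i < d \<Longrightarrow> uniform_limit {0..T} (\<lambda>n s. picard u n s i) (\<lambda>s. L s i) sequentially"
proof -
  obtain c where c: "0 \<le> c"
    "\<And>n i s. i < d \<Longrightarrow> s \<in> {0..T} \<Longrightarrow> \<bar>picard u (Suc n) s i - picard u n s i\<bar> \<le> c * \<rho> ^ n * w i"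
    by (rule picard_geometric) blast
  have "uniform_limit {0..T} (\<lambda>n s. picard u n s i) (\<lambda>s. \<Sum>n. picard u (Suc n) s i - picard u n s i) sequentially"
    if i: "i < d" for i
  proof -
    have "uniform_limit {0..T} (\<lambda>n s. \<Sum>k<n. picard u (Suc k) s i - picard u k s i)
       (\<lambda>s. \<Sum>k. picard u (Suc k) s i - picard u k s i) sequentially"
      by (rule Weierstrass_m_test[where M = "\<lambda>n. c * \<rho> ^ n * w i"])
        (use c(2) i rho in \<open>auto intro!: summable_mult2 summable_mult simp del: picard.simps\<close>)
    moreover have "(\<Sum>k<n. picard u (Suc k) s i - picard u k s i) = picard u n s i" for n s
      using sum_lessThan_telescope[of "\<lambda>n. picard u n s i" n] by simp
    ultimately show ?thesis by simp
  qed
  then show ?thesis by (rule that[of "\<lambda>s i. \<Sum>n. picard u (Suc n) s i - picard u n s i"])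
qed

lemma reflects_exists: "\<exists>Y L. reflects T u Y L"
proof -
  obtain L where L: "\<And>i. i < d \<Longrightarrow> uniform_limit {0..T} (\<lambda>n s. picard u n s i) (\<lambda>s. L s i) sequentially"
    using picard_converges by blast
  define Y where "Y s i = u s i + L s i - (\<Sum>j<d. P i j * L s j)" for s i
  have lim: "(\<lambda>n. picard u n s i) \<longlonglongrightarrow> L s i" if "i < d" "s \<in> {0..T}" for s i
    using tendsto_uniform_limitI[OF L[OF that(1)] that(2)] .
  have Lc: "continuous_on {0..T} (\<lambda>s. L s i)" if "i < d" for i
    by (rule uniform_limit_theorem[OF _ L[OF that]]) (use picard_cont that in auto)
  have Yc: "continuous_on {0..T} (\<lambda>s. Y s i)" if "i < d" for i
    unfolding Y_def using Lc cont that by (intro continuous_intros) auto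
  \<comment> \<open>The index shift makes \<open>Yn n\<close> the exact one-dimensional reflection
    whose pushing term is \<open>picard u (Suc n)\<close>. Nonnegativity and flatness thus hold for
    every \<open>n\<close> and only have to survive the limit.\<close>
  define Yn where "Yn n s i = picard_free n i s + picard u (Suc n) s i" for n s i
  have Yu: "uniform_limit {0..T} (\<lambda>n s. Yn n s i) (\<lambda>s. Y s i) sequentially" if i: "i < d" for i
  proof -
    have "uniform_limit {0..T} (\<lambda>n s. \<Sum>j<d. P i j * picard u n s j) (\<lambda>s. \<Sum>j<d. P i j * L s j) sequentially"
    proof -
      have "uniform_limit {0..T} (\<lambda>n s. \<Sum>j\<in>J. P i j * picard u n s j) (\<lambda>s. \<Sum>j\<in>J. P i j * L s j) sequentially"
        if "finite J" "J \<subseteq> {..<d}" for J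
        using that
      proof (induction J)
        case (insert j J)
        have "uniform_limit {0..T} (\<lambda>n s. P i j * picard u n s j) (\<lambda>s. P i j * L s j) sequentially"
          using bounded_linear.uniform_limit[OF bounded_linear_mult_right L[of j]] insert.prems by simp
        then show ?case using insert by (simp add: uniform_limit_add)
      qed (simp add: uniform_limit_const)
      then show ?thesis by blast
    qed
    moreover have "uniform_limit {0..T} (\<lambda>n s. picard u (Suc n) s i) (\<lambda>s. L s i) sequentially"
      using filterlim_compose[OF L[OF i] filterlim_Suc] .
    ultimately have "uniform_limit {0..T} (\<lambda>n s. u s i - (\<Sum>j<d. P i j * picard u n s j) + picard u (Suc n) s i)
      (\<lambda>s. u s i - (\<Sum>j<d. P i j * L s j) + L s i) sequentially"
      by (intro uniform_limit_intros)
    then show ?thesis by (simp add: Y_def Yn_def algebra_simps del: picard.simps)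
  qed
  have Yn_nonneg: "0 \<le> Yn n s i" if "i < d" "s \<in> {0..T}" for n s i
    using reflection_term_upper[OF picard_free_cont[OF that(1)], of s s n] that(2)
    by (simp add: Yn_def)
  have Y_nonneg: "0 \<le> Y s i" if "i < d" "s \<in> {0..T}" for s i
    by (rule LIMSEQ_le_const[OF tendsto_uniform_limitI[OF Yu[OF that(1)] that(2)]]) (use Yn_nonneg that in auto)
  have mono: "L s i \<le> L t i" if "i < d" "0 \<le> s" "s \<le> t" "t \<le> T" for i s t
  proof (rule LIMSEQ_le[OF lim lim])
    show "\<exists>N. \<forall>n\<ge>N. picard u n s i \<le> picard u n t i"
    proof (intro exI allI impI)
      fix n :: nat
      show "picard u n s i \<le> picard u n t i"
        by (cases n) (use reflection_term_mono[OF picard_free_cont[OF that(1)] that(2-4)] in auto)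
    qed
  qed (use that in auto)
  have flat: "flat_off_zeros T (\<lambda>s. Y s i) (\<lambda>s. L s i)" if i: "i < d" for i
    unfolding flat_off_zeros_def
  proof (intro allI impI)
    fix a b :: real
    assume ab: "0 \<le> a" "a \<le> b" "b \<le> T" and pos: "\<forall>s\<in>{a..b}. 0 < Y s i"
    have "continuous_on {a..b} (\<lambda>s. Y s i)" using Yc[OF i] by (rule continuous_on_subset) (use ab in auto)
    then obtain r where r: "r \<in> {a..b}" "\<And>s. s \<in> {a..b} \<Longrightarrow> Y r i \<le> Y s i"
      using continuous_attains_inf[of "{a..b}" "\<lambda>s. Y s i"] ab by auto
    \<comment> \<open>On \<open>{a..b}\<close> the limit stays above its minimum
      \<open>Y r i > 0\<close>, so uniform convergence makes \<open>Yn n\<close> positive there for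
      large \<open>n\<close>, and the iterate is already flat.\<close>
    have "\<forall>\<^sub>F n in sequentially. \<forall>s\<in>{0..T}. dist (Yn n s i) (Y s i) < Y r i"
      using uniform_limitD[OF Yu[OF i]] pos r(1) by blast
    then have "\<forall>\<^sub>F n in sequentially. picard u (Suc n) a i = picard u (Suc n) b i"
    proof eventually_elim
      case (elim n)
      have "0 < Yn n s i" if "s \<in> {a..b}" for s
      proof -
        have "dist (Yn n s i) (Y s i) < Y r i" using elim that ab by auto
        then show ?thesis using r(2)[OF that] by (auto simp: dist_real_def)
      qed
      then show ?case
        using reflection_term_flat[OF picard_free_cont[OF i, of n]] ab
        by (simp add: flat_off_zeros_def Yn_def)
    qed
    moreover have "(\<lambda>n. picard u (Suc n) a i) \<longlonglongrightarrow> L a i"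
      using LIMSEQ_Suc[OF lim[OF i, of a]] ab by simp
    ultimately have "(\<lambda>n. picard u (Suc n) b i) \<longlonglongrightarrow> L a i"
      by (rule Lim_transform_eventually[rotated])
    moreover have "(\<lambda>n. picard u (Suc n) b i) \<longlonglongrightarrow> L b i"
      using LIMSEQ_Suc[OF lim[OF i, of b]] ab by simp
    ultimately show "L a i = L b i" by (rule LIMSEQ_unique)
  qed
  have "L 0 i = 0" if "i < d" for i
    using lim[OF that, of 0] T LIMSEQ_unique[OF _ tendsto_const] by (simp add: picard_start[OF that])
  then have "reflects T u Y L"
    unfolding reflects_def using Lc Yc flat Y_nonneg mono by (auto simp: mono_on_def Y_def)
  then show ?thesis by blast
qed

end

end

section \<open>Complementarity integral and flatness\<close>

lemma clamp_continuous:
  fixes f :: "real \<Rightarrow> real"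
  assumes "0 \<le> T" "continuous_on {0..T} f"
  shows "continuous_on UNIV (\<lambda>u. f (max 0 (min T u)))"
  by (rule continuous_on_compose2[OF assms(2)]) (use assms(1) in \<open>auto intro!: continuous_intros\<close>)

context
  fixes T :: real and Y L F :: "real \<Rightarrow> real"
  assumes T: "0 \<le> T" and cL: "continuous_on {0..T} L" and mL: "mono_on {0..T} L"
    and cY: "continuous_on {0..T} Y"
  defines "F \<equiv> \<lambda>u. L (max 0 (min T u))"
begin

lemma clamp_mono: "x \<le> y \<Longrightarrow> F x \<le> F y"
  unfolding F_def using mL T by (auto simp: mono_on_def)

lemma emeasure_clamp:
  assumes "0 \<le> a" "a \<le> b" "b \<le> T"
  shows "emeasure (interval_measure F) {a..b} = ennreal (L b - L a)"
proof -
  have "emeasure (interval_measure F) {a..b} = ennreal (F b - F a)"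
    using clamp_mono clamp_continuous[OF T cL] assms(2)
    by (intro emeasure_interval_measure_Icc) (auto simp: F_def)
  then show ?thesis using assms by (simp add: F_def)
qed

text \<open>The minimum of \<open>Y\<close> on \<open>{a..b}\<close>, which is positive, times the
  mass \<open>L b - L a\<close> is a lower bound of the integral.\<close>

lemma flat_if_complementary:
  assumes int: "(\<integral>\<^sup>+u\<in>{0..T}. ennreal (Y u) \<partial>interval_measure F) = 0"
  shows "flat_off_zeros T Y L"
  unfolding flat_off_zeros_def
proof (intro allI impI)
  fix a b :: real
  assume ab: "0 \<le> a" "a \<le> b" "b \<le> T" and pos: "\<forall>s\<in>{a..b}. 0 < Y s"
  have "continuous_on {a..b} Y" using cY by (rule continuous_on_subset) (use ab in auto)
  then obtain r where r: "r \<in> {a..b}" "\<And>s. s \<in> {a..b} \<Longrightarrow> Y r \<le> Y s"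
    using continuous_attains_inf[of "{a..b}" Y] ab by auto
  have Yr: "0 < Y r" using pos r by blast
  have "ennreal (Y r) * emeasure (interval_measure F) {a..b}
      = (\<integral>\<^sup>+u. ennreal (Y r) * indicator {a..b} u \<partial>interval_measure F)"
    by (simp add: nn_integral_cmult_indicator)
  also have "\<dots> \<le> (\<integral>\<^sup>+u\<in>{0..T}. ennreal (Y u) \<partial>interval_measure F)"
    using r(2) ab by (intro nn_integral_mono) (auto simp: indicator_def intro!: ennreal_leI)
  finally have "ennreal (Y r) * ennreal (L b - L a) = 0"
    using int emeasure_clamp[OF ab] by simp
  then have "L b - L a \<le> 0" using Yr by (simp add: ennreal_eq_0_iff)
  moreover have "L a \<le> L b" using mL ab by (auto simp: mono_on_def)
  ultimately show "L a = L b" by simp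
qed

text \<open>Intervals with rational endpoints on which \<open>Y\<close> is positive cover the set
  where \<open>Y\<close> is positive. They are countably many, and flatness makes each of them a
  null set.\<close>

lemma complementary_if_flat:
  assumes flat: "flat_off_zeros T Y L" and s: "s \<in> {0..T}"
  shows "(\<integral>\<^sup>+u\<in>{0..s}. ennreal (Y u) \<partial>interval_measure F) = 0"
proof -
  define J where "J = {(p, q). p \<in> \<rat> \<and> q \<in> \<rat> \<and> (\<forall>r\<in>{p..q} \<inter> {0..T}. 0 < Y r)}"
  define U where "U = (\<Union>(p, q)\<in>J. {p..q} \<inter> {0..T})"
  have "J \<subseteq> \<rat> \<times> \<rat>" by (auto simp: J_def)
  then have cJ: "countable J" by (rule countable_subset) (intro countable_SIGMA countable_rat)
  have "{p..q} \<inter> {0..T} \<in> null_sets (interval_measure F)" if "(p, q) \<in> J" for p q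
  proof (cases "max 0 p \<le> min T q")
    case True
    have eq: "{p..q} \<inter> {0..T} = {max 0 p..min T q}" by auto
    have "L (max 0 p) = L (min T q)"
      using flat that True unfolding flat_off_zeros_def J_def eq by auto
    then show ?thesis using emeasure_clamp[of "max 0 p" "min T q"] True unfolding eq null_sets_def by simp
  next
    case False
    then have "{p..q} \<inter> {0..T} = {}" by auto
    then show ?thesis by simp
  qed
  then have U: "U \<in> null_sets (interval_measure F)"
    unfolding U_def using cJ by (intro null_sets_UN') auto
  have sub: "u \<in> U" if u: "u \<in> {0..T}" "0 < Y u" for u
  proof -
    obtain \<delta> where \<delta>: "0 < \<delta>" "\<And>r. r \<in> {0..T} \<Longrightarrow> dist r u < \<delta> \<Longrightarrow> dist (Y r) (Y u) < Y u"
      using cY u unfolding continuous_on_iff by meson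
    obtain p where p: "p \<in> \<rat>" "u - \<delta> < p" "p < u" using Rats_dense_in_real[of "u - \<delta>" u] \<delta> by auto
    obtain q where q: "q \<in> \<rat>" "u < q" "q < u + \<delta>" using Rats_dense_in_real[of u "u + \<delta>"] \<delta> by auto
    have "0 < Y r" if "r \<in> {p..q} \<inter> {0..T}" for r
    proof -
      have "dist r u < \<delta>" using that p q by (auto simp: dist_real_def)
      then show ?thesis using \<delta>(2)[of r] that by (auto simp: dist_real_def)
    qed
    then have "(p, q) \<in> J" using p q by (auto simp: J_def)
    moreover have "u \<in> {p..q} \<inter> {0..T}" using u p q by simp
    ultimately show ?thesis unfolding U_def by blast
  qed
  \<comment> \<open>Outside \<open>U\<close> the integrand vanishes, also where \<open>Y\<close> is
    negative, as \<open>ennreal\<close> truncates; on the null set \<open>U\<close> even the bound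
    \<open>\<top>\<close> costs nothing.\<close>
  have "(\<integral>\<^sup>+u\<in>{0..s}. ennreal (Y u) \<partial>interval_measure F) \<le> (\<integral>\<^sup>+u. \<top> * indicator U u \<partial>interval_measure F)"
  proof (intro nn_integral_mono)
    fix u
    show "ennreal (Y u) * indicator {0..s} u \<le> \<top> * indicator U u"
      using sub[of u] s by (cases "0 < Y u") (auto simp: indicator_def ennreal_neg not_less)
  qed
  also have "\<dots> = 0" using U by (subst nn_integral_cmult_indicator) (auto simp: null_sets_def)
  finally show ?thesis by simp
qed

end

section \<open>The Skorokhod problem in matrix form\<close>

lemma reflection_matrix_mult:
  assumes "Q \<in> carrier_mat d d" "i < d"
  shows "(reflection_matrix d Q *\<^sub>v vec d v) $ i = v i - (\<Sum>j<d. Q $$ (j, i) * v j)"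
proof -
  have "(reflection_matrix d Q *\<^sub>v vec d v) $ i = (\<Sum>j<d. ((if i = j then 1 else 0) - Q $$ (j, i)) * v j)"
    using assms by (simp add: reflection_matrix_def mult_mat_vec_def scalar_prod_def lessThan_atLeast0)
  also have "\<dots> = (\<Sum>j<d. (if i = j then v j else 0)) - (\<Sum>j<d. Q $$ (j, i) * v j)"
    by (simp add: left_diff_distrib sum_subtractf if_distrib[of "\<lambda>c. c * _"] cong: if_cong)
  finally show ?thesis using assms by simp
qed

locale skorokhod_problem = contraction_weights d "\<lambda>i j. Q $$ (j, i)" w \<rho>
  for d :: nat and Q :: "real mat" and w :: "nat \<Rightarrow> real" and \<rho> :: real +
  assumes Q: "Q \<in> carrier_mat d d"
begin

text \<open>Continuity of \<open>Y\<close>, which only \<open>reflects\<close> demands, comes from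
  the equation for \<open>Y\<close>; the rest is the equivalence of the two forms of
  complementarity.\<close>

lemma skorokhod_solution_iff_reflects:
  assumes T: "0 \<le> T" and cx: "\<And>i. i < d \<Longrightarrow> continuous_on {0..T} (\<lambda>s. x s i)"
  shows "skorokhod_solution d (reflection_matrix d Q) T y x Y L \<longleftrightarrow> reflects T (\<lambda>s i. y i + x s i) Y L"
proof
  assume sol: "skorokhod_solution d (reflection_matrix d Q) T y x Y L"
  have Yeq: "0 \<le> Y s i \<and> Y s i = y i + x s i + L s i - (\<Sum>j<d. Q $$ (j, i) * L s j)"
    if "i < d" "s \<in> {0..T}" for s i
  proof -
    have "0 \<le> Y s i \<and> Y s i = y i + x s i + (reflection_matrix d Q *\<^sub>v vec d (L s)) $ i"
      using sol that unfolding skorokhod_solution_def by blast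
    then show ?thesis unfolding reflection_matrix_mult[OF Q that(1)] add_diff_eq .
  qed
  have L: "L 0 i = 0" "continuous_on {0..T} (\<lambda>s. L s i)" "mono_on {0..T} (\<lambda>s. L s i)" if "i < d" for i
    using sol that unfolding skorokhod_solution_def by auto
  have cY: "continuous_on {0..T} (\<lambda>s. Y s i)" if "i < d" for i
  proof -
    have "continuous_on {0..T} (\<lambda>s. y i + x s i + L s i - (\<Sum>j<d. Q $$ (j, i) * L s j))"
      using L(2) cx that by (intro continuous_intros) auto
    moreover have "continuous_on {0..T} (\<lambda>s. Y s i) \<longleftrightarrow>
        continuous_on {0..T} (\<lambda>s. y i + x s i + L s i - (\<Sum>j<d. Q $$ (j, i) * L s j))"
      by (rule continuous_on_cong[OF refl]) (use Yeq[OF that] in blast)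
    ultimately show ?thesis by blast
  qed
  have "flat_off_zeros T (\<lambda>s. Y s i) (\<lambda>s. L s i)" if "i < d" for i
  proof (rule flat_if_complementary[OF T L(2)[OF that] L(3)[OF that] cY[OF that]])
    show "(\<integral>\<^sup>+u\<in>{0..T}. ennreal (Y u i) \<partial>interval_measure (\<lambda>u. L (max 0 (min T u)) i)) = 0"
      using sol that T unfolding skorokhod_solution_def by auto
  qed
  then show "reflects T (\<lambda>s i. y i + x s i) Y L"
    unfolding reflects_def using L cY Yeq by blast
next
  assume r: "reflects T (\<lambda>s i. y i + x s i) Y L"
  have "(\<integral>\<^sup>+u\<in>{0..s}. ennreal (Y u i) \<partial>interval_measure (\<lambda>u. L (max 0 (min T u)) i)) = 0"
    if "i < d" "s \<in> {0..T}" for i s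
    using complementary_if_flat[OF T reflectsD(2,4,3,5)[OF r that(1)] that(2)] .
  moreover have "Y s i = y i + x s i + (reflection_matrix d Q *\<^sub>v vec d (L s)) $ i"
    if "i < d" "s \<in> {0..T}" for i s
    unfolding reflection_matrix_mult[OF Q that(1)] using reflectsD(7)[OF r that] by linarith
  ultimately show "skorokhod_solution d (reflection_matrix d Q) T y x Y L"
    unfolding skorokhod_solution_def using reflectsD(1,2,4,6)[OF r] by blast
qed

text \<open>Existence and uniqueness give the definite description in \<open>reflected_path\<close>
  its meaning. From here on reflected paths are used through this lemma only.\<close>

lemma reflected_path_reflects:
  assumes T: "0 \<le> T" and cx: "\<And>i. i < d \<Longrightarrow> continuous_on {0..T} (\<lambda>s. x s i)"
    and x0: "\<And>i. i < d \<Longrightarrow> x 0 i = 0" and y: "\<And>i. i < d \<Longrightarrow> 0 \<le> y i"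
  obtains Y L where "reflects T (\<lambda>s i. y i + x s i) Y L"
    "\<And>i. i < d \<Longrightarrow> reflected_path d (reflection_matrix d Q) T y x i = Y T i"
proof -
  have iff: "skorokhod_solution d (reflection_matrix d Q) T y x Y L \<longleftrightarrow> reflects T (\<lambda>s i. y i + x s i) Y L"
    for Y L by (rule skorokhod_solution_iff_reflects[OF T cx])
  have "\<exists>Y L. reflects T (\<lambda>s i. y i + x s i) Y L"
    using cx x0 y by (intro reflects_exists T continuous_intros) auto
  then obtain Y L where r: "reflects T (\<lambda>s i. y i + x s i) Y L" by blast
  have "reflected_path d (reflection_matrix d Q) T y x i = Y T i" if "i < d" for i
  proof -
    have "(THE v. \<exists>Y L. skorokhod_solution d (reflection_matrix d Q) T y x Y L \<and> Y T i = v) = Y T i"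
    proof (rule the_equality)
      show "\<exists>Y' L'. skorokhod_solution d (reflection_matrix d Q) T y x Y' L' \<and> Y' T i = Y T i"
        using r iff by blast
      show "v = Y T i" if "\<exists>Y' L'. skorokhod_solution d (reflection_matrix d Q) T y x Y' L' \<and> Y' T i = v" for v
        using that reflects_unique(2)[OF _ r \<open>i < d\<close>, of _ _ T] iff T by auto
    qed
    then show ?thesis using that by (simp add: reflected_path_def)
  qed
  then show ?thesis using that r by blast
qed

end

section \<open>Workload and contraction over a time block\<close>

text \<open>\<open>Ri\<close> is the inverse of \<open>1 - P\<close>, as identities on vectors.
  \<open>Ri_left\<close> turns \<open>R L\<close> into \<open>L\<close>; \<open>Ri_right\<close>
  yields the fixed point equation of the workload.\<close>

locale reflection_inverse = contraction_weights +
  fixes Ri :: "nat \<Rightarrow> nat \<Rightarrow> real"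
  assumes Ri_nonneg: "\<And>i j. i < d \<Longrightarrow> j < d \<Longrightarrow> 0 \<le> Ri i j"
    and Ri_left: "\<And>i v. i < d \<Longrightarrow> (\<Sum>j<d. Ri i j * (v j - (\<Sum>k<d. P j k * v k))) = v i"
    and Ri_right: "\<And>i v. i < d \<Longrightarrow>
      (\<Sum>j<d. Ri i j * v j) - (\<Sum>k<d. P i k * (\<Sum>j<d. Ri k j * v j)) = v i"
begin

text \<open>Multiplication by \<open>R^-1\<close>. In these coordinates the reflection decouples:
  \<open>L i\<close> moves only coordinate \<open>i\<close>
  (\<open>workload_reflects\<close>).\<close>

definition workload :: "(nat \<Rightarrow> real) \<Rightarrow> nat \<Rightarrow> real" where
  "workload y i = (\<Sum>j<d. Ri i j * y j)"

lemma workload_nonneg: "i < d \<Longrightarrow> (\<And>j. j < d \<Longrightarrow> 0 \<le> y j) \<Longrightarrow> 0 \<le> workload y i"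
  unfolding workload_def using Ri_nonneg by (intro sum_nonneg) auto

lemma workload_diff: "workload (\<lambda>j. x j - y j) i = workload x i - workload y i"
  by (simp add: workload_def algebra_simps sum_subtractf)

lemma workload_cong: "(\<And>j. j < d \<Longrightarrow> x j = y j) \<Longrightarrow> workload x i = workload y i"
  by (simp add: workload_def)

text \<open>The source of every factor \<open>\<rho>\<close> below: where \<open>y i = 0\<close>,
  coordinate \<open>i\<close> of the workload is \<open>P\<close> applied to the workload.\<close>

lemma workload_fixpoint: "i < d \<Longrightarrow> workload y i = y i + (\<Sum>k<d. P i k * workload y k)"
  using Ri_right[of i y] by (simp add: workload_def)

lemma le_workload: "i < d \<Longrightarrow> (\<And>j. j < d \<Longrightarrow> 0 \<le> y j) \<Longrightarrow> y i \<le> workload y i"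
  using workload_fixpoint[of i y] workload_nonneg[of _ y] P_nonneg[of i]
    sum_nonneg[of "{..<d}" "\<lambda>k. P i k * workload y k"] by simp

lemma workload_reflects:
  assumes "reflects T u Y L" "s \<in> {0..T}" "i < d"
  shows "workload (Y s) i = workload (u s) i + L s i"
proof -
  have "workload (Y s) i = workload (\<lambda>j. u s j + (L s j - (\<Sum>k<d. P j k * L s k))) i"
    using reflectsD(7)[OF assms(1) _ assms(2)] by (intro workload_cong) (simp add: algebra_simps)
  also have "\<dots> = workload (u s) i + L s i"
    using Ri_left[OF assms(3), of "L s"] by (simp add: workload_def distrib_left sum.distrib)
  finally show ?thesis .
qed

text \<open>The vector \<open>w - P w\<close> is at least \<open>1 - \<rho>\<close> in every
  coordinate; applying the nonnegative \<open>Ri\<close> to it gives back \<open>w\<close>.\<close>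

lemma row_sum_le:
  assumes i: "i < d" and c: "w i \<le> c"
  shows "(\<Sum>j<d. Ri i j) \<le> c / (1 - \<rho>)"
proof -
  have "(1 - \<rho>) * (\<Sum>j<d. Ri i j) = (\<Sum>j<d. Ri i j * (1 - \<rho>))"
    by (simp add: sum_distrib_left mult.commute)
  also have "\<dots> \<le> (\<Sum>j<d. Ri i j * (w j - (\<Sum>k<d. P j k * w k)))"
  proof (intro sum_mono mult_left_mono)
    fix j assume "j \<in> {..<d}"
    then have j: "j < d" by simp
    have "1 * (1 - \<rho>) \<le> w j * (1 - \<rho>)" using w_ge_1[OF j] rho by (intro mult_right_mono) auto
    then show "1 - \<rho> \<le> w j - (\<Sum>k<d. P j k * w k)" using P_w_le[OF j] by (simp add: algebra_simps)
  qed (use Ri_nonneg i in auto)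
  also have "\<dots> = w i" using Ri_left[OF i] .
  finally show ?thesis using rho c by (simp add: field_simps)
qed

text \<open>One time block \<open>{a..b}\<close>, with all quantities in units of \<open>w\<close>:
  \<open>m\<close> bounds the initial workload, \<open>\<delta>\<close> is the drift, and
  \<open>G\<close> bounds what the noise can add between any two times of the block.\<close>

context
  fixes T u Y L a b m G \<delta>
  assumes r: "reflects T u Y L" and ab: "0 \<le> a" "a \<le> b" "b \<le> T"
    and m: "0 \<le> m" and G: "0 \<le> G" and \<delta>: "0 \<le> \<delta>"
    and start: "\<And>i. i < d \<Longrightarrow> workload (Y a) i \<le> m * w i"
    and fluct: "\<And>i s t. i < d \<Longrightarrow> a \<le> s \<Longrightarrow> s \<le> t \<Longrightarrow> t \<le> b \<Longrightarrow>
      workload (u t) i - workload (u s) i \<le> (G - \<delta> * (t - s)) * w i"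
begin

lemma workload_increment:
  assumes "i < d" "a \<le> s" "s \<le> t" "t \<le> b" "L s i = L t i"
  shows "workload (Y t) i \<le> workload (Y s) i + (G - \<delta> * (t - s)) * w i"
  using workload_reflects[OF r _ assms(1), of s] workload_reflects[OF r _ assms(1), of t]
    fluct[OF assms(1-4)] assms ab by simp

lemma workload_after_zero:
  assumes "i < d" "a \<le> s" "s \<le> t" "t \<le> b" "L s i = L t i" "Y s i = 0"
    and "0 \<le> c" "\<And>j. j < d \<Longrightarrow> workload (Y s) j \<le> c * w j"
  shows "workload (Y t) i \<le> (\<rho> * c + G) * w i"
proof -
  have "workload (Y s) i \<le> \<rho> * c * w i"
    using workload_fixpoint[OF assms(1), of "Y s"] P_sum_le[OF assms(1,7,8)] assms(6) by simp
  moreover have "(G - \<delta> * (t - s)) * w i \<le> G * w i"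
    using w_pos[OF assms(1)] \<delta> assms by (intro mult_right_mono) auto
  ultimately show ?thesis
    using workload_increment[OF assms(1-5)] by (simp add: algebra_simps)
qed

text \<open>A coordinate either has been positive since \<open>a\<close> and gained at most
  \<open>G\<close>, or it comes from a zero, where its workload was at most \<open>\<rho>\<close>
  times the overall bound. Hence the excess over \<open>m + G / (1 - \<rho>)\<close> improves by the
  factor \<open>\<rho>\<close>.\<close>

lemma workload_block_sup:
  assumes i: "i < d" and t: "a \<le> t" "t \<le> b"
  shows "workload (Y t) i \<le> (m + G / (1 - \<rho>)) * w i"
proof -
  \<comment> \<open>\<open>G / (1 - \<rho>)\<close> sums the geometric series of gains
    \<open>G\<close> over successive zeros; it is what makes
    \<open>\<rho> * M + G \<le> M\<close>.\<close>
  define M where "M = m + G / (1 - \<rho>)"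
  have GM: "G \<le> G / (1 - \<rho>)" using G rho by (simp add: field_simps)
  have "\<rho> * M + G = \<rho> * m + G / (1 - \<rho>)" using rho by (simp add: M_def field_simps)
  then have M: "\<rho> * M + G \<le> M" "m + G \<le> M" "0 \<le> M"
    using rho m G GM mult_right_mono[of \<rho> 1 m] by (auto simp: M_def)
  define S where "S = {(t, i). i < d \<and> a \<le> t \<and> t \<le> b}"
  define f where "f = (\<lambda>(t, i). workload (Y t) i / w i - M)"
  have "continuous_on {0..T} (\<lambda>s. workload (Y s) i)" if "i < d" for i
    unfolding workload_def using reflectsD(3)[OF r] by (intro continuous_intros) auto
  then obtain K where K: "0 \<le> K" "\<And>i s. i < d \<Longrightarrow> s \<in> {0..T} \<Longrightarrow> \<bar>workload (Y s) i\<bar> \<le> K"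
    using bounded_on_interval[of T "\<lambda>s. workload (Y s)"] by blast
  have "f x \<le> 0" if "x \<in> S" for x
  proof (rule zero_bound_of_contraction[of \<rho> S f K])
    fix x assume "x \<in> S"
    then obtain t i where x: "x = (t, i)" "i < d" "a \<le> t" "t \<le> b" by (auto simp: S_def)
    have "workload (Y t) i \<le> K * 1" using K(2)[of i t] x ab by auto
    also have "\<dots> \<le> K * w i" using K(1) w_ge_1[OF x(2)] by (intro mult_left_mono) auto
    finally have "workload (Y t) i / w i \<le> K" using w_pos[OF x(2)] by (simp add: field_simps)
    then show "f x \<le> K" using M by (simp add: f_def x)
  next
    fix e x assume e: "0 \<le> e" and le: "\<And>x. x \<in> S \<Longrightarrow> f x \<le> e" and "x \<in> S"
    then obtain t i where x: "x = (t, i)" and i: "i < d" and t: "a \<le> t" "t \<le> b"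
      by (auto simp: S_def)
    have bound: "workload (Y s) j \<le> (M + e) * w j" if "j < d" "a \<le> s" "s \<le> b" for s j
      using le[of "(s, j)"] that w_pos[of j] by (auto simp: S_def f_def field_simps)
    have "workload (Y t) i \<le> (M + \<rho> * e) * w i"
    proof (cases rule: reflects_last_zero[OF r i ab(1) t(1) order.trans[OF t(2) ab(3)]])
      case 1
      have "workload (Y t) i \<le> m * w i + (G - \<delta> * (t - a)) * w i"
        using workload_increment[OF i order.refl t 1(2)] start[OF i] by simp
      also have "\<dots> = (m + G - \<delta> * (t - a)) * w i" by (simp add: algebra_simps)
      also have "\<dots> \<le> (M + \<rho> * e) * w i"
      proof (rule mult_right_mono)
        have "0 \<le> \<delta> * (t - a)" "0 \<le> \<rho> * e" using \<delta> t rho e by simp_all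
        then show "m + G - \<delta> * (t - a) \<le> M + \<rho> * e" using M(2) by linarith
      qed (use w_pos[OF i] in simp)
      finally show ?thesis .
    next
      case (2 s)
      have "workload (Y t) i \<le> (\<rho> * (M + e) + G) * w i"
        using 2 t e M by (intro workload_after_zero[OF i, of s] bound) auto
      also have "\<dots> \<le> (M + \<rho> * e) * w i"
        using M(1) w_pos[OF i] by (intro mult_right_mono) (auto simp: algebra_simps)
      finally show ?thesis .
    qed
    then show "f x \<le> \<rho> * e" using w_pos[OF i] by (simp add: f_def x field_simps)
  qed (use that rho in auto)
  then have "f (t, i) \<le> 0" using i t by (auto simp: S_def)
  then show ?thesis using w_pos[OF i] by (simp add: f_def M_def[symmetric] field_simps)
qed

text \<open>The two entries of \<open>max\<close> are the two fates of a coordinate: a visit to zero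
  contracts its workload, and no visit lets the drift act during the whole block.\<close>

lemma workload_block_end:
  assumes i: "i < d"
  shows "workload (Y b) i \<le> (max (\<rho> * m) (m - \<delta> * (b - a)) + G / (1 - \<rho>)) * w i"
proof (cases rule: reflects_last_zero[OF r i ab])
  case 1
  have "G \<le> G / (1 - \<rho>)" using G rho by (simp add: field_simps)
  have "workload (Y b) i \<le> (m - \<delta> * (b - a) + G) * w i"
    using workload_increment[OF i order.refl ab(2) order.refl 1(2)] start[OF i] by (simp add: algebra_simps)
  also have "\<dots> \<le> (max (\<rho> * m) (m - \<delta> * (b - a)) + G / (1 - \<rho>)) * w i"
    using \<open>G \<le> G / (1 - \<rho>)\<close> w_pos[OF i] by (intro mult_right_mono) auto
  finally show ?thesis .
next
  case (2 s)
  have "workload (Y b) i \<le> (\<rho> * (m + G / (1 - \<rho>)) + G) * w i"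
    using 2 m G rho by (intro workload_after_zero[OF i, of s] workload_block_sup) auto
  also have "\<rho> * (m + G / (1 - \<rho>)) + G = \<rho> * m + G / (1 - \<rho>)"
    using rho by (simp add: field_simps)
  also have "(\<rho> * m + G / (1 - \<rho>)) * w i \<le> (max (\<rho> * m) (m - \<delta> * (b - a)) + G / (1 - \<rho>)) * w i"
    using w_pos[OF i] by (intro mult_right_mono) auto
  finally show ?thesis .
qed

text \<open>A coordinate that stayed positive would be driven to a negative workload.\<close>

lemma hits_zero:
  assumes i: "i < d" and "m + G < \<delta> * (b - a)"
  obtains s where "a \<le> s" "s \<le> b" "Y s i = 0"
proof (cases rule: reflects_last_zero[OF r i ab])
  case 1
  have "workload (Y b) i \<le> (m - \<delta> * (b - a) + G) * w i"
    using workload_increment[OF i order.refl ab(2) order.refl 1(2)] start[OF i] by (simp add: algebra_simps)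
  also have "\<dots> < 0" using assms w_pos[OF i] by (intro mult_neg_pos) auto
  finally have "workload (Y b) i < 0" .
  moreover have "0 \<le> workload (Y b) i"
    using reflectsD(6)[OF r] ab by (intro workload_nonneg[OF i]) auto
  ultimately show ?thesis by simp
next
  case (2 s)
  then show ?thesis using that by auto
qed

end

section \<open>The gap between two solutions driven by the same path\<close>

definition gap :: "(real \<Rightarrow> nat \<Rightarrow> real) \<Rightarrow> (real \<Rightarrow> nat \<Rightarrow> real) \<Rightarrow> real \<Rightarrow> nat \<Rightarrow> real" where
  "gap Y Y' s i = workload (\<lambda>j. Y s j - Y' s j) i"

context
  fixes T u Y L u' Y' L' y
  assumes r: "reflects T u Y L" and r': "reflects T u' Y' L'"
    and uu: "\<And>s i. i < d \<Longrightarrow> s \<in> {0..T} \<Longrightarrow> u s i = y i + u' s i"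
    and y: "\<And>i. i < d \<Longrightarrow> 0 \<le> y i"
begin

lemma states_ordered:
  assumes "i < d" "t \<in> {0..T}"
  shows "Y' t i \<le> Y t i"
proof (rule reflects_state_mono[OF r r' _ _ assms])
  show "u' 0 j \<le> u 0 j" if "j < d" for j using uu[OF that, of 0] y[OF that] assms by simp
qed (use uu y in auto)

text \<open>The free paths differ by the constant \<open>y\<close>, so the gap moves only through
  \<open>L' - L\<close> and inherits its monotonicity.\<close>

lemma gap_eq: "i < d \<Longrightarrow> s \<in> {0..T} \<Longrightarrow> gap Y Y' s i = workload y i - (L' s i - L s i)"
proof -
  assume *: "i < d" "s \<in> {0..T}"
  have "workload (u s) i = workload y i + workload (u' s) i"
    using uu * by (simp add: workload_def distrib_left sum.distrib)
  then show ?thesis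
    using workload_reflects[OF r *(2,1)] workload_reflects[OF r' *(2,1)]
    by (simp add: gap_def workload_diff)
qed

lemma gap_antimono:
  assumes "i < d" "0 \<le> a" "a \<le> b" "b \<le> T"
  shows "gap Y Y' b i \<le> gap Y Y' a i"
proof -
  have "L' a i - L a i \<le> L' b i - L b i"
  proof (rule pushing_difference_mono[OF r r' _ _ assms])
    show "u' 0 j \<le> u 0 j" if "j < d" for j using uu[OF that, of 0] y[OF that] assms by simp
  qed (use uu y assms in auto)
  then show ?thesis using gap_eq[of i a] gap_eq[of i b] assms by simp
qed

lemma gap_bounds_difference:
  assumes "i < d" "s \<in> {0..T}"
  shows "\<bar>Y s i - Y' s i\<bar> \<le> gap Y Y' s i"
  using le_workload[OF assms(1), of "\<lambda>j. Y s j - Y' s j"] states_ordered assms by (simp add: gap_def)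

text \<open>At the zero \<open>s\<close> of \<open>Y\<close> the difference \<open>Y - Y'\<close> is
  nonpositive in coordinate \<open>i\<close>, so the fixed point equation bounds the gap by
  \<open>P\<close> applied to it. Monotonicity carries the bound to \<open>b\<close>; hence each
  coordinate may use a zero of its own.\<close>

lemma gap_contracts:
  assumes ab: "0 \<le> a" "a \<le> b" "b \<le> T" and i: "i < d" and v: "0 \<le> v"
    and le: "\<And>j. j < d \<Longrightarrow> gap Y Y' a j \<le> v * w j"
    and s: "a \<le> s" "s \<le> b" "Y s i = 0"
  shows "gap Y Y' b i \<le> \<rho> * v * w i"
proof -
  have "gap Y Y' b i \<le> gap Y Y' s i" using gap_antimono[OF i, of s b] ab s by simp
  also have "\<dots> = - Y' s i + (\<Sum>k<d. P i k * gap Y Y' s k)"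
    using workload_fixpoint[OF i, of "\<lambda>j. Y s j - Y' s j"] s by (simp add: gap_def)
  also have "\<dots> \<le> (\<Sum>k<d. P i k * gap Y Y' s k)"
    using reflectsD(6)[OF r' i, of s] s ab by simp
  also have "\<dots> \<le> \<rho> * v * w i"
  proof (rule P_sum_le[OF i v])
    fix j assume "j < d"
    then show "gap Y Y' s j \<le> v * w j" using gap_antimono[of j a s] le[of j] ab s by simp
  qed
  finally show ?thesis .
qed

end

end

text \<open>
  The first summand is for blocks that contract or start at a large workload, the second one for
  those whose oscillation \<open>g\<close> exceeds \<open>\<alpha> / 2\<close>, where \<open>exp (\<zeta> (g - \<alpha> / 2)) \<ge> 1\<close>.
\<close>

definition potential_factor :: "real \<Rightarrow> real \<Rightarrow> real \<Rightarrow> real \<Rightarrow> real \<Rightarrow> real" where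
  "potential_factor \<rho> \<theta> \<zeta> \<alpha> g =
     \<rho>\<^sup>2 * exp (\<theta> * g) + exp ((\<theta> + \<zeta>) * g - \<zeta> * \<alpha> / 2)"

text \<open>For \<open>m \<ge> \<alpha> / 2\<close> both entries of \<open>max\<close> lie at least
  \<open>(1 - \<rho>) * \<alpha> / 2\<close> below \<open>m\<close>.\<close>

lemma drift_factor:
  fixes \<rho> :: real
  assumes rho: "0 < \<rho>" "\<rho> < 1" and m: "\<alpha> / 2 \<le> m" and \<theta>: "0 \<le> \<theta>" and \<alpha>: "0 \<le> \<alpha>"
  shows "exp (\<theta> * (max (\<rho> * m) (m - \<alpha>) + g)) \<le> exp (- \<theta> * (1 - \<rho>) * \<alpha> / 2) * exp (\<theta> * m) * exp (\<theta> * g)"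
proof -
  have "(1 - \<rho>) * (\<alpha> / 2) \<le> (1 - \<rho>) * m" using m rho by (intro mult_left_mono) auto
  moreover have "(1 - \<rho>) * \<alpha> / 2 \<le> 1 * \<alpha>" using rho \<alpha> mult_right_mono[of "1 - \<rho>" 2 \<alpha>] by simp
  ultimately have "max (\<rho> * m) (m - \<alpha>) + g \<le> m - (1 - \<rho>) * \<alpha> / 2 + g"
    by (auto simp: max_def algebra_simps)
  then have "\<theta> * (max (\<rho> * m) (m - \<alpha>) + g) \<le> \<theta> * (m - (1 - \<rho>) * \<alpha> / 2 + g)"
    using \<theta> by (rule mult_left_mono)
  also have "\<dots> = - \<theta> * (1 - \<rho>) * \<alpha> / 2 + \<theta> * m + \<theta> * g"
    by (simp add: field_simps)
  finally show ?thesis by (simp only: exp_add[symmetric] exp_le_cancel_iff)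
qed

text \<open>Three cases. From a workload above \<open>\<alpha> / 2\<close> the gap need not
  contract, but the drift gains \<open>\<rho>^2\<close> in the exponential; this is what the
  condition on \<open>2 * ln (1 / \<rho>)\<close> secures. If \<open>m\<close> and \<open>g\<close>
  are both below \<open>\<alpha> / 2\<close>, their sum is below \<open>\<alpha>\<close> and
  \<open>v^2\<close> gains \<open>\<rho>^2\<close>. For large \<open>g\<close> the second summand of
  the factor pays.\<close>

lemma potential_step:
  fixes \<rho> :: real
  assumes rho: "0 < \<rho>" "\<rho> < 1" and mg: "0 \<le> m" "0 \<le> g" and v: "0 \<le> v" "0 \<le> v'" "v' \<le> v"
    and contr: "m + g < \<alpha> \<Longrightarrow> v' \<le> \<rho> * v"
    and par: "0 \<le> \<theta>" "0 \<le> \<zeta>" "0 \<le> \<alpha>" "2 * ln (1 / \<rho>) \<le> \<theta> * (1 - \<rho>) * \<alpha> / 2"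
  shows "v'\<^sup>2 * exp (\<theta> * (max (\<rho> * m) (m - \<alpha>) + g)) \<le> v\<^sup>2 * exp (\<theta> * m) * potential_factor \<rho> \<theta> \<zeta> \<alpha> g"
proof (cases "\<alpha> / 2 \<le> m")
  case True
  have "exp (- \<theta> * (1 - \<rho>) * \<alpha> / 2) \<le> exp (2 * ln \<rho>)"
    using par rho by (simp add: ln_div)
  also have "\<dots> = \<rho>\<^sup>2" using rho exp_of_nat_mult[of 2 "ln \<rho>"] by simp
  finally have *: "exp (- \<theta> * (1 - \<rho>) * \<alpha> / 2) \<le> \<rho>\<^sup>2" .
  have "exp (\<theta> * (max (\<rho> * m) (m - \<alpha>) + g)) \<le> exp (- \<theta> * (1 - \<rho>) * \<alpha> / 2) * exp (\<theta> * m) * exp (\<theta> * g)"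
    by (rule drift_factor) (use rho True par in auto)
  also have "\<dots> \<le> \<rho>\<^sup>2 * exp (\<theta> * m) * exp (\<theta> * g)" using * by (intro mult_right_mono) auto
  also have "\<dots> \<le> exp (\<theta> * m) * potential_factor \<rho> \<theta> \<zeta> \<alpha> g"
    by (simp add: potential_factor_def distrib_left)
  finally have "v'\<^sup>2 * exp (\<theta> * (max (\<rho> * m) (m - \<alpha>) + g)) \<le> v\<^sup>2 * (exp (\<theta> * m) * potential_factor \<rho> \<theta> \<zeta> \<alpha> g)"
    using v by (intro mult_mono) (auto intro: power_mono)
  then show ?thesis by (simp add: mult.assoc)
next
  case False
  have "max (\<rho> * m) (m - \<alpha>) \<le> m" using mg rho par mult_right_mono[of \<rho> 1 m] by simp
  then have "\<theta> * (max (\<rho> * m) (m - \<alpha>) + g) \<le> \<theta> * (m + g)" using par by (intro mult_left_mono) auto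
  then have E: "exp (\<theta> * (max (\<rho> * m) (m - \<alpha>) + g)) \<le> exp (\<theta> * m) * exp (\<theta> * g)"
    by (simp add: exp_add[symmetric] algebra_simps)
  show ?thesis
  proof (cases "g < \<alpha> / 2")
    case True
    then have "v' \<le> \<rho> * v" using contr False by simp
    then have "v'\<^sup>2 \<le> (\<rho> * v)\<^sup>2" using v by (intro power_mono) auto
    then have "v'\<^sup>2 * exp (\<theta> * (max (\<rho> * m) (m - \<alpha>) + g)) \<le> (\<rho> * v)\<^sup>2 * (exp (\<theta> * m) * exp (\<theta> * g))"
      using E by (intro mult_mono) auto
    also have "\<dots> \<le> v\<^sup>2 * exp (\<theta> * m) * potential_factor \<rho> \<theta> \<zeta> \<alpha> g"
      by (simp add: potential_factor_def algebra_simps power_mult_distrib)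
    finally show ?thesis .
  next
    case g: False
    have "0 \<le> \<zeta> * (g - \<alpha> / 2)" using g par by (intro mult_nonneg_nonneg) auto
    then have "exp (\<theta> * g) \<le> exp ((\<theta> + \<zeta>) * g - \<zeta> * \<alpha> / 2)" by (simp add: algebra_simps)
    also have "\<dots> \<le> potential_factor \<rho> \<theta> \<zeta> \<alpha> g" by (simp add: potential_factor_def)
    finally have "exp (\<theta> * m) * exp (\<theta> * g) \<le> exp (\<theta> * m) * potential_factor \<rho> \<theta> \<zeta> \<alpha> g" by simp
    then have "v'\<^sup>2 * exp (\<theta> * (max (\<rho> * m) (m - \<alpha>) + g)) \<le> v\<^sup>2 * (exp (\<theta> * m) * potential_factor \<rho> \<theta> \<zeta> \<alpha> g)"
      using v order_trans[OF E] by (intro mult_mono) (auto intro: power_mono)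
    then show ?thesis by (simp add: mult.assoc)
  qed
qed

context reflection_inverse
begin

text \<open>Induction over blocks with bounds \<open>v\<close> of the gap and \<open>n\<close> of
  the workload. Initially the gap is bounded by the workload of \<open>y\<close>, so
  \<open>m\<close> serves as both.\<close>

lemma gap_after_blocks:
  assumes r: "reflects T u Y L" and r': "reflects T u' Y' L'"
    and uu: "\<And>s i. i < d \<Longrightarrow> s \<in> {0..T} \<Longrightarrow> u s i = y i + u' s i"
    and y: "\<And>i. i < d \<Longrightarrow> 0 \<le> y i"
    and u'0: "\<And>i. i < d \<Longrightarrow> u' 0 i = 0"
    and \<tau>: "0 \<le> \<tau>" "real k * \<tau> \<le> T" and G: "\<And>j. 0 \<le> G j"
    and fluct: "\<And>j i s t. j < k \<Longrightarrow> i < d \<Longrightarrow> real j * \<tau> \<le> s \<Longrightarrow> s \<le> t \<Longrightarrow> t \<le> real (Suc j) * \<tau> \<Longrightarrow>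
      workload (u' t) i - workload (u' s) i \<le> (G j - \<delta> * (t - s)) * w i"
    and m: "0 \<le> m" "\<And>i. i < d \<Longrightarrow> workload y i \<le> m * w i"
    and par: "0 \<le> \<theta>" "0 \<le> \<zeta>" "0 \<le> \<delta>" "2 * ln (1 / \<rho>) \<le> \<theta> * (1 - \<rho>) * (\<delta> * \<tau>) / 2"
    and i: "i < d"
  shows "\<bar>Y T i - Y' T i\<bar>\<^sup>2 \<le> (w i)\<^sup>2 * (m\<^sup>2 * exp (\<theta> * m) * (\<Prod>j<k. potential_factor \<rho> \<theta> \<zeta> (\<delta> * \<tau>) (G j / (1 - \<rho>))))"
proof -
  let ?F = "\<lambda>j. potential_factor \<rho> \<theta> \<zeta> (\<delta> * \<tau>) (G j / (1 - \<rho>))"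
  have T: "0 \<le> T" using \<tau> by (meson mult_nonneg_nonneg of_nat_0_le_iff order_trans)
  have blocks: "\<exists>v n. 0 \<le> v \<and> 0 \<le> n \<and> (\<forall>i<d. gap Y Y' (real l * \<tau>) i \<le> v * w i) \<and>
      (\<forall>i<d. workload (Y (real l * \<tau>)) i \<le> n * w i) \<and>
      v\<^sup>2 * exp (\<theta> * n) \<le> m\<^sup>2 * exp (\<theta> * m) * (\<Prod>j<l. ?F j)" if "l \<le> k" for l
    using that
  proof (induction l)
    case 0
    have "gap Y Y' 0 i \<le> m * w i" if "i < d" for i
      using gap_eq[OF r r' uu y that, of 0] reflectsD(1)[OF r that] reflectsD(1)[OF r' that] m(2)[OF that] T by simp
    moreover have "workload (Y 0) i \<le> m * w i" if "i < d" for i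
    proof -
      have "workload (u 0) i = workload y i" using uu[of _ 0] u'0 T by (intro workload_cong) auto
      then show ?thesis
        using workload_reflects[OF r _ that, of 0] reflectsD(1)[OF r that] m(2)[OF that] T by simp
    qed
    ultimately show ?case using m(1) by (intro exI[of _ m]) auto
  next
    case (Suc l)
    then obtain v n where vn: "0 \<le> v" "0 \<le> n" and
      gapl: "\<And>i. i < d \<Longrightarrow> gap Y Y' (real l * \<tau>) i \<le> v * w i" and
      wl: "\<And>i. i < d \<Longrightarrow> workload (Y (real l * \<tau>)) i \<le> n * w i" and
      pot: "v\<^sup>2 * exp (\<theta> * n) \<le> m\<^sup>2 * exp (\<theta> * m) * (\<Prod>j<l. ?F j)" by auto
    let ?a = "real l * \<tau>" and ?b = "real (Suc l) * \<tau>" and ?g = "G l / (1 - \<rho>)"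
    have "?b \<le> real k * \<tau>" using Suc.prems \<tau> by (intro mult_right_mono) auto
    then have ab: "0 \<le> ?a" "?a \<le> ?b" "?b \<le> T" using \<tau> by (auto simp: algebra_simps)
    have ba: "\<delta> * (?b - ?a) = \<delta> * \<tau>" by (simp add: algebra_simps)
    have Gg: "G l \<le> ?g" "0 \<le> ?g" using G[of l] rho mult_right_mono[of "1 - \<rho>" 1 "G l"] by (auto simp: field_simps)
    have fl: "workload (u t) i - workload (u s) i \<le> (G l - \<delta> * (t - s)) * w i"
      if "i < d" "?a \<le> s" "s \<le> t" "t \<le> ?b" for i s t
    proof -
      have "workload (u t) i - workload (u s) i = workload (u' t) i - workload (u' s) i"
        using that ab by (simp add: workload_def uu distrib_left sum.distrib)
      then show ?thesis using fluct[of l i s t] that Suc.prems by simp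
    qed
    \<comment> \<open>\<open>v\<close> shrinks exactly when \<open>hits_zero\<close> is sure to
      apply to all coordinates. As \<open>G l \<le> ?g\<close>, the same number \<open>?g\<close>
      can serve in this test and in the workload bound.\<close>
    define v' where "v' = (if n + ?g < \<delta> * \<tau> then \<rho> * v else v)"
    define n' where "n' = max (\<rho> * n) (n - \<delta> * \<tau>) + ?g"
    have v': "0 \<le> v'" "v' \<le> v" using rho vn mult_right_mono[of \<rho> 1 v] by (auto simp: v'_def)
    have n': "0 \<le> n'" using rho vn Gg by (simp add: n'_def le_max_iff_disj add_nonneg_nonneg)
    have "gap Y Y' ?b i \<le> v' * w i" if i: "i < d" for i
    proof (cases "n + ?g < \<delta> * \<tau>")
      case True
      then have "n + G l < \<delta> * (?b - ?a)" unfolding ba using Gg by linarith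
      from hits_zero[OF r ab vn(2) G par(3) wl fl i this]
      obtain s where "?a \<le> s" "s \<le> ?b" "Y s i = 0" by blast
      from gap_contracts[OF r r' uu y ab i vn(1) gapl this] show ?thesis
        using True by (simp add: v'_def)
    next
      case False
      then show ?thesis using gap_antimono[OF r r' uu y i ab] gapl[OF i] by (simp add: v'_def)
    qed
    moreover have "workload (Y ?b) i \<le> n' * w i" if "i < d" for i
      using workload_block_end[OF r ab vn(2) G par(3) wl fl that] unfolding ba n'_def .
    moreover have "v'\<^sup>2 * exp (\<theta> * n') \<le> v\<^sup>2 * exp (\<theta> * n) * ?F l"
      unfolding n'_def
      by (rule potential_step) (use rho vn Gg v' par \<tau> in \<open>auto simp: v'_def\<close>)
    moreover have "v\<^sup>2 * exp (\<theta> * n) * ?F l \<le> m\<^sup>2 * exp (\<theta> * m) * (\<Prod>j<Suc l. ?F j)"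
      using mult_right_mono[OF pot, of "?F l"] by (simp add: potential_factor_def mult.assoc)
    ultimately show ?case using v' n' by (intro exI[of _ v'] exI[of _ n']) auto
  qed
  obtain v n where vn: "0 \<le> v" "0 \<le> n" and
    gapk: "\<And>i. i < d \<Longrightarrow> gap Y Y' (real k * \<tau>) i \<le> v * w i" and
    pot: "v\<^sup>2 * exp (\<theta> * n) \<le> m\<^sup>2 * exp (\<theta> * m) * (\<Prod>j<k. ?F j)"
    using blocks[OF order.refl] by blast
  have "\<bar>Y T i - Y' T i\<bar> \<le> gap Y Y' T i" using gap_bounds_difference[OF r r' uu y i, of T] T by simp
  also have "\<dots> \<le> gap Y Y' (real k * \<tau>) i" using gap_antimono[OF r r' uu y i, of "real k * \<tau>" T] \<tau> by simp
  also have "\<dots> \<le> v * w i" by (rule gapk[OF i])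
  finally have "\<bar>Y T i - Y' T i\<bar>\<^sup>2 \<le> (v * w i)\<^sup>2" by (intro power_mono) auto
  also have "\<dots> = (w i)\<^sup>2 * (v\<^sup>2 * 1)" by (simp add: power_mult_distrib)
  \<comment> \<open>The exponential weight, at least 1, has done its work in the induction and is
    only used as an upper bound of 1.\<close>
  also have "\<dots> \<le> (w i)\<^sup>2 * (v\<^sup>2 * exp (\<theta> * n))"
    using par vn by (intro mult_left_mono) auto
  also have "\<dots> \<le> (w i)\<^sup>2 * (m\<^sup>2 * exp (\<theta> * m) * (\<Prod>j<k. ?F j))"
    using pot by (intro mult_left_mono) auto
  finally show ?thesis .
qed

text \<open>A Foster-Lyapunov inequality for one block: contraction above the level
  \<open>\<delta> * \<tau> / 2\<close>, a constant bound below it, and the sum covers both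
  cases.\<close>

lemma exp_workload_block:
  assumes r: "reflects \<tau> u Y L"
    and uu: "\<And>s i. i < d \<Longrightarrow> s \<in> {0..\<tau>} \<Longrightarrow> u s i = y i + x s i"
    and x0: "\<And>i. i < d \<Longrightarrow> x 0 i = 0"
    and \<tau>: "0 \<le> \<tau>" and G: "0 \<le> G"
    and fluct: "\<And>i s t. i < d \<Longrightarrow> 0 \<le> s \<Longrightarrow> s \<le> t \<Longrightarrow> t \<le> \<tau> \<Longrightarrow>
      workload (x t) i - workload (x s) i \<le> (G - \<delta> * (t - s)) * w i"
    and m: "0 \<le> m" "\<And>i. i < d \<Longrightarrow> workload y i \<le> m * w i"
    and par: "0 \<le> \<theta>" "0 \<le> \<delta>"
    and i: "i < d"
  shows "exp (\<theta> * (workload (Y \<tau>) i / w i)) \<le>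
    exp (\<theta> * (G / (1 - \<rho>))) * (exp (- \<theta> * (1 - \<rho>) * (\<delta> * \<tau>) / 2) * exp (\<theta> * m) + exp (\<theta> * (\<delta> * \<tau>) / 2))"
proof -
  let ?g = "G / (1 - \<rho>)"
  have start: "workload (Y 0) i \<le> m * w i" if "i < d" for i
  proof -
    have "workload (u 0) i = workload y i" using uu[of _ 0] x0 \<tau> by (intro workload_cong) auto
    then show ?thesis
      using workload_reflects[OF r _ that, of 0] reflectsD(1)[OF r that] m(2)[OF that] \<tau> by simp
  qed
  have fl: "workload (u t) i - workload (u s) i \<le> (G - \<delta> * (t - s)) * w i"
    if "i < d" "0 \<le> s" "s \<le> t" "t \<le> \<tau>" for i s t
  proof -
    have "workload (u t) i - workload (u s) i = workload (x t) i - workload (x s) i"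
      using that by (simp add: workload_def uu distrib_left sum.distrib)
    then show ?thesis using fluct[of i s t] that by simp
  qed
  have "workload (Y \<tau>) i \<le> (max (\<rho> * m) (m - \<delta> * (\<tau> - 0)) + ?g) * w i"
    by (rule workload_block_end[OF r order.refl \<tau> order.refl m(1) G par(2) start fl i])
  then have "workload (Y \<tau>) i / w i \<le> max (\<rho> * m) (m - \<delta> * \<tau>) + ?g"
    using w_pos[OF i] by (simp add: field_simps)
  then have 1: "exp (\<theta> * (workload (Y \<tau>) i / w i)) \<le> exp (\<theta> * (max (\<rho> * m) (m - \<delta> * \<tau>) + ?g))"
    using mult_left_mono[OF _ par(1)] by (simp only: exp_le_cancel_iff)
  also have "\<dots> \<le> exp (\<theta> * ?g) * (exp (- \<theta> * (1 - \<rho>) * (\<delta> * \<tau>) / 2) * exp (\<theta> * m) + exp (\<theta> * (\<delta> * \<tau>) / 2))"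
  proof (cases "\<delta> * \<tau> / 2 \<le> m")
    case True
    have "exp (\<theta> * (max (\<rho> * m) (m - \<delta> * \<tau>) + ?g))
        \<le> exp (- \<theta> * (1 - \<rho>) * (\<delta> * \<tau>) / 2) * exp (\<theta> * m) * exp (\<theta> * ?g)"
      by (rule drift_factor) (use rho True par \<tau> in auto)
    moreover have "0 \<le> exp (\<theta> * ?g) * exp (\<theta> * (\<delta> * \<tau>) / 2)" by simp
    ultimately show ?thesis by (simp add: distrib_left mult_ac del: exp_ge_zero)
  next
    case False
    have "\<rho> * m \<le> m" "0 \<le> \<delta> * \<tau>" using m rho \<tau> par mult_right_mono[of \<rho> 1 m] by simp_all
    then have "max (\<rho> * m) (m - \<delta> * \<tau>) \<le> \<delta> * \<tau> / 2" using False unfolding max.bounded_iff by linarith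
    then have "\<theta> * (max (\<rho> * m) (m - \<delta> * \<tau>) + ?g) \<le> \<theta> * (\<delta> * \<tau> / 2 + ?g)"
      using par by (intro mult_left_mono) auto
    then have "exp (\<theta> * (max (\<rho> * m) (m - \<delta> * \<tau>) + ?g)) \<le> exp (\<theta> * ?g) * exp (\<theta> * (\<delta> * \<tau>) / 2)"
      by (simp add: exp_add[symmetric] algebra_simps)
    then show ?thesis by (simp add: distrib_left add_increasing)
  qed
  finally show ?thesis .
qed

end

section \<open>Exponential maximal inequality\<close>

lemma (in prob_space) indep_var_nn_integral:
  fixes X Y :: "'a \<Rightarrow> ennreal"
  assumes "indep_var borel X borel Y"
  shows "(\<integral>\<^sup>+\<omega>. X \<omega> * Y \<omega> \<partial>M) = (\<integral>\<^sup>+\<omega>. X \<omega> \<partial>M) * (\<integral>\<^sup>+\<omega>. Y \<omega> \<partial>M)"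
proof -
  have *: "case_bool borel borel = (\<lambda>_. borel :: ennreal measure)"
    by (auto simp: fun_eq_iff split: bool.split)
  have "indep_vars (\<lambda>_. borel) (case_bool X Y) (UNIV :: bool set)"
    using assms unfolding indep_var_def * .
  from indep_vars_nn_integral[OF _ this] show ?thesis by (simp add: UNIV_bool mult.commute)
qed

lemma nn_integral_exp_normal:
  assumes "distributed M lborel X (normal_density 0 \<sigma>)" "0 < \<sigma>"
  shows "(\<integral>\<^sup>+\<omega>. ennreal (exp (c * X \<omega>)) \<partial>M) = ennreal (exp (c\<^sup>2 * \<sigma>\<^sup>2 / 2))"
proof -
  \<comment> \<open>Completing the square: tilting a centred normal density by
    \<open>exp (c * x)\<close> shifts its mean to \<open>c * \<sigma>^2\<close>.\<close>
  have eq: "normal_density 0 \<sigma> x * exp (c * x) = exp (c\<^sup>2 * \<sigma>\<^sup>2 / 2) * normal_density (c * \<sigma>\<^sup>2) \<sigma> x" for x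
  proof -
    have "- (x - 0)\<^sup>2 / (2 * \<sigma>\<^sup>2) + c * x = c\<^sup>2 * \<sigma>\<^sup>2 / 2 + - (x - c * \<sigma>\<^sup>2)\<^sup>2 / (2 * \<sigma>\<^sup>2)"
      using assms(2) by (simp add: field_simps power2_eq_square)
    then have "exp (- (x - 0)\<^sup>2 / (2 * \<sigma>\<^sup>2)) * exp (c * x)
       = exp (c\<^sup>2 * \<sigma>\<^sup>2 / 2) * exp (- (x - c * \<sigma>\<^sup>2)\<^sup>2 / (2 * \<sigma>\<^sup>2))"
      by (simp only: exp_add[symmetric])
    then show ?thesis unfolding normal_density_def by simp
  qed
  have "(\<integral>\<^sup>+\<omega>. ennreal (exp (c * X \<omega>)) \<partial>M) = (\<integral>\<^sup>+x. ennreal (normal_density 0 \<sigma> x) * ennreal (exp (c * x)) \<partial>lborel)"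
    using distributed_nn_integral[OF assms(1), of "\<lambda>x. ennreal (exp (c * x))"] by simp
  also have "\<dots> = (\<integral>\<^sup>+x. ennreal (exp (c\<^sup>2 * \<sigma>\<^sup>2 / 2)) * ennreal (normal_density (c * \<sigma>\<^sup>2) \<sigma> x) \<partial>lborel)"
    by (simp add: ennreal_mult[symmetric] eq)
  also have "\<dots> = ennreal (exp (c\<^sup>2 * \<sigma>\<^sup>2 / 2)) * (\<integral>\<^sup>+x. ennreal (normal_density (c * \<sigma>\<^sup>2) \<sigma> x) \<partial>lborel)"
    by (intro nn_integral_cmult) simp
  also have "(\<integral>\<^sup>+x. ennreal (normal_density (c * \<sigma>\<^sup>2) \<sigma> x) \<partial>lborel) = 1"
    using assms(2) by (subst nn_integral_eq_integral) auto
  finally show ?thesis by simp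
qed

text \<open>The pathwise form of Doob's \<open>L\<^sup>2\<close> inequality, which needs no martingale theory.\<close>

lemma pathwise_doob:
  fixes a :: "nat \<Rightarrow> real"
  defines "A \<equiv> \<lambda>l. Max (a ` {..l})"
  shows "(A n)\<^sup>2 + 4 * (\<Sum>l<n. A l * a (Suc l)) \<le> 4 * (a n)\<^sup>2 + 4 * (\<Sum>l<n. A l * a l)"
proof -
  have A_Suc: "A (Suc l) = max (a (Suc l)) (A l)" for l
    unfolding A_def atMost_Suc image_insert by (rule Max_insert) auto
  \<comment> \<open>Discrete integration by parts against the running maximum. \<open>A\<close>
    grows only when \<open>a\<close> sets a record, and then the claim is the nonnegativity of
    \<open>(a (Suc n) - A n)^2\<close>.\<close>
  have *: "(\<Sum>l<n. A l * a (Suc l)) - (\<Sum>l<n. A l * a l) \<le> A n * a n - (A n)\<^sup>2 / 2"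
  proof (induction n)
    case 0 show ?case by (simp add: A_def power2_eq_square)
  next
    case (Suc n)
    have "(\<Sum>l<Suc n. A l * a (Suc l)) - (\<Sum>l<Suc n. A l * a l) \<le> A n * a (Suc n) - (A n)\<^sup>2 / 2"
      using Suc.IH by (simp add: algebra_simps)
    also have "\<dots> \<le> A (Suc n) * a (Suc n) - (A (Suc n))\<^sup>2 / 2"
    proof (cases "a (Suc n) \<le> A n")
      case True then show ?thesis by (simp add: A_Suc)
    next
      case False
      have "0 \<le> (a (Suc n) - A n)\<^sup>2" by simp
      with False show ?thesis by (simp add: A_Suc power2_eq_square algebra_simps)
    qed
    finally show ?case .
  qed
  have "0 \<le> (A n - 2 * a n)\<^sup>2" by simp
  then have "4 * (A n * a n) \<le> (A n)\<^sup>2 + 4 * (a n)\<^sup>2" by (simp add: power2_eq_square algebra_simps)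
  then show ?thesis using * by linarith
qed

text \<open>Cancels the sums in the integrated Doob inequality, where cancellation is valid only for
  a finite term.\<close>

lemma ennreal_le_of_add_le:
  fixes x y y' z :: ennreal
  assumes "y \<le> y'" "y < \<top>" "x + y' \<le> z + y"
  shows "x \<le> z"
proof -
  have "x + y \<le> z + y" using add_left_mono[OF assms(1), of x] assms(3) by (rule order_trans)
  then have "y + x \<le> y + z" by (simp only: add.commute)
  then show ?thesis using assms(2) unfolding ennreal_add_left_cancel_le by (elim disjE) simp_all
qed

lemma prod_less_top_ennreal:
  fixes f :: "'b \<Rightarrow> ennreal"
  assumes "\<And>i. i \<in> I \<Longrightarrow> f i < \<top>"
  shows "(\<Prod>i\<in>I. f i) < \<top>"
  using assms
proof (induction I rule: infinite_finite_induct)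
  case (insert i I)
  then have "f i < \<top>" "(\<Prod>i\<in>I. f i) < \<top>" by simp_all
  then show ?case using insert.hyps by (simp add: ennreal_mult_less_top)
qed simp_all

text \<open>\<open>exp (c * S l)\<close> is a submartingale, since each factor is independent of the
  past and has mean at least 1 by \<open>sub\<close>. Integrating the pathwise inequality leaves
  sums that this property compares.\<close>

lemma (in prob_space) doob_exponential:
  fixes \<xi> :: "nat \<Rightarrow> 'a \<Rightarrow> real"
  assumes ind: "indep_vars (\<lambda>_. borel) \<xi> {..<n}"
    and sub: "\<And>r. r < n \<Longrightarrow> 1 \<le> (\<integral>\<^sup>+\<omega>. ennreal (exp (c * \<xi> r \<omega>)) \<partial>M)"
    and fin: "\<And>r. r < n \<Longrightarrow> (\<integral>\<^sup>+\<omega>. ennreal (exp (2 * c * \<xi> r \<omega>)) \<partial>M) < \<top>"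
  defines "S \<equiv> \<lambda>l \<omega>. \<Sum>r<l. \<xi> r \<omega>"
  shows "(\<integral>\<^sup>+\<omega>. ennreal ((Max ((\<lambda>l. exp (c * S l \<omega>)) ` {..n}))\<^sup>2) \<partial>M)
    \<le> 4 * (\<integral>\<^sup>+\<omega>. ennreal (exp (2 * c * S n \<omega>)) \<partial>M)"
    and "(\<integral>\<^sup>+\<omega>. ennreal (exp (2 * c * S n \<omega>)) \<partial>M) = (\<Prod>r<n. \<integral>\<^sup>+\<omega>. ennreal (exp (2 * c * \<xi> r \<omega>)) \<partial>M)"
proof -
  define a where "a l \<omega> = exp (c * S l \<omega>)" for l \<omega>
  define A where "A l \<omega> = Max ((\<lambda>k. a k \<omega>) ` {..l})" for l \<omega>
  have rv [measurable]: "\<xi> r \<in> borel_measurable M" if "r < n" for r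
    using ind that by (auto simp: indep_vars_def)
  have a_meas: "a l \<in> borel_measurable M" if "l \<le> n" for l
    unfolding a_def S_def using rv that by (intro borel_measurable_exp[THEN measurable_compose[rotated]] borel_measurable_times borel_measurable_sum) auto
  have A_meas: "A l \<in> borel_measurable M" if "l \<le> n" for l
    unfolding A_def using that by (intro borel_measurable_Max a_meas) auto
  have pos: "0 < a l \<omega>" for l \<omega> by (simp add: a_def)
  have aA: "a l \<omega> \<le> A l \<omega>" for l \<omega> unfolding A_def by (intro Max_ge) auto
  have Apos: "0 < A l \<omega>" for l \<omega> using pos aA less_le_trans by blast
  have moment: "(\<integral>\<^sup>+\<omega>. ennreal (exp (2 * c * S l \<omega>)) \<partial>M) = (\<Prod>r<l. \<integral>\<^sup>+\<omega>. ennreal (exp (2 * c * \<xi> r \<omega>)) \<partial>M)"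
    if "l \<le> n" for l
  proof -
    have "indep_vars (\<lambda>_. borel) (\<lambda>r \<omega>. ennreal (exp (2 * c * \<xi> r \<omega>))) {..<l}"
      by (rule indep_vars_compose2[OF indep_vars_subset[OF ind]]) (use that in auto)
    from indep_vars_nn_integral[OF _ this] show ?thesis
      by (simp add: S_def sum_distrib_left exp_sum prod_ennreal)
  qed
  then show "(\<integral>\<^sup>+\<omega>. ennreal (exp (2 * c * S n \<omega>)) \<partial>M) = (\<Prod>r<n. \<integral>\<^sup>+\<omega>. ennreal (exp (2 * c * \<xi> r \<omega>)) \<partial>M)"
    by simp
  have sq: "(a l \<omega>)\<^sup>2 = exp (2 * c * S l \<omega>)" for l \<omega>
    by (simp add: a_def power2_eq_square exp_add[symmetric])
  have a_fin: "(\<integral>\<^sup>+\<omega>. ennreal ((a l \<omega>)\<^sup>2) \<partial>M) < \<top>" if "l \<le> n" for l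
    unfolding sq moment[OF that] using fin that by (intro prod_less_top_ennreal) auto
  have step: "(\<integral>\<^sup>+\<omega>. ennreal (A l \<omega> * a l \<omega>) \<partial>M) \<le> (\<integral>\<^sup>+\<omega>. ennreal (A l \<omega> * a (Suc l) \<omega>) \<partial>M)" if l: "l < n" for l
  proof -
    \<comment> \<open>The past up to \<open>l\<close> as a function of \<open>\<xi>\<close>
      restricted to \<open>{..<l}\<close>, so that independence over disjoint index sets separates
      it from \<open>\<xi> l\<close>.\<close>
    define f where "f z = ennreal (Max ((\<lambda>k. exp (c * (\<Sum>r<k. z r))) ` {..l}) * exp (c * (\<Sum>r<l. z r)))"
      for z :: "nat \<Rightarrow> real"
    have f: "f \<in> borel_measurable (PiM {..<l} (\<lambda>_. borel))"
    proof -
      have *: "(\<lambda>z. exp (c * (\<Sum>r<k. z r))) \<in> borel_measurable (PiM {..<l} (\<lambda>_. borel :: real measure))" if "k \<le> l" for k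
        using that by (intro borel_measurable_exp[THEN measurable_compose[rotated]] borel_measurable_times borel_measurable_sum
            borel_measurable_const measurable_component_singleton) auto
      show ?thesis unfolding f_def
        by (intro measurable_compose[OF _ measurable_ennreal] borel_measurable_times borel_measurable_Max *) auto
    qed
    have g: "(\<lambda>z. ennreal (exp (c * z l))) \<in> borel_measurable (PiM {l} (\<lambda>_. borel :: real measure))"
      by (intro measurable_compose[OF _ measurable_ennreal] measurable_compose[OF _ borel_measurable_exp] borel_measurable_times
            borel_measurable_const measurable_component_singleton) auto
    have "indep_var borel (f \<circ> (\<lambda>\<omega>. restrict (\<lambda>r. \<xi> r \<omega>) {..<l}))
        borel ((\<lambda>z. ennreal (exp (c * z l))) \<circ> (\<lambda>\<omega>. restrict (\<lambda>r. \<xi> r \<omega>) {l}))"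
      by (rule indep_var_compose[OF indep_var_restrict[OF ind] f g]) (use l in auto)
    from indep_var_nn_integral[OF this]
    have eq: "(\<integral>\<^sup>+\<omega>. f (restrict (\<lambda>r. \<xi> r \<omega>) {..<l}) * ennreal (exp (c * \<xi> l \<omega>)) \<partial>M) =
       (\<integral>\<^sup>+\<omega>. f (restrict (\<lambda>r. \<xi> r \<omega>) {..<l}) \<partial>M) * (\<integral>\<^sup>+\<omega>. ennreal (exp (c * \<xi> l \<omega>)) \<partial>M)"
      by simp
    have fr: "f (restrict (\<lambda>r. \<xi> r \<omega>) {..<l}) = ennreal (A l \<omega> * a l \<omega>)" for \<omega>
    proof -
      have "(\<Sum>r<k. restrict (\<lambda>r. \<xi> r \<omega>) {..<l} r) = S k \<omega>" if "k \<le> l" for k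
        unfolding S_def using that by (intro sum.cong) auto
      then have "(\<lambda>k. exp (c * (\<Sum>r<k. restrict (\<lambda>r. \<xi> r \<omega>) {..<l} r))) ` {..l} = (\<lambda>k. a k \<omega>) ` {..l}"
        and "(\<Sum>r<l. restrict (\<lambda>r. \<xi> r \<omega>) {..<l} r) = S l \<omega>"
        by (auto simp: a_def)
      then show ?thesis unfolding f_def A_def by (simp add: a_def)
    qed
    have "ennreal (A l \<omega> * a (Suc l) \<omega>) = ennreal (A l \<omega> * a l \<omega>) * ennreal (exp (c * \<xi> l \<omega>))" for \<omega>
      using pos[of l \<omega>] Apos[of l \<omega>]
      by (simp add: a_def S_def distrib_left exp_add ennreal_mult[symmetric] mult.assoc)
    then have "(\<integral>\<^sup>+\<omega>. ennreal (A l \<omega> * a (Suc l) \<omega>) \<partial>M)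
      = (\<integral>\<^sup>+\<omega>. ennreal (A l \<omega> * a l \<omega>) \<partial>M) * (\<integral>\<^sup>+\<omega>. ennreal (exp (c * \<xi> l \<omega>)) \<partial>M)"
      using eq by (simp add: fr)
    then show ?thesis using mult_left_mono[OF sub[OF l], of "\<integral>\<^sup>+\<omega>. ennreal (A l \<omega> * a l \<omega>) \<partial>M"] by simp
  qed
  \<comment> \<open>The induction serves finiteness only: the bounds for \<open>k < l\<close> make
    the sum finite that has to be cancelled.\<close>
  have "(\<integral>\<^sup>+\<omega>. ennreal ((A l \<omega>)\<^sup>2) \<partial>M) \<le> 4 * (\<integral>\<^sup>+\<omega>. ennreal ((a l \<omega>)\<^sup>2) \<partial>M)" if "l \<le> n" for l
    using that
  proof (induction l rule: less_induct)
    case (less l)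
    have m [measurable]: "A k \<in> borel_measurable M" "a k \<in> borel_measurable M" if "k \<le> l" for k
      using A_meas a_meas that less.prems by auto
    let ?y = "4 * (\<Sum>k<l. \<integral>\<^sup>+\<omega>. ennreal (A k \<omega> * a k \<omega>) \<partial>M)"
    let ?y' = "4 * (\<Sum>k<l. \<integral>\<^sup>+\<omega>. ennreal (A k \<omega> * a (Suc k) \<omega>) \<partial>M)"
    have "?y \<le> ?y'" using step less.prems by (intro mult_left_mono sum_mono) auto
    moreover have "(\<integral>\<^sup>+\<omega>. ennreal (A k \<omega> * a k \<omega>) \<partial>M) < \<top>" if "k < l" for k
    proof -
      have "(\<integral>\<^sup>+\<omega>. ennreal (A k \<omega> * a k \<omega>) \<partial>M) \<le> (\<integral>\<^sup>+\<omega>. ennreal ((A k \<omega>)\<^sup>2) \<partial>M)"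
        using aA Apos by (intro nn_integral_mono ennreal_leI) (auto simp: power2_eq_square less_imp_le)
      also have "\<dots> \<le> 4 * (\<integral>\<^sup>+\<omega>. ennreal ((a k \<omega>)\<^sup>2) \<partial>M)" using less that by auto
      also have "\<dots> < \<top>" using a_fin[of k] that less.prems by (simp add: ennreal_mult_less_top)
      finally show ?thesis .
    qed
    then have "?y < \<top>" by (simp add: ennreal_mult_less_top)
    moreover have "(\<integral>\<^sup>+\<omega>. ennreal ((A l \<omega>)\<^sup>2) \<partial>M) + ?y' \<le> 4 * (\<integral>\<^sup>+\<omega>. ennreal ((a l \<omega>)\<^sup>2) \<partial>M) + ?y"
    proof -
      have lin: "(\<integral>\<^sup>+\<omega>. X \<omega> + 4 * (\<Sum>k<l. Z k \<omega>) \<partial>M) = (\<integral>\<^sup>+\<omega>. X \<omega> \<partial>M) + 4 * (\<Sum>k<l. \<integral>\<^sup>+\<omega>. Z k \<omega> \<partial>M)"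
        if X: "X \<in> borel_measurable M" and Z: "\<And>k. k < l \<Longrightarrow> Z k \<in> borel_measurable M"
        for X :: "'a \<Rightarrow> ennreal" and Z :: "nat \<Rightarrow> 'a \<Rightarrow> ennreal"
      proof -
        have Zs: "(\<lambda>\<omega>. \<Sum>k<l. Z k \<omega>) \<in> borel_measurable M" using Z by (intro borel_measurable_sum) auto
        have "(\<integral>\<^sup>+\<omega>. X \<omega> + 4 * (\<Sum>k<l. Z k \<omega>) \<partial>M) = (\<integral>\<^sup>+\<omega>. X \<omega> \<partial>M) + (\<integral>\<^sup>+\<omega>. 4 * (\<Sum>k<l. Z k \<omega>) \<partial>M)"
          using X Zs by (intro nn_integral_add) auto
        also have "(\<integral>\<^sup>+\<omega>. 4 * (\<Sum>k<l. Z k \<omega>) \<partial>M) = 4 * (\<integral>\<^sup>+\<omega>. (\<Sum>k<l. Z k \<omega>) \<partial>M)"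
          using Zs by (rule nn_integral_cmult)
        also have "(\<integral>\<^sup>+\<omega>. (\<Sum>k<l. Z k \<omega>) \<partial>M) = (\<Sum>k<l. \<integral>\<^sup>+\<omega>. Z k \<omega> \<partial>M)"
          using Z by (intro nn_integral_sum) auto
        finally show ?thesis .
      qed
      have meas: "(\<lambda>\<omega>. ennreal ((A l \<omega>)\<^sup>2)) \<in> borel_measurable M" "(\<lambda>\<omega>. 4 * ennreal ((a l \<omega>)\<^sup>2)) \<in> borel_measurable M"
        "(\<lambda>\<omega>. ennreal ((a l \<omega>)\<^sup>2)) \<in> borel_measurable M"
        using m[of l] by measurable
      have meas_k: "(\<lambda>\<omega>. ennreal (A k \<omega> * a k \<omega>)) \<in> borel_measurable M"
        "(\<lambda>\<omega>. ennreal (A k \<omega> * a (Suc k) \<omega>)) \<in> borel_measurable M" if "k < l" for k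
      proof -
        have [measurable]: "A k \<in> borel_measurable M" "a k \<in> borel_measurable M" "a (Suc k) \<in> borel_measurable M"
          using m that by auto
        show "(\<lambda>\<omega>. ennreal (A k \<omega> * a k \<omega>)) \<in> borel_measurable M"
          "(\<lambda>\<omega>. ennreal (A k \<omega> * a (Suc k) \<omega>)) \<in> borel_measurable M"
          by measurable
      qed
      have pointwise: "ennreal ((A l \<omega>)\<^sup>2) + 4 * (\<Sum>k<l. ennreal (A k \<omega> * a (Suc k) \<omega>))
          \<le> 4 * ennreal ((a l \<omega>)\<^sup>2) + 4 * (\<Sum>k<l. ennreal (A k \<omega> * a k \<omega>))" for \<omega>
      proof -
        have nn: "0 \<le> A k \<omega> * a j \<omega>" for k j
          by (rule mult_nonneg_nonneg) (use pos[of j \<omega>] Apos[of k \<omega>] in linarith)+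
        have le: "(A l \<omega>)\<^sup>2 + 4 * (\<Sum>k<l. A k \<omega> * a (Suc k) \<omega>) \<le> 4 * (a l \<omega>)\<^sup>2 + 4 * (\<Sum>k<l. A k \<omega> * a k \<omega>)"
          unfolding A_def by (rule pathwise_doob)
        have to_ennreal: "ennreal x + ennreal 4 * (\<Sum>k<l. ennreal (z k)) = ennreal (x + 4 * (\<Sum>k<l. z k))"
          if "0 \<le> x" "\<And>k. 0 \<le> z k" for x and z :: "nat \<Rightarrow> real"
        proof -
          have "(\<Sum>k<l. ennreal (z k)) = ennreal (\<Sum>k<l. z k)" using that by (intro sum_ennreal) auto
          moreover have "0 \<le> (\<Sum>k<l. z k)" using that by (intro sum_nonneg) auto
          ultimately show ?thesis using that(1)
            by (simp only: ennreal_mult[symmetric] ennreal_plus[symmetric] mult_nonneg_nonneg zero_le_numeral)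
        qed
        have "4 * ennreal ((a l \<omega>)\<^sup>2) = ennreal (4 * (a l \<omega>)\<^sup>2)" by (simp add: ennreal_mult)
        then show ?thesis
          using to_ennreal[of "(A l \<omega>)\<^sup>2" "\<lambda>k. A k \<omega> * a (Suc k) \<omega>"] to_ennreal[of "4 * (a l \<omega>)\<^sup>2" "\<lambda>k. A k \<omega> * a k \<omega>"]
            ennreal_leI[OF le] nn by simp
      qed
      have "(\<integral>\<^sup>+\<omega>. ennreal ((A l \<omega>)\<^sup>2) \<partial>M) + ?y'
        = (\<integral>\<^sup>+\<omega>. ennreal ((A l \<omega>)\<^sup>2) + 4 * (\<Sum>k<l. ennreal (A k \<omega> * a (Suc k) \<omega>)) \<partial>M)"
        by (rule lin[symmetric]) (use meas meas_k in auto)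
      also have "\<dots> \<le> (\<integral>\<^sup>+\<omega>. 4 * ennreal ((a l \<omega>)\<^sup>2) + 4 * (\<Sum>k<l. ennreal (A k \<omega> * a k \<omega>)) \<partial>M)"
        by (rule nn_integral_mono) (rule pointwise)
      also have "\<dots> = (\<integral>\<^sup>+\<omega>. 4 * ennreal ((a l \<omega>)\<^sup>2) \<partial>M) + ?y"
        by (rule lin) (use meas meas_k in auto)
      also have "(\<integral>\<^sup>+\<omega>. 4 * ennreal ((a l \<omega>)\<^sup>2) \<partial>M) = 4 * (\<integral>\<^sup>+\<omega>. ennreal ((a l \<omega>)\<^sup>2) \<partial>M)"
        using meas(3) by (rule nn_integral_cmult)
      finally show ?thesis .
    qed
    ultimately show ?case by (rule ennreal_le_of_add_le)
  qed
  from this[OF order.refl] show "(\<integral>\<^sup>+\<omega>. ennreal ((Max ((\<lambda>l. exp (c * S l \<omega>)) ` {..n}))\<^sup>2) \<partial>M)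
    \<le> 4 * (\<integral>\<^sup>+\<omega>. ennreal (exp (2 * c * S n \<omega>)) \<partial>M)"
    unfolding A_def sq by (simp add: a_def)
qed

text \<open>The factor 2 turns the largest distance from the initial value, to which Doob's
  inequality applies, into a bound for increments between any two grid points.\<close>

definition max_increment :: "nat \<Rightarrow> nat \<Rightarrow> (nat \<Rightarrow> nat \<Rightarrow> real) \<Rightarrow> real" where
  "max_increment d n s = 2 * Max ((\<lambda>(l, i). \<bar>s l i\<bar>) ` ({..n} \<times> {..<d}))"

lemma max_increment_cong:
  assumes "\<And>l i. l \<le> n \<Longrightarrow> i < d \<Longrightarrow> s l i = s' l i"
  shows "max_increment d n s = max_increment d n s'"
proof -
  have "(\<lambda>(l, i). \<bar>s l i\<bar>) ` ({..n} \<times> {..<d}) = (\<lambda>(l, i). \<bar>s' l i\<bar>) ` ({..n} \<times> {..<d})"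
    using assms by (intro image_cong) auto
  then show ?thesis by (simp add: max_increment_def)
qed

lemma max_increment_attained:
  assumes "0 < d"
  obtains l i where "l \<le> n" "i < d" "max_increment d n s = 2 * \<bar>s l i\<bar>"
proof -
  have "Max ((\<lambda>(l, i). \<bar>s l i\<bar>) ` ({..n} \<times> {..<d})) \<in> (\<lambda>(l, i). \<bar>s l i\<bar>) ` ({..n} \<times> {..<d})"
    using assms by (intro Max_in) auto
  then show ?thesis using that by (auto simp: max_increment_def)
qed

lemma max_increment_upper: "l \<le> n \<Longrightarrow> i < d \<Longrightarrow> 2 * \<bar>s l i\<bar> \<le> max_increment d n s"
  unfolding max_increment_def by (intro mult_left_mono Max_ge) force+

lemma borel_measurable_max_increment:
  assumes "\<And>l i. l \<le> n \<Longrightarrow> i < d \<Longrightarrow> (\<lambda>x. s x l i) \<in> borel_measurable N"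
  shows "(\<lambda>x. max_increment d n (s x)) \<in> borel_measurable N"
proof -
  have "(\<lambda>x. Max ((\<lambda>p. \<bar>s x (fst p) (snd p)\<bar>) ` ({..n} \<times> {..<d}))) \<in> borel_measurable N"
    using assms by (intro borel_measurable_Max borel_measurable_abs) auto
  then show ?thesis unfolding max_increment_def case_prod_beta' by (intro borel_measurable_times) auto
qed

text \<open>Partial sums, from step \<open>r0\<close> on, of \<open>A\<close> applied to vector
  increments \<open>z\<close>. Keeping \<open>z\<close> as an argument exhibits which increments are
  involved, as the independence of blocks requires.\<close>

definition weighted_sums :: "nat \<Rightarrow> (nat \<Rightarrow> nat \<Rightarrow> real) \<Rightarrow> (nat \<times> nat \<Rightarrow> real) \<Rightarrow> nat \<Rightarrow> nat \<Rightarrow> nat \<Rightarrow> real" where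
  "weighted_sums d A z r0 l i = (\<Sum>r<l. \<Sum>j<d. A i j * z (r0 + r, j))"

lemma borel_measurable_weighted_sums:
  assumes "\<And>r j. r < l \<Longrightarrow> j < d \<Longrightarrow> (\<lambda>x. z x (r0 + r, j)) \<in> borel_measurable N"
  shows "(\<lambda>x. weighted_sums d A (z x) r0 l i) \<in> borel_measurable N"
  unfolding weighted_sums_def using assms by (intro borel_measurable_sum borel_measurable_times) auto

context prob_space
begin

lemma nn_integral_exp_weighted:
  fixes \<Delta> :: "nat \<times> nat \<Rightarrow> 'a \<Rightarrow> real"
  assumes ind: "indep_vars (\<lambda>_. borel) \<Delta> ({..<n} \<times> {..<d})"
    and mgf: "\<And>r j c. r < n \<Longrightarrow> j < d \<Longrightarrow>
      (\<integral>\<^sup>+\<omega>. ennreal (exp (c * \<Delta> (r, j) \<omega>)) \<partial>M) = ennreal (exp (c\<^sup>2 * h / 2))"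
    and r: "r < n"
  shows "(\<integral>\<^sup>+\<omega>. ennreal (exp (c * (\<Sum>j<d. a j * \<Delta> (r, j) \<omega>))) \<partial>M) = ennreal (exp (c\<^sup>2 * h * (\<Sum>j<d. (a j)\<^sup>2) / 2))"
proof -
  let ?I = "{r} \<times> {..<d}"
  have prod_eq: "(\<Prod>p\<in>?I. f p) = (\<Prod>j<d. f (r, j))" for f :: "nat \<times> nat \<Rightarrow> ennreal"
    using prod.cartesian_product[of "\<lambda>x y. f (x, y)" "{..<d}" "{r}"] by simp
  have "indep_vars (\<lambda>_. borel) (\<lambda>p \<omega>. ennreal (exp (c * a (snd p) * \<Delta> p \<omega>))) ?I"
    by (rule indep_vars_compose2[OF indep_vars_subset[OF ind]]) (use r in auto)
  from indep_vars_nn_integral[OF _ this]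
  have "(\<integral>\<^sup>+\<omega>. (\<Prod>j<d. ennreal (exp (c * a j * \<Delta> (r, j) \<omega>))) \<partial>M)
      = (\<Prod>j<d. \<integral>\<^sup>+\<omega>. ennreal (exp (c * a j * \<Delta> (r, j) \<omega>)) \<partial>M)"
    by (simp add: prod_eq)
  also have "\<dots> = (\<Prod>j<d. ennreal (exp ((c * a j)\<^sup>2 * h / 2)))"
    using mgf[OF r] by (intro prod.cong) auto
  also have "\<dots> = ennreal (exp (\<Sum>j<d. (c * a j)\<^sup>2 * h / 2))"
    by (simp add: prod_ennreal exp_sum)
  also have "(\<Sum>j<d. (c * a j)\<^sup>2 * h / 2) = c\<^sup>2 * h * (\<Sum>j<d. (a j)\<^sup>2) / 2"
    by (simp add: power_mult_distrib sum_distrib_left sum_divide_distrib algebra_simps)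
  also have "(\<integral>\<^sup>+\<omega>. (\<Prod>j<d. ennreal (exp (c * a j * \<Delta> (r, j) \<omega>))) \<partial>M)
     = (\<integral>\<^sup>+\<omega>. ennreal (exp (c * (\<Sum>j<d. a j * \<Delta> (r, j) \<omega>))) \<partial>M)"
    by (simp add: prod_ennreal exp_sum sum_distrib_left mult.assoc)
  finally show ?thesis .
qed

text \<open>\<open>exp (2 * p * \<bar>x\<bar>)\<close> is the square of \<open>exp (p * x)\<close>
  or of \<open>exp (- p * x)\<close>. Doob's inequality costs a factor 4, the two signs a factor 2,
  and the union over coordinates a factor \<open>d\<close>. The exponent is that of a normal
  variable of variance at most \<open>V * (n * h)\<close>, evaluated at
  \<open>2 * p\<close>.\<close>

lemma max_increment_exp_moment:
  fixes \<Delta> :: "nat \<times> nat \<Rightarrow> 'a \<Rightarrow> real"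
  assumes ind: "indep_vars (\<lambda>_. borel) \<Delta> ({..<n} \<times> {..<d})"
    and mgf: "\<And>r j c. r < n \<Longrightarrow> j < d \<Longrightarrow>
      (\<integral>\<^sup>+\<omega>. ennreal (exp (c * \<Delta> (r, j) \<omega>)) \<partial>M) = ennreal (exp (c\<^sup>2 * h / 2))"
    and var: "\<And>i. i < d \<Longrightarrow> (\<Sum>j<d. (A i j)\<^sup>2) \<le> V" and h: "0 \<le> h" and d: "0 < d"
  shows "(\<integral>\<^sup>+\<omega>. ennreal (exp (p * max_increment d n (weighted_sums d A (\<lambda>q. \<Delta> q \<omega>) 0))) \<partial>M)
    \<le> ennreal (8 * real d * exp (2 * p\<^sup>2 * V * (real n * h)))"
proof -
  let ?S = "\<lambda>\<omega>. weighted_sums d A (\<lambda>q. \<Delta> q \<omega>) 0"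
  define D where "D c i \<omega> = (Max ((\<lambda>l. exp (c * ?S \<omega> l i)) ` {..n}))\<^sup>2" for c i \<omega>
  have rv: "\<Delta> (r, j) \<in> borel_measurable M" if "r < n" "j < d" for r j
    using ind that by (auto simp: indep_vars_def)
  have D_meas: "D c i \<in> borel_measurable M" for c i
    unfolding D_def
    by (intro borel_measurable_power borel_measurable_Max measurable_compose[OF _ borel_measurable_exp]
        borel_measurable_times borel_measurable_const borel_measurable_weighted_sums) (auto intro: rv)
  have D_int: "(\<integral>\<^sup>+\<omega>. ennreal (D c i \<omega>) \<partial>M) \<le> ennreal (4 * exp (2 * c\<^sup>2 * V * (real n * h)))" if i: "i < d" for c i
  proof -
    define \<xi> where "\<xi> r \<omega> = (\<Sum>j<d. A i j * \<Delta> (r, j) \<omega>)" for r \<omega>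
    have "indep_vars (\<lambda>_. borel) (\<lambda>r \<omega>. (\<lambda>z. \<Sum>j<d. A i j * z (r, j)) (restrict (\<lambda>q. \<Delta> q \<omega>) ({r} \<times> {..<d}))) {..<n}"
    proof (rule indep_vars_compose2[OF indep_vars_restrict[OF ind]])
      show "(\<lambda>z. \<Sum>j<d. A i j * z (r, j)) \<in> borel_measurable (PiM ({r} \<times> {..<d}) (\<lambda>_. borel))" for r
        by (intro borel_measurable_sum borel_measurable_times borel_measurable_const measurable_component_singleton) auto
    qed (auto simp: disjoint_family_on_def)
    then have ind\<xi>: "indep_vars (\<lambda>_. borel) \<xi> {..<n}"
      by (simp add: \<xi>_def[abs_def])
    have mg: "(\<integral>\<^sup>+\<omega>. ennreal (exp (c' * \<xi> r \<omega>)) \<partial>M) = ennreal (exp (c'\<^sup>2 * h * (\<Sum>j<d. (A i j)\<^sup>2) / 2))" if "r < n" for r c'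
      unfolding \<xi>_def by (rule nn_integral_exp_weighted[OF ind mgf that])
    have nonneg: "0 \<le> c'\<^sup>2 * h * (\<Sum>j<d. (A i j)\<^sup>2) / 2" for c' using h by (simp add: sum_nonneg)
    have doob1: "1 \<le> (\<integral>\<^sup>+\<omega>. ennreal (exp (c * \<xi> r \<omega>)) \<partial>M)" if "r < n" for r
      unfolding mg[OF that] using nonneg[of c] by (simp add: ennreal_1[symmetric] del: ennreal_1)
    have doob2: "(\<integral>\<^sup>+\<omega>. ennreal (exp (2 * c * \<xi> r \<omega>)) \<partial>M) < \<top>" if "r < n" for r
      unfolding mg[OF that] by simp
    note doob = doob_exponential[OF ind\<xi> doob1 doob2]
    have S\<xi>: "?S \<omega> l i = (\<Sum>r<l. \<xi> r \<omega>)" for \<omega> l by (simp add: weighted_sums_def \<xi>_def)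
    have "(\<integral>\<^sup>+\<omega>. ennreal (D c i \<omega>) \<partial>M) \<le> 4 * (\<integral>\<^sup>+\<omega>. ennreal (exp (2 * c * (\<Sum>r<n. \<xi> r \<omega>))) \<partial>M)"
      unfolding D_def S\<xi> by (rule doob(1))
    also have "(\<integral>\<^sup>+\<omega>. ennreal (exp (2 * c * (\<Sum>r<n. \<xi> r \<omega>))) \<partial>M)
        = (\<Prod>r<n. \<integral>\<^sup>+\<omega>. ennreal (exp (2 * c * \<xi> r \<omega>)) \<partial>M)"
      by (rule doob(2))
    also have "\<dots> = (\<Prod>r<n. ennreal (exp ((2 * c)\<^sup>2 * h * (\<Sum>j<d. (A i j)\<^sup>2) / 2)))"
      by (intro prod.cong refl mg) simp
    also have "\<dots> = ennreal (exp (real n * ((2 * c)\<^sup>2 * h * (\<Sum>j<d. (A i j)\<^sup>2) / 2)))"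
      by (simp add: prod_ennreal exp_of_nat_mult[symmetric] ennreal_power)
    also have "\<dots> \<le> ennreal (exp (2 * c\<^sup>2 * V * (real n * h)))"
    proof (intro ennreal_leI)
      have "(2 * c\<^sup>2 * (real n * h)) * (\<Sum>j<d. (A i j)\<^sup>2) \<le> (2 * c\<^sup>2 * (real n * h)) * V"
        using var[OF i] h by (intro mult_left_mono) auto
      then show "exp (real n * ((2 * c)\<^sup>2 * h * (\<Sum>j<d. (A i j)\<^sup>2) / 2)) \<le> exp (2 * c\<^sup>2 * V * (real n * h))"
        by (simp add: power_mult_distrib algebra_simps)
    qed
    finally have "(\<integral>\<^sup>+\<omega>. ennreal (D c i \<omega>) \<partial>M) \<le> 4 * ennreal (exp (2 * c\<^sup>2 * V * (real n * h)))"
      by (simp add: mult_left_mono)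
    then show ?thesis by (simp add: ennreal_mult)
  qed
  have "(\<integral>\<^sup>+\<omega>. ennreal (exp (p * max_increment d n (?S \<omega>))) \<partial>M)
    \<le> (\<integral>\<^sup>+\<omega>. (\<Sum>i<d. ennreal (D p i \<omega>) + ennreal (D (- p) i \<omega>)) \<partial>M)"
  proof (rule nn_integral_mono)
    fix \<omega>
    obtain l i where li: "l \<le> n" "i < d" "max_increment d n (?S \<omega>) = 2 * \<bar>?S \<omega> l i\<bar>"
      using max_increment_attained[OF d] by blast
    have DD: "exp (2 * (c * ?S \<omega> l i)) \<le> D c i \<omega>" for c
    proof -
      have "exp (2 * (c * ?S \<omega> l i)) = (exp (c * ?S \<omega> l i))\<^sup>2" by (simp add: power2_eq_square exp_add[symmetric])
      also have "\<dots> \<le> D c i \<omega>" unfolding D_def using li by (intro power_mono Max_ge) auto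
      finally show ?thesis .
    qed
    \<comment> \<open>The sign of the sum selects \<open>p\<close> or \<open>- p\<close>, whatever
      the sign of \<open>p\<close>.\<close>
    have "exp (p * max_increment d n (?S \<omega>)) \<le> D p i \<omega> \<or> exp (p * max_increment d n (?S \<omega>)) \<le> D (- p) i \<omega>"
      using DD[of p] DD[of "- p"] li(3) by (cases "0 \<le> ?S \<omega> l i") (auto simp: algebra_simps)
    then have "ennreal (exp (p * max_increment d n (?S \<omega>))) \<le> ennreal (D p i \<omega>) + ennreal (D (- p) i \<omega>)"
      using ennreal_leI by (auto intro: add_increasing add_increasing2)
    also have "\<dots> \<le> (\<Sum>i<d. ennreal (D p i \<omega>) + ennreal (D (- p) i \<omega>))"
      using li(2) by (intro member_le_sum) auto
    finally show "ennreal (exp (p * max_increment d n (?S \<omega>))) \<le> (\<Sum>i<d. ennreal (D p i \<omega>) + ennreal (D (- p) i \<omega>))" .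
  qed
  also have "\<dots> = (\<Sum>i<d. (\<integral>\<^sup>+\<omega>. ennreal (D p i \<omega>) \<partial>M) + (\<integral>\<^sup>+\<omega>. ennreal (D (- p) i \<omega>) \<partial>M))"
    using D_meas by (subst nn_integral_sum) (auto intro!: sum.cong nn_integral_add)
  also have "\<dots> \<le> (\<Sum>i<d. ennreal (4 * exp (2 * p\<^sup>2 * V * (real n * h))) + ennreal (4 * exp (2 * p\<^sup>2 * V * (real n * h))))"
    using D_int[of _ p] D_int[of _ "- p"] by (intro sum_mono add_mono) auto
  also have "\<dots> = ennreal (8 * real d * exp (2 * p\<^sup>2 * V * (real n * h)))"
    by (simp add: ennreal_plus[symmetric] ennreal_mult[symmetric] ennreal_of_nat_eq_real_of_nat del: ennreal_plus)
  finally show ?thesis .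
qed

text \<open>Block \<open>b\<close> depends only on the increments with steps in
  \<open>{b * n..<Suc b * n}\<close>, and these index sets are disjoint.\<close>

lemma block_product_nn_integral:
  fixes \<Delta> :: "nat \<times> nat \<Rightarrow> 'a \<Rightarrow> real" and \<phi> :: "real \<Rightarrow> ennreal"
  assumes ind: "indep_vars (\<lambda>_. borel) \<Delta> ({..<k * n} \<times> {..<d})"
    and \<phi>: "\<phi> \<in> borel_measurable borel"
  shows "(\<integral>\<^sup>+\<omega>. (\<Prod>b<k. \<phi> (max_increment d n (weighted_sums d A (\<lambda>q. \<Delta> q \<omega>) (b * n)))) \<partial>M)
    = (\<Prod>b<k. \<integral>\<^sup>+\<omega>. \<phi> (max_increment d n (weighted_sums d A (\<lambda>q. \<Delta> q \<omega>) (b * n))) \<partial>M)"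
proof -
  define K where "K b = {b * n..<Suc b * n} \<times> {..<d}" for b
  define f where "f b z = \<phi> (max_increment d n (weighted_sums d A z (b * n)))" for b and z :: "nat \<times> nat \<Rightarrow> real"
  have "indep_vars (\<lambda>_. borel) (\<lambda>b \<omega>. f b (restrict (\<lambda>q. \<Delta> q \<omega>) (K b))) {..<k}"
  proof (rule indep_vars_compose2[OF indep_vars_restrict[OF ind]])
    show "f b \<in> borel_measurable (PiM (K b) (\<lambda>_. borel))" for b
      unfolding f_def
      by (intro measurable_compose[OF _ \<phi>] borel_measurable_max_increment borel_measurable_weighted_sums
          measurable_component_singleton) (auto simp: K_def)
    show "K b \<subseteq> {..<k * n} \<times> {..<d}" if "b \<in> {..<k}" for b
    proof -
      have "Suc b * n \<le> k * n" using that by (intro mult_right_mono) auto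
      then show ?thesis by (auto simp: K_def)
    qed
    have "b * n + n \<le> b' * n" if "b < b'" for b b' :: nat
      using mult_right_mono[of "Suc b" b' n] that by simp
    then have "K b \<inter> K b' = {}" if "b < b'" for b b' using that by (fastforce simp: K_def)
    then show "disjoint_family_on K {..<k}"
      unfolding disjoint_family_on_def by (metis inf_commute linorder_neqE_nat)
  qed
  moreover have "f b (restrict (\<lambda>q. \<Delta> q \<omega>) (K b)) = f b (\<lambda>q. \<Delta> q \<omega>)" for b \<omega>
  proof -
    have "weighted_sums d A (restrict (\<lambda>q. \<Delta> q \<omega>) (K b)) (b * n) l i = weighted_sums d A (\<lambda>q. \<Delta> q \<omega>) (b * n) l i"
      if "l \<le> n" for l i
      unfolding weighted_sums_def using that by (intro sum.cong) (auto simp: K_def)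
    then show ?thesis unfolding f_def by (intro arg_cong[of _ _ \<phi>] max_increment_cong) auto
  qed
  ultimately have "indep_vars (\<lambda>_. borel) (\<lambda>b \<omega>. f b (\<lambda>q. \<Delta> q \<omega>)) {..<k}" by simp
  from indep_vars_nn_integral[OF _ this] show ?thesis by (simp add: f_def)
qed

end

section \<open>Oscillation of the driving noise\<close>

text \<open>An upper bound of the true oscillation: twice the largest deviation from the left
  endpoint, in the shape of \<open>max_increment\<close>, so that grid values converge to
  it.\<close>

definition oscillation :: "nat \<Rightarrow> (real \<Rightarrow> nat \<Rightarrow> real) \<Rightarrow> real \<Rightarrow> real \<Rightarrow> real" where
  "oscillation d z s T = 2 * (SUP (t, i)\<in>{0..T} \<times> {..<d}. \<bar>z (s + t) i - z s i\<bar>)"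

definition grid_oscillation :: "nat \<Rightarrow> (real \<Rightarrow> nat \<Rightarrow> real) \<Rightarrow> real \<Rightarrow> real \<Rightarrow> nat \<Rightarrow> real" where
  "grid_oscillation d z s T n = max_increment d n (\<lambda>l i. z (s + real l * (T / real n)) i - z s i)"

context
  fixes d :: nat and z :: "real \<Rightarrow> nat \<Rightarrow> real" and s T :: real
  assumes d: "0 < d" and T: "0 < T"
    and cont: "\<And>i. i < d \<Longrightarrow> continuous_on {s..s + T} (\<lambda>t. z t i)"
begin

lemma increment_continuous: "i < d \<Longrightarrow> continuous_on {0..T} (\<lambda>t. \<bar>z (s + t) i - z s i\<bar>)"
  by (intro continuous_intros continuous_on_compose2[OF cont]) auto

lemma oscillation_attained:
  obtains t i where "t \<in> {0..T}" "i < d" "oscillation d z s T = 2 * \<bar>z (s + t) i - z s i\<bar>"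
    "\<And>r j. r \<in> {0..T} \<Longrightarrow> j < d \<Longrightarrow> \<bar>z (s + r) j - z s j\<bar> \<le> \<bar>z (s + t) i - z s i\<bar>"
proof -
  define f where "f i t = \<bar>z (s + t) i - z s i\<bar>" for i t
  have "\<exists>t\<in>{0..T}. \<forall>r\<in>{0..T}. f i r \<le> f i t" if "i < d" for i
    using continuous_attains_sup[of "{0..T}" "f i"] increment_continuous[OF that] T by (auto simp: f_def)
  then obtain t where t: "\<And>i. i < d \<Longrightarrow> t i \<in> {0..T}" "\<And>i r. i < d \<Longrightarrow> r \<in> {0..T} \<Longrightarrow> f i r \<le> f i (t i)"
    by metis
  have "Max ((\<lambda>i. f i (t i)) ` {..<d}) \<in> (\<lambda>i. f i (t i)) ` {..<d}" using d by (intro Max_in) auto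
  then obtain i where i: "i < d" "Max ((\<lambda>i. f i (t i)) ` {..<d}) = f i (t i)" by auto
  have le: "f j r \<le> f i (t i)" if "r \<in> {0..T}" "j < d" for r j
  proof -
    have "f j (t j) \<le> f i (t i)" unfolding i(2)[symmetric] using that by (intro Max_ge) auto
    then show ?thesis using t(2)[OF that(2,1)] by simp
  qed
  have "(SUP (t, i)\<in>{0..T} \<times> {..<d}. f i t) = f i (t i)"
  proof (rule antisym)
    show "(SUP (t, i)\<in>{0..T} \<times> {..<d}. f i t) \<le> f i (t i)"
      using d T le by (intro cSUP_least) auto
    have "(\<lambda>(t, i). f i t) (t i, i) \<le> (SUP (t, i)\<in>{0..T} \<times> {..<d}. f i t)"
      using i t(1) le by (intro cSUP_upper bdd_aboveI2[where M = "f i (t i)"]) auto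
    then show "f i (t i) \<le> (SUP (t, i)\<in>{0..T} \<times> {..<d}. f i t)" by simp
  qed
  then have "oscillation d z s T = 2 * f i (t i)" by (simp add: oscillation_def f_def)
  then show ?thesis using that[of "t i" i] t(1) i(1) le unfolding f_def by blast
qed

lemma oscillation_nonneg: "0 \<le> oscillation d z s T"
  by (rule oscillation_attained) auto

lemma increment_le_oscillation:
  assumes "i < d" "s \<le> a" "a \<le> b" "b \<le> s + T"
  shows "z b i - z a i \<le> oscillation d z s T"
proof (rule oscillation_attained)
  fix t k
  assume o: "oscillation d z s T = 2 * \<bar>z (s + t) k - z s k\<bar>"
    and le: "\<And>r j. r \<in> {0..T} \<Longrightarrow> j < d \<Longrightarrow> \<bar>z (s + r) j - z s j\<bar> \<le> \<bar>z (s + t) k - z s k\<bar>"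
  have "\<bar>z a i - z s i\<bar> \<le> \<bar>z (s + t) k - z s k\<bar>" "\<bar>z b i - z s i\<bar> \<le> \<bar>z (s + t) k - z s k\<bar>"
    using le[of "a - s" i] le[of "b - s" i] assms by simp_all
  then have "- (z a i - z s i) \<le> \<bar>z (s + t) k - z s k\<bar>" "z b i - z s i \<le> \<bar>z (s + t) k - z s k\<bar>"
    by (simp_all only: abs_le_iff)
  then have "- (z a i - z s i) + (z b i - z s i) \<le> \<bar>z (s + t) k - z s k\<bar> + \<bar>z (s + t) k - z s k\<bar>"
    by (rule add_mono)
  then show ?thesis unfolding o by (simp only: mult_2)
qed

lemma grid_oscillation_tendsto: "(\<lambda>n. grid_oscillation d z s T (Suc n)) \<longlonglongrightarrow> oscillation d z s T"
proof (rule oscillation_attained)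
  fix t i
  assume t: "t \<in> {0..T}" and i: "i < d" and o: "oscillation d z s T = 2 * \<bar>z (s + t) i - z s i\<bar>"
    and le: "\<And>r j. r \<in> {0..T} \<Longrightarrow> j < d \<Longrightarrow> \<bar>z (s + r) j - z s j\<bar> \<le> \<bar>z (s + t) i - z s i\<bar>"
  \<comment> \<open>The index of the last grid point not after the maximiser \<open>t\<close>. These
    grid points tend to \<open>t\<close>, which gives the lower bound; \<open>Suc n\<close> keeps
    the mesh defined.\<close>
  define l where "l n = nat \<lfloor>real (Suc n) * t / T\<rfloor>" for n
  define g where "g n = real (l n) * (T / real (Suc n))" for n
  have l_le: "real (l n) \<le> real (Suc n) * t / T" "real (Suc n) * t / T < real (l n) + 1" for n
    using t T by (auto simp: l_def floor_le_iff)
  have g: "g n \<le> t" "t \<le> g n + T / real (Suc n)" "0 \<le> g n" for n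
  proof -
    have eq: "real (Suc n) * t / T * (T / real (Suc n)) = t" using T by simp
    show "g n \<le> t" "t \<le> g n + T / real (Suc n)"
      using mult_right_mono[OF l_le(1)[of n], of "T / real (Suc n)"]
        mult_right_mono[OF less_imp_le[OF l_le(2)[of n]], of "T / real (Suc n)"] T
      unfolding eq g_def by (simp_all add: distrib_right add_divide_distrib)
    show "0 \<le> g n" using T by (simp add: g_def)
  qed
  have gT: "g n \<in> {0..T}" for n using g[of n] t by auto
  have lS: "l n \<le> Suc n" for n
  proof -
    have "real (Suc n) * t / T \<le> real (Suc n)"       using mult_left_mono[of t T "real (Suc n)"] t T by (simp add: pos_divide_le_eq)
    then have "real (l n) \<le> real (Suc n)" using l_le(1)[of n] by linarith
    then show ?thesis by simp
  qed
  have T0: "(\<lambda>n. T / real (Suc n)) \<longlonglongrightarrow> 0"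
    using tendsto_mult_right_zero[OF LIMSEQ_inverse_real_of_nat, of T] by (simp add: divide_inverse)
  have "g \<longlonglongrightarrow> t"
  proof (rule tendsto_sandwich[OF _ _ _ tendsto_const])
    show "(\<lambda>n. t - T / real (Suc n)) \<longlonglongrightarrow> t" using tendsto_diff[OF tendsto_const T0, of t] by simp
    show "\<forall>\<^sub>F n in sequentially. t - T / real (Suc n) \<le> g n" using g(2) by (simp add: algebra_simps)
    show "\<forall>\<^sub>F n in sequentially. g n \<le> t" using g(1) by simp
  qed
  then have "(\<lambda>n. \<bar>z (s + g n) i - z s i\<bar>) \<longlonglongrightarrow> \<bar>z (s + t) i - z s i\<bar>"
    by (intro continuous_on_tendsto_compose[OF increment_continuous[OF i]]) (use t gT in auto)
  then have lower: "(\<lambda>n. 2 * \<bar>z (s + g n) i - z s i\<bar>) \<longlonglongrightarrow> oscillation d z s T"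
    unfolding o by (intro tendsto_mult tendsto_const)
  show ?thesis
  proof (rule tendsto_sandwich[OF _ _ lower tendsto_const])
    show "\<forall>\<^sub>F n in sequentially. 2 * \<bar>z (s + g n) i - z s i\<bar> \<le> grid_oscillation d z s T (Suc n)"
      unfolding grid_oscillation_def g_def
      by (intro always_eventually allI max_increment_upper[OF lS i])
    show "\<forall>\<^sub>F n in sequentially. grid_oscillation d z s T (Suc n) \<le> oscillation d z s T"
    proof (intro always_eventually allI)
      fix n
      obtain m j where mj: "m \<le> Suc n" "j < d"
        "grid_oscillation d z s T (Suc n) = 2 * \<bar>z (s + real m * (T / real (Suc n))) j - z s j\<bar>"
        unfolding grid_oscillation_def by (rule max_increment_attained[OF d])
      have "real m * (T / real (Suc n)) \<le> real (Suc n) * (T / real (Suc n))"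
        using mj(1) T by (intro mult_right_mono) auto
      then have "real m * (T / real (Suc n)) \<in> {0..T}" using T by simp
      from le[OF this mj(2)] show "grid_oscillation d z s T (Suc n) \<le> oscillation d z s T"
        unfolding mj(3) o by simp
    qed
  qed
qed

end

text \<open>\<open>h (Z \<omega>)\<close> and the functional \<open>F\<close> of the process have
  the same value type, so \<open>indep_var\<close> applies to them; their events are preimages of
  events of \<open>Z\<close> and of the process.\<close>

lemma indep_process_nn_integral:
  fixes h :: "(nat \<Rightarrow> real) \<Rightarrow> ennreal" and F :: "(real \<times> nat \<Rightarrow> real) \<Rightarrow> ennreal"
  assumes M: "prob_space M" and ind: "independent_of_process M d Z X"
    and X: "\<And>t i. 0 \<le> t \<Longrightarrow> i < d \<Longrightarrow> (\<lambda>\<omega>. X \<omega> t i) \<in> borel_measurable M"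
    and h: "h \<in> borel_measurable (state_space d)"
    and F: "F \<in> borel_measurable (PiM ({0..} \<times> {..<d}) (\<lambda>_. borel))"
  shows "(\<integral>\<^sup>+\<omega>. h (Z \<omega>) * F (\<lambda>(t, i)\<in>{0..} \<times> {..<d}. X \<omega> t i) \<partial>M)
    = (\<integral>\<^sup>+\<omega>. h (Z \<omega>) \<partial>M) * (\<integral>\<^sup>+\<omega>. F (\<lambda>(t, i)\<in>{0..} \<times> {..<d}. X \<omega> t i) \<partial>M)"
proof -
  interpret prob_space M by (rule M)
  let ?X = "\<lambda>\<omega>. \<lambda>(t, i)\<in>{0..} \<times> {..<d}. X \<omega> t i"
  let ?S = "PiM ({0..} \<times> {..<d}) (\<lambda>_. borel :: real measure)"
  have Z: "Z \<in> M \<rightarrow>\<^sub>M state_space d"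
    and iset: "indep_set {Z -` A \<inter> space M | A. A \<in> sets (state_space d)} {?X -` A \<inter> space M | A. A \<in> sets ?S}"
    using ind unfolding independent_of_process_def by auto
  have Xm: "?X \<in> M \<rightarrow>\<^sub>M ?S"
    by (rule measurable_restrict) (auto intro: X)
  have hZ: "(\<lambda>\<omega>. h (Z \<omega>)) \<in> borel_measurable M" by (rule measurable_compose[OF Z h])
  have FX: "(\<lambda>\<omega>. F (?X \<omega>)) \<in> borel_measurable M" by (rule measurable_compose[OF Xm F])
  have stable: "Int_stable {f -` A \<inter> space M | A. A \<in> sets N}" for f :: "'a \<Rightarrow> 'c" and N :: "'c measure"
  proof (rule Int_stableI)
    fix a b assume "a \<in> {f -` A \<inter> space M | A. A \<in> sets N}" "b \<in> {f -` A \<inter> space M | A. A \<in> sets N}"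
    then obtain A B where "a = f -` A \<inter> space M" "b = f -` B \<inter> space M" "A \<in> sets N" "B \<in> sets N" by auto
    then have "a \<inter> b = f -` (A \<inter> B) \<inter> space M" "A \<inter> B \<in> sets N" by auto
    then show "a \<inter> b \<in> {f -` A \<inter> space M | A. A \<in> sets N}" by blast
  qed
  have "indep_set {(\<lambda>\<omega>. h (Z \<omega>)) -` A \<inter> space M | A. A \<in> sets borel} {(\<lambda>\<omega>. F (?X \<omega>)) -` A \<inter> space M | A. A \<in> sets borel}"
  proof (rule indep_setI)
    show "{(\<lambda>\<omega>. h (Z \<omega>)) -` A \<inter> space M | A. A \<in> sets borel} \<subseteq> events"
      using measurable_sets[OF hZ] by auto
    show "{(\<lambda>\<omega>. F (?X \<omega>)) -` A \<inter> space M | A. A \<in> sets borel} \<subseteq> events"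
      using measurable_sets[OF FX] by auto
    fix a b assume "a \<in> {(\<lambda>\<omega>. h (Z \<omega>)) -` A \<inter> space M | A. A \<in> sets borel}"
      "b \<in> {(\<lambda>\<omega>. F (?X \<omega>)) -` A \<inter> space M | A. A \<in> sets borel}"
    then obtain A B where ab: "a = (\<lambda>\<omega>. h (Z \<omega>)) -` A \<inter> space M" "A \<in> sets borel"
      "b = (\<lambda>\<omega>. F (?X \<omega>)) -` B \<inter> space M" "B \<in> sets borel" by auto
    have "a = Z -` (h -` A \<inter> space (state_space d)) \<inter> space M"
      using ab(1) measurable_space[OF Z] by auto
    moreover have "h -` A \<inter> space (state_space d) \<in> sets (state_space d)"
      by (rule measurable_sets[OF h ab(2)])
    moreover have "b = ?X -` (F -` B \<inter> space ?S) \<inter> space M"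
      using ab(3) measurable_space[OF Xm] by auto
    moreover have "F -` B \<inter> space ?S \<in> sets ?S"
      by (rule measurable_sets[OF F ab(4)])
    ultimately show "prob (a \<inter> b) = prob a * prob b"
      by (intro indep_setD[OF iset]) blast+
  qed
  then have "indep_var borel (\<lambda>\<omega>. h (Z \<omega>)) borel (\<lambda>\<omega>. F (?X \<omega>))"
    unfolding indep_var_eq using hZ FX by (intro conjI indep_set_sigma_sets stable)
  from indep_var_nn_integral[OF this] show ?thesis .
qed

text \<open>\<open>A\<close> will be \<open>R^-1 C\<close>, so \<open>noise\<close> is the
  martingale part of the workload of the driving process and \<open>V\<close> bounds its variance
  per unit time in each coordinate.\<close>

locale brownian_noise =
  fixes M :: "'w measure" and d :: nat and B :: "'w \<Rightarrow> real \<Rightarrow> nat \<Rightarrow> real"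
    and A :: "nat \<Rightarrow> nat \<Rightarrow> real" and V :: real
  assumes bm: "standard_brownian_motion M d B" and d: "0 < d"
    and var: "\<And>i. i < d \<Longrightarrow> (\<Sum>j<d. (A i j)\<^sup>2) \<le> V"
begin

sublocale prob_space M
  using bm by (simp add: standard_brownian_motion_def)

definition noise :: "'w \<Rightarrow> real \<Rightarrow> nat \<Rightarrow> real" where
  "noise \<omega> t i = (\<Sum>j<d. A i j * B \<omega> t j)"

definition increment :: "real \<Rightarrow> real \<Rightarrow> nat \<times> nat \<Rightarrow> 'w \<Rightarrow> real" where
  "increment s h = (\<lambda>(r, j) \<omega>. B \<omega> (s + real (Suc r) * h) j - B \<omega> (s + real r * h) j)"

lemma B_measurable: "j < d \<Longrightarrow> 0 \<le> t \<Longrightarrow> (\<lambda>\<omega>. B \<omega> t j) \<in> borel_measurable M"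
  and B_continuous: "j < d \<Longrightarrow> \<omega> \<in> space M \<Longrightarrow> continuous_on {0..} (\<lambda>t. B \<omega> t j)"
  using bm by (auto simp: standard_brownian_motion_def)

lemma noise_measurable: "0 \<le> t \<Longrightarrow> (\<lambda>\<omega>. noise \<omega> t i) \<in> borel_measurable M"
  unfolding noise_def by (intro borel_measurable_sum borel_measurable_times borel_measurable_const B_measurable) auto

lemma noise_continuous: "\<omega> \<in> space M \<Longrightarrow> continuous_on {0..} (\<lambda>t. noise \<omega> t i)"
  unfolding noise_def by (intro continuous_intros B_continuous) auto

lemma increment_indep:
  assumes "0 \<le> s" "0 < h"
  shows "indep_vars (\<lambda>_. borel) (increment s h) ({..<n} \<times> {..<d})"
proof -
  define \<tau> where "\<tau> r = s + real r * h" for r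
  have "0 \<le> \<tau> 0" "strict_mono_on {..n} \<tau>"
    using assms by (auto simp: \<tau>_def strict_mono_on_def)
  then have "indep_vars (\<lambda>_. borel) (\<lambda>(k, i) \<omega>. B \<omega> (\<tau> (Suc k)) i - B \<omega> (\<tau> k) i) ({..<n} \<times> {..<d})"
    using bm unfolding standard_brownian_motion_def by blast
  then show ?thesis by (simp add: increment_def \<tau>_def)
qed

lemma increment_mgf:
  assumes "0 \<le> s" "0 < h" "j < d"
  shows "(\<integral>\<^sup>+\<omega>. ennreal (exp (c * increment s h (r, j) \<omega>)) \<partial>M) = ennreal (exp (c\<^sup>2 * h / 2))"
proof -
  let ?s = "s + real r * h" and ?t = "s + real (Suc r) * h"
  have st: "0 \<le> ?s" "?s < ?t" "?t - ?s = h" using assms by (auto simp: algebra_simps)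
  then have "distributed M lborel (\<lambda>\<omega>. B \<omega> ?t j - B \<omega> ?s j) (normal_density 0 (sqrt (?t - ?s)))"
    using bm assms(3) unfolding standard_brownian_motion_def by blast
  then have "distributed M lborel (increment s h (r, j)) (normal_density 0 (sqrt h))"
    unfolding st(3) by (simp add: increment_def)
  from nn_integral_exp_normal[OF this, of c] assms(2) show ?thesis by simp
qed

lemma weighted_sums_increment:
  "weighted_sums d A (\<lambda>q. increment s h q \<omega>) r0 l i
    = noise \<omega> (s + real (r0 + l) * h) i - noise \<omega> (s + real r0 * h) i"
proof -
  have "weighted_sums d A (\<lambda>q. increment s h q \<omega>) r0 l i
      = (\<Sum>r<l. noise \<omega> (s + real (r0 + Suc r) * h) i - noise \<omega> (s + real (r0 + r) * h) i)"
    by (simp add: weighted_sums_def increment_def noise_def right_diff_distrib sum_subtractf)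
  also have "\<dots> = noise \<omega> (s + real (r0 + l) * h) i - noise \<omega> (s + real (r0 + 0) * h) i"
    by (rule sum_lessThan_telescope)
  finally show ?thesis by simp
qed

lemma grid_oscillation_measurable:
  assumes "0 \<le> s" "0 \<le> T"
  shows "(\<lambda>\<omega>. grid_oscillation d (noise \<omega>) s T n) \<in> borel_measurable M"
  unfolding grid_oscillation_def
  using assms by (intro borel_measurable_max_increment borel_measurable_diff noise_measurable) auto

lemma noise_continuous_on: "\<omega> \<in> space M \<Longrightarrow> 0 \<le> s \<Longrightarrow> continuous_on {s..s + T} (\<lambda>t. noise \<omega> t i)"
  using noise_continuous by (rule continuous_on_subset) auto

lemma grid_oscillation_LIMSEQ:
  "0 \<le> s \<Longrightarrow> 0 < T \<Longrightarrow> \<omega> \<in> space M \<Longrightarrow>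
    (\<lambda>n. grid_oscillation d (noise \<omega>) s T (Suc n)) \<longlonglongrightarrow> oscillation d (noise \<omega>) s T"
  using noise_continuous_on d by (intro grid_oscillation_tendsto) auto

lemma oscillation_measurable:
  assumes "0 \<le> s" "0 < T"
  shows "(\<lambda>\<omega>. oscillation d (noise \<omega>) s T) \<in> borel_measurable M"
  by (rule borel_measurable_LIMSEQ_real[OF grid_oscillation_LIMSEQ grid_oscillation_measurable])
    (use assms in auto)

text \<open>\<open>n\<close> steps of length \<open>T / n\<close> have total length
  \<open>T\<close>, so the bound is uniform in the grid, which is what Fatou's lemma asks
  for.\<close>

lemma grid_oscillation_moment:
  assumes "0 \<le> s" "0 < T" "0 < n"
  shows "(\<integral>\<^sup>+\<omega>. ennreal (exp (p * grid_oscillation d (noise \<omega>) s T n)) \<partial>M)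
    \<le> ennreal (8 * real d * exp (2 * p\<^sup>2 * V * T))"
proof -
  let ?h = "T / real n"
  have h: "0 < ?h" using assms by simp
  have "(\<integral>\<^sup>+\<omega>. ennreal (exp (p * max_increment d n (weighted_sums d A (\<lambda>q. increment s ?h q \<omega>) 0))) \<partial>M)
    \<le> ennreal (8 * real d * exp (2 * p\<^sup>2 * V * (real n * ?h)))"
    by (rule max_increment_exp_moment[OF increment_indep increment_mgf]) (use assms h var d in auto)
  then show ?thesis
    using assms by (simp add: grid_oscillation_def weighted_sums_increment[abs_def])
qed

text \<open>The grids of the \<open>k\<close> blocks are consecutive pieces of one grid of mesh
  \<open>T / n\<close> that starts at 0.\<close>

lemma grid_oscillation_product:
  fixes \<phi> :: "real \<Rightarrow> ennreal"
  assumes T: "0 < T" and n: "0 < n" and \<phi>: "\<phi> \<in> borel_measurable borel"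
  shows "(\<integral>\<^sup>+\<omega>. (\<Prod>b<k. \<phi> (grid_oscillation d (noise \<omega>) (real b * T) T n)) \<partial>M)
    = (\<Prod>b<k. \<integral>\<^sup>+\<omega>. \<phi> (grid_oscillation d (noise \<omega>) (real b * T) T n) \<partial>M)"
proof -
  let ?h = "T / real n"
  have "max_increment d n (weighted_sums d A (\<lambda>q. increment 0 ?h q \<omega>) (b * n))
      = grid_oscillation d (noise \<omega>) (real b * T) T n" for b \<omega>
    unfolding grid_oscillation_def weighted_sums_increment
    using n by (intro max_increment_cong) (simp add: field_simps)
  moreover have "indep_vars (\<lambda>_. borel) (increment 0 ?h) ({..<k * n} \<times> {..<d})"
    using T n by (intro increment_indep) auto
  ultimately show ?thesis
    using block_product_nn_integral[OF _ \<phi>, of "increment 0 ?h" k n d A] by simp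
qed

lemma oscillation_moment:
  assumes "0 \<le> s" "0 < T"
  shows "(\<integral>\<^sup>+\<omega>. ennreal (exp (p * oscillation d (noise \<omega>) s T)) \<partial>M) \<le> ennreal (8 * real d * exp (2 * p\<^sup>2 * V * T))"
proof -
  let ?f = "\<lambda>n \<omega>. ennreal (exp (p * grid_oscillation d (noise \<omega>) s T (Suc n)))"
  have "(\<integral>\<^sup>+\<omega>. ennreal (exp (p * oscillation d (noise \<omega>) s T)) \<partial>M) = (\<integral>\<^sup>+\<omega>. liminf (\<lambda>n. ?f n \<omega>) \<partial>M)"
  proof (rule nn_integral_cong)
    fix \<omega> assume "\<omega> \<in> space M"
    then have "(\<lambda>n. ?f n \<omega>) \<longlonglongrightarrow> ennreal (exp (p * oscillation d (noise \<omega>) s T))"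
      using assms by (intro tendsto_ennrealI tendsto_exp tendsto_mult tendsto_const grid_oscillation_LIMSEQ)
    then show "ennreal (exp (p * oscillation d (noise \<omega>) s T)) = liminf (\<lambda>n. ?f n \<omega>)"
      by (rule lim_imp_Liminf[OF trivial_limit_sequentially, symmetric])
  qed
  also have "\<dots> \<le> liminf (\<lambda>n. \<integral>\<^sup>+\<omega>. ?f n \<omega> \<partial>M)"
    using assms by (intro nn_integral_liminf measurable_compose[OF _ measurable_ennreal]
        measurable_compose[OF _ borel_measurable_exp] borel_measurable_times borel_measurable_const grid_oscillation_measurable) auto
  also have "\<dots> \<le> ennreal (8 * real d * exp (2 * p\<^sup>2 * V * T))"
    using grid_oscillation_moment[OF assms] by (intro Liminf_le always_eventually) auto
  finally show ?thesis .
qed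

text \<open>\<open>Z\<close> is independent of \<open>X\<close>, so the noise must be a function of
  \<open>X\<close>; this is the role of \<open>noise_X\<close>. The product space of paths sees only
  countably many times, so the factorisation is done for grid functionals and Fatou's lemma passes
  to the oscillation.\<close>

lemma independent_oscillation_product:
  fixes \<phi> :: "real \<Rightarrow> real" and h :: "(nat \<Rightarrow> real) \<Rightarrow> real"
  assumes ind: "independent_of_process M d Z X"
    and Xm: "\<And>t i. 0 \<le> t \<Longrightarrow> i < d \<Longrightarrow> (\<lambda>\<omega>. X \<omega> t i) \<in> borel_measurable M"
    and noise_X: "\<And>\<omega> t i. \<omega> \<in> space M \<Longrightarrow> 0 \<le> t \<Longrightarrow> i < d \<Longrightarrow> noise \<omega> t i = (\<Sum>j<d. D i j * X \<omega> t j) - t * c i"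
    and T: "0 < T" and \<phi>: "continuous_on UNIV \<phi>" "\<And>x. 0 \<le> \<phi> x"
    and h: "h \<in> borel_measurable (state_space d)" "\<And>y. 0 \<le> h y"
    and le: "\<And>b n. 0 < n \<Longrightarrow> (\<integral>\<^sup>+\<omega>. ennreal (\<phi> (grid_oscillation d (noise \<omega>) (real b * T) T n)) \<partial>M) \<le> q"
  shows "(\<integral>\<^sup>+\<omega>. ennreal (h (Z \<omega>) * (\<Prod>b<k. \<phi> (oscillation d (noise \<omega>) (real b * T) T))) \<partial>M)
    \<le> (\<integral>\<^sup>+\<omega>. ennreal (h (Z \<omega>)) \<partial>M) * q ^ k"
proof -
  let ?g = "\<lambda>n b \<omega>. grid_oscillation d (noise \<omega>) (real b * T) T n"
  have \<phi>m: "\<phi> \<in> borel_measurable borel" using \<phi>(1) by (rule borel_measurable_continuous_onI)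
  have Z: "Z \<in> M \<rightarrow>\<^sub>M state_space d" using ind unfolding independent_of_process_def by auto
  have grid: "(\<integral>\<^sup>+\<omega>. ennreal (h (Z \<omega>) * (\<Prod>b<k. \<phi> (?g n b \<omega>))) \<partial>M) \<le> (\<integral>\<^sup>+\<omega>. ennreal (h (Z \<omega>)) \<partial>M) * q ^ k"
    if n: "0 < n" for n
  proof -
    \<comment> \<open>Recovers the noise from a path of \<open>X\<close> by applying
      \<open>D\<close> and removing the linear drift.\<close>
    define zz where "zz q t i = (\<Sum>j<d. D i j * q (t, j)) - t * c i" for q :: "real \<times> nat \<Rightarrow> real" and t i
    define F where "F q = ennreal (\<Prod>b<k. \<phi> (grid_oscillation d (zz q) (real b * T) T n))" for q
    have Fm: "F \<in> borel_measurable (PiM ({0..} \<times> {..<d}) (\<lambda>_. borel))"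
      unfolding F_def grid_oscillation_def zz_def
      by (intro measurable_compose[OF _ measurable_ennreal] borel_measurable_prod measurable_compose[OF _ \<phi>m]
          borel_measurable_max_increment borel_measurable_diff borel_measurable_sum borel_measurable_times
          borel_measurable_const measurable_component_singleton) (use T in auto)
    have FX: "F (\<lambda>(t, i)\<in>{0..} \<times> {..<d}. X \<omega> t i) = (\<Prod>b<k. ennreal (\<phi> (?g n b \<omega>)))" if \<omega>: "\<omega> \<in> space M" for \<omega>
    proof -
      have zz: "zz (\<lambda>(t, i)\<in>{0..} \<times> {..<d}. X \<omega> t i) t i = noise \<omega> t i" if "0 \<le> t" "i < d" for t i
        unfolding noise_X[OF \<omega> that] zz_def using that by simp
      have "grid_oscillation d (zz (\<lambda>(t, i)\<in>{0..} \<times> {..<d}. X \<omega> t i)) (real b * T) T n = ?g n b \<omega>" for b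
        unfolding grid_oscillation_def using T by (intro max_increment_cong) (simp add: zz)
      then show ?thesis unfolding F_def using \<phi>(2) by (simp add: prod_ennreal)
    qed
    have "(\<integral>\<^sup>+\<omega>. ennreal (h (Z \<omega>) * (\<Prod>b<k. \<phi> (?g n b \<omega>))) \<partial>M)
       = (\<integral>\<^sup>+\<omega>. ennreal (h (Z \<omega>)) * F (\<lambda>(t, i)\<in>{0..} \<times> {..<d}. X \<omega> t i) \<partial>M)"
      using \<phi>(2) h(2) by (intro nn_integral_cong) (simp add: FX ennreal_mult prod_nonneg prod_ennreal)
    also have "\<dots> = (\<integral>\<^sup>+\<omega>. ennreal (h (Z \<omega>)) \<partial>M) * (\<integral>\<^sup>+\<omega>. F (\<lambda>(t, i)\<in>{0..} \<times> {..<d}. X \<omega> t i) \<partial>M)"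
      by (rule indep_process_nn_integral[OF prob_space_axioms ind Xm _ Fm]) (use h(1) in auto)
    also have "(\<integral>\<^sup>+\<omega>. F (\<lambda>(t, i)\<in>{0..} \<times> {..<d}. X \<omega> t i) \<partial>M) = (\<integral>\<^sup>+\<omega>. (\<Prod>b<k. ennreal (\<phi> (?g n b \<omega>))) \<partial>M)"
      by (intro nn_integral_cong FX)
    also have "\<dots> = (\<Prod>b<k. \<integral>\<^sup>+\<omega>. ennreal (\<phi> (?g n b \<omega>)) \<partial>M)"
      by (rule grid_oscillation_product[OF T n]) (use \<phi>m in auto)
    also have "\<dots> \<le> q ^ k"
    proof (induction k)
      case (Suc k)
      then show ?case using le[OF n, of k] by (simp add: mult.commute[of q] mult_mono)
    qed simp
    finally show ?thesis by (simp add: mult_left_mono)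
  qed
  let ?f = "\<lambda>n \<omega>. ennreal (h (Z \<omega>) * (\<Prod>b<k. \<phi> (?g (Suc n) b \<omega>)))"
  have "(\<integral>\<^sup>+\<omega>. ennreal (h (Z \<omega>) * (\<Prod>b<k. \<phi> (oscillation d (noise \<omega>) (real b * T) T))) \<partial>M)
     = (\<integral>\<^sup>+\<omega>. liminf (\<lambda>n. ?f n \<omega>) \<partial>M)"
  proof (rule nn_integral_cong)
    fix \<omega> assume \<omega>: "\<omega> \<in> space M"
    have "(\<lambda>n. \<phi> (?g (Suc n) b \<omega>)) \<longlonglongrightarrow> \<phi> (oscillation d (noise \<omega>) (real b * T) T)" for b
      using T \<omega> by (intro continuous_on_tendsto_compose[OF \<phi>(1) grid_oscillation_LIMSEQ]) auto
    then have "(\<lambda>n. ?f n \<omega>) \<longlonglongrightarrow> ennreal (h (Z \<omega>) * (\<Prod>b<k. \<phi> (oscillation d (noise \<omega>) (real b * T) T)))"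
      by (intro tendsto_ennrealI tendsto_mult tendsto_const tendsto_prod)
    then show "ennreal (h (Z \<omega>) * (\<Prod>b<k. \<phi> (oscillation d (noise \<omega>) (real b * T) T))) = liminf (\<lambda>n. ?f n \<omega>)"
      by (rule lim_imp_Liminf[OF trivial_limit_sequentially, symmetric])
  qed
  also have "\<dots> \<le> liminf (\<lambda>n. \<integral>\<^sup>+\<omega>. ?f n \<omega> \<partial>M)"
    using T by (intro nn_integral_liminf measurable_compose[OF _ measurable_ennreal] borel_measurable_times borel_measurable_prod
        measurable_compose[OF _ \<phi>m] measurable_compose[OF Z h(1)] grid_oscillation_measurable) auto
  also have "\<dots> \<le> (\<integral>\<^sup>+\<omega>. ennreal (h (Z \<omega>)) \<partial>M) * q ^ k"
    using grid by (intro Liminf_le always_eventually) auto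
  finally show ?thesis .
qed

end

section \<open>Moments of stationary distributions\<close>

text \<open>
  A function that is not measurable has a pushforward that vanishes on some set and on its
  complement, or is the zero measure; so a pushforward that is a probability measure comes from a
  measurable function.
\<close>

lemma measurable_if_distr_prob_space:
  assumes p: "prob_space (distr M N f)" and f: "\<And>x. x \<in> space M \<Longrightarrow> f x \<in> space N"
  shows "f \<in> M \<rightarrow>\<^sub>M N"
proof (rule measurableI[OF f])
  interpret prob_space "distr M N f" by (rule p)
  let ?\<mu> = "\<lambda>A. emeasure M (f -` A \<inter> space M)"
  have conv: "emeasure (distr M N f) A = (if measure_space (space N) (sets N) ?\<mu> then ?\<mu> A else 0)" if "A \<in> sets N" for A
    unfolding distr_def using that
    by (simp add: emeasure_measure_of_conv sets.sigma_sets_eq)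
  fix A assume A: "A \<in> sets N"
  show "f -` A \<inter> space M \<in> sets M"
  proof (rule ccontr)
    assume nm: "f -` A \<inter> space M \<notin> sets M"
    have eq: "f -` A \<inter> space M = space M - (f -` (space N - A) \<inter> space M)" using f by auto
    have "f -` (space N - A) \<inter> space M \<notin> sets M" using nm unfolding eq by blast
    then have "emeasure (distr M N f) A = 0" "emeasure (distr M N f) (space N - A) = 0"
      using nm A by (simp_all add: conv emeasure_notin_sets)
    moreover have "emeasure (distr M N f) (space N)
      = emeasure (distr M N f) A + emeasure (distr M N f) (space N - A)"
      using A by (subst plus_emeasure) (auto simp: Un_Diff_cancel sets.sets_into_space[OF A] Un_absorb1)
    ultimately show False using emeasure_space_1 by simp
  qed
qed

text \<open>If the integral of \<open>f\<close> were known to be finite,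
  \<open>E f \<le> \<gamma> * E f + b\<close> could be solved at once. Truncation makes all
  integrals finite; iterating replaces \<open>f\<close> by \<open>\<gamma> ^ j * f\<close>, whose
  truncated integral tends to 0 by dominated convergence, and the additive terms form a geometric
  series.\<close>

lemma truncated_iteration_bound:
  fixes f :: "'a \<Rightarrow> real"
  assumes p: "prob_space \<pi>" and f: "f \<in> borel_measurable \<pi>" "\<And>y. 0 \<le> f y"
    and \<gamma>: "0 < \<gamma>" "\<gamma> < 1" and b: "0 \<le> b"
    and step: "\<And>c. 0 < c \<Longrightarrow> (\<integral>\<^sup>+y. ennreal (min (f y) c) \<partial>\<pi>) \<le> (\<integral>\<^sup>+y. ennreal (min (\<gamma> * f y) c) \<partial>\<pi>) + ennreal b"
  shows "(\<integral>\<^sup>+y. ennreal (f y) \<partial>\<pi>) \<le> ennreal (b / (1 - \<gamma>))"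
proof -
  interpret prob_space \<pi> by (rule p)
  define I where "I g c = (\<integral>\<^sup>+y. ennreal (min (g * f y) c) \<partial>\<pi>)" for g c
  have scale: "I (s * g) (s * c) = ennreal s * I g c" if "0 < s" for s g c
  proof -
    have "min (s * g * f y) (s * c) = s * min (g * f y) c" for y
      using that by (simp add: min_mult_distrib_left mult.assoc)
    then show ?thesis
      using that f unfolding I_def by (simp add: ennreal_mult' nn_integral_cmult)
  qed
  have it: "I 1 c \<le> I (\<gamma> ^ j) c + ennreal (b / (1 - \<gamma>) * (1 - \<gamma> ^ j))" if c: "0 < c" for j c
  proof (induction j)
    case 0 show ?case by simp
  next
    case (Suc j)
    let ?s = "\<gamma> ^ j"
    have s: "0 < ?s" using \<gamma> by simp
    \<comment> \<open>Scaling moves the factor \<open>\<gamma> ^ j\<close> into the truncation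
      level, so \<open>step\<close> is applied at level \<open>c / \<gamma> ^ j\<close>.\<close>
    have "I ?s c = ennreal ?s * I 1 (c / ?s)" using scale[OF s, of 1 "c / ?s"] \<gamma> by simp
    also have "\<dots> \<le> ennreal ?s * (I \<gamma> (c / ?s) + ennreal b)"
      using step[of "c / ?s"] c s by (intro mult_left_mono) (auto simp: I_def)
    also have "\<dots> = I (?s * \<gamma>) c + ennreal (?s * b)"
      using scale[OF s, of \<gamma> "c / ?s"] \<gamma> b by (simp add: distrib_left ennreal_mult)
    finally have "I 1 c \<le> I (\<gamma> ^ Suc j) c + (ennreal (?s * b) + ennreal (b / (1 - \<gamma>) * (1 - ?s)))"
      using Suc.IH by (auto simp: mult.commute ac_simps intro: order_trans add_mono)
    also have "ennreal (?s * b) + ennreal (b / (1 - \<gamma>) * (1 - ?s)) = ennreal (b / (1 - \<gamma>) * (1 - \<gamma> ^ Suc j))"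
    proof (subst ennreal_plus[symmetric])
      show "0 \<le> ?s * b" using s b by simp
      show "0 \<le> b / (1 - \<gamma>) * (1 - ?s)" using \<gamma> b by (simp add: power_le_one)
      have "?s * b = b / (1 - \<gamma>) * (?s * (1 - \<gamma>))" using \<gamma> by simp
      then have "?s * b + b / (1 - \<gamma>) * (1 - ?s) = b / (1 - \<gamma>) * (?s * (1 - \<gamma>) + (1 - ?s))"
        by (simp only: distrib_left)
      also have "?s * (1 - \<gamma>) + (1 - ?s) = 1 - \<gamma> ^ Suc j" by (simp add: algebra_simps)
      finally show "ennreal (?s * b + b / (1 - \<gamma>) * (1 - ?s)) = ennreal (b / (1 - \<gamma>) * (1 - \<gamma> ^ Suc j))"
        by (rule arg_cong)
    qed
    finally show ?case .
  qed
  have bound: "I 1 c \<le> ennreal (b / (1 - \<gamma>))" if c: "0 < c" for c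
  proof -
    have "(\<lambda>j. I (\<gamma> ^ j) c) \<longlonglongrightarrow> (\<integral>\<^sup>+y. 0 \<partial>\<pi>)"
      unfolding I_def
    proof (rule nn_integral_dominated_convergence[where w = "\<lambda>_. ennreal c"])
      show "AE y in \<pi>. (\<lambda>j. ennreal (min (\<gamma> ^ j * f y) c)) \<longlonglongrightarrow> 0"
      proof (rule AE_I2)
        fix y
        have "(\<lambda>j. \<gamma> ^ j * f y) \<longlonglongrightarrow> 0 * f y"
          using \<gamma> by (intro tendsto_mult LIMSEQ_realpow_zero tendsto_const) auto
        then have "(\<lambda>j. ennreal (min (\<gamma> ^ j * f y) c)) \<longlonglongrightarrow> ennreal (min 0 c)"
          by (intro tendsto_ennrealI tendsto_min tendsto_const) simp
        then show "(\<lambda>j. ennreal (min (\<gamma> ^ j * f y) c)) \<longlonglongrightarrow> 0" using c by simp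
      qed
      show "AE y in \<pi>. ennreal (min (\<gamma> ^ j * f y) c) \<le> ennreal c" for j by (intro AE_I2 ennreal_leI) simp
      show "(\<integral>\<^sup>+y. ennreal c \<partial>\<pi>) < \<infinity>" by (simp add: emeasure_space_1)
    qed (use f in auto)
    then have "(\<lambda>j. I (\<gamma> ^ j) c + ennreal (b / (1 - \<gamma>))) \<longlonglongrightarrow> 0 + ennreal (b / (1 - \<gamma>))"
      by (intro tendsto_add tendsto_const) simp
    moreover have "I 1 c \<le> I (\<gamma> ^ j) c + ennreal (b / (1 - \<gamma>))" for j
    proof -
      have "b / (1 - \<gamma>) * (1 - \<gamma> ^ j) \<le> b / (1 - \<gamma>) * 1" using \<gamma> b by (intro mult_left_mono) auto
      then show ?thesis using it[OF c, of j] by (auto intro: order_trans add_left_mono ennreal_leI)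
    qed
    ultimately show ?thesis by (intro LIMSEQ_le_const[where X = "\<lambda>j. I (\<gamma> ^ j) c + ennreal (b / (1 - \<gamma>))"]) auto
  qed
  have "(\<integral>\<^sup>+y. ennreal (f y) \<partial>\<pi>) = (\<integral>\<^sup>+y. liminf (\<lambda>n. ennreal (min (f y) (real (Suc n)))) \<partial>\<pi>)"
  proof (rule nn_integral_cong)
    fix y
    obtain N where N: "f y \<le> real N" using real_arch_simple by blast
    have "\<forall>\<^sub>F n in sequentially. ennreal (min (f y) (real (Suc n))) = ennreal (f y)"
      using eventually_ge_at_top[of N] by eventually_elim (use N in \<open>auto simp: min_def\<close>)
    then have "(\<lambda>n. ennreal (min (f y) (real (Suc n)))) \<longlonglongrightarrow> ennreal (f y)" by (rule tendsto_eventually)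
    then show "ennreal (f y) = liminf (\<lambda>n. ennreal (min (f y) (real (Suc n))))"
      by (rule lim_imp_Liminf[OF trivial_limit_sequentially, symmetric])
  qed
  also have "\<dots> \<le> liminf (\<lambda>n. \<integral>\<^sup>+y. ennreal (min (f y) (real (Suc n))) \<partial>\<pi>)"
    using f by (intro nn_integral_liminf) auto
  also have "\<dots> \<le> ennreal (b / (1 - \<gamma>))"
    using bound by (intro Liminf_le always_eventually) (auto simp: I_def)
  finally show ?thesis .
qed

text \<open>Stationarity rewrites the integral of the truncated \<open>f\<close> as one over the
  next state, where the drift inequality applies; averaging over the noise gives the hypothesis of
  \<open>truncated_iteration_bound\<close>.\<close>

lemma stationary_moment_bound:
  fixes f :: "'a \<Rightarrow> real" and G :: "'b \<Rightarrow> real"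
  assumes p: "prob_space \<pi>" and M: "prob_space M" and N: "sets \<pi> = sets N"
    and st: "distr (\<pi> \<Otimes>\<^sub>M M) N \<Phi> = \<pi>" and \<Phi>: "\<And>x. x \<in> space (\<pi> \<Otimes>\<^sub>M M) \<Longrightarrow> \<Phi> x \<in> space N"
    and f: "f \<in> borel_measurable N" "\<And>y. 0 \<le> f y"
    and G: "G \<in> borel_measurable M" "\<And>\<omega>. 0 \<le> G \<omega>" "(\<integral>\<^sup>+\<omega>. ennreal (G \<omega>) \<partial>M) \<le> ennreal g" "0 \<le> g"
    and drift: "AE y in \<pi>. \<forall>\<omega>\<in>space M. f (\<Phi> (y, \<omega>)) \<le> G \<omega> * (a * f y + c)"
    and ac: "0 < a" "0 \<le> c" and \<gamma>: "g * a \<le> \<gamma>" "0 < \<gamma>" "\<gamma> < 1"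
  shows "(\<integral>\<^sup>+y. ennreal (f y) \<partial>\<pi>) \<le> ennreal (g * c / (1 - \<gamma>))"
proof (rule truncated_iteration_bound[OF p])
  interpret \<pi>: prob_space \<pi> by (rule p)
  interpret M: prob_space M by (rule M)
  have f\<pi>: "f \<in> borel_measurable \<pi>" using f(1) N by (simp cong: measurable_cong_sets)
  then show "f \<in> borel_measurable \<pi>" .
  have \<Phi>m: "\<Phi> \<in> \<pi> \<Otimes>\<^sub>M M \<rightarrow>\<^sub>M N"
    by (rule measurable_if_distr_prob_space) (use st p \<Phi> in auto)
  fix K :: real assume K: "0 < K"
  have fm: "(\<lambda>x. ennreal (min (f (\<Phi> x)) K)) \<in> borel_measurable (\<pi> \<Otimes>\<^sub>M M)"
    using measurable_compose[OF \<Phi>m f(1)] by simp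
  have "(\<integral>\<^sup>+y. ennreal (min (f y) K) \<partial>\<pi>) = (\<integral>\<^sup>+y. ennreal (min (f y) K) \<partial>distr (\<pi> \<Otimes>\<^sub>M M) N \<Phi>)"
    by (simp only: st)
  also have "\<dots> = (\<integral>\<^sup>+x. ennreal (min (f (\<Phi> x)) K) \<partial>(\<pi> \<Otimes>\<^sub>M M))"
    using f(1) by (intro nn_integral_distr \<Phi>m) auto
  also have "\<dots> = (\<integral>\<^sup>+y. \<integral>\<^sup>+\<omega>. ennreal (min (f (\<Phi> (y, \<omega>))) K) \<partial>M \<partial>\<pi>)"
    by (rule M.nn_integral_fst[OF fm, symmetric])
  also have "\<dots> \<le> (\<integral>\<^sup>+y. ennreal (min (\<gamma> * f y) K) + ennreal (g * c) \<partial>\<pi>)"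
  proof (rule nn_integral_mono_AE, use drift in eventually_elim)
    fix y assume le: "\<forall>\<omega>\<in>space M. f (\<Phi> (y, \<omega>)) \<le> G \<omega> * (a * f y + c)"
    have "(\<integral>\<^sup>+\<omega>. ennreal (min (f (\<Phi> (y, \<omega>))) K) \<partial>M)
       \<le> (\<integral>\<^sup>+\<omega>. ennreal (min (G \<omega> * (a * f y)) K) + ennreal (G \<omega>) * ennreal c \<partial>M)"
    proof (rule nn_integral_mono)
      fix \<omega> assume "\<omega> \<in> space M"
      then have "f (\<Phi> (y, \<omega>)) \<le> G \<omega> * (a * f y) + G \<omega> * c" using le by (simp add: distrib_left)
      moreover have "0 \<le> G \<omega> * c" "0 \<le> G \<omega> * (a * f y)" using G ac f by simp_all
      ultimately have "min (f (\<Phi> (y, \<omega>))) K \<le> min (G \<omega> * (a * f y)) K + G \<omega> * c" by linarith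
      then have "ennreal (min (f (\<Phi> (y, \<omega>))) K) \<le> ennreal (min (G \<omega> * (a * f y)) K + G \<omega> * c)"
        by (rule ennreal_leI)
      also have "\<dots> = ennreal (min (G \<omega> * (a * f y)) K) + ennreal (G \<omega>) * ennreal c"
        using \<open>0 \<le> G \<omega> * (a * f y)\<close> \<open>0 \<le> G \<omega> * c\<close> K G(2) ac by (simp add: ennreal_plus ennreal_mult)
      finally show "ennreal (min (f (\<Phi> (y, \<omega>))) K) \<le> ennreal (min (G \<omega> * (a * f y)) K) + ennreal (G \<omega>) * ennreal c" .
    qed
    also have "\<dots> = (\<integral>\<^sup>+\<omega>. ennreal (min (G \<omega> * (a * f y)) K) \<partial>M) + (\<integral>\<^sup>+\<omega>. ennreal (G \<omega>) \<partial>M) * ennreal c"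
      using G(1) by (subst nn_integral_add) (auto simp: nn_integral_multc)
    also have "\<dots> \<le> ennreal (min (\<gamma> * f y) K) + ennreal (g * c)"
    proof (rule add_mono)
      have "(\<integral>\<^sup>+\<omega>. ennreal (min (G \<omega> * (a * f y)) K) \<partial>M) \<le> (\<integral>\<^sup>+\<omega>. ennreal (G \<omega>) * ennreal (a * f y) \<partial>M)"
        using G(2) ac f by (intro nn_integral_mono) (simp add: ennreal_mult[symmetric] ennreal_leI)
      also have "\<dots> = (\<integral>\<^sup>+\<omega>. ennreal (G \<omega>) \<partial>M) * ennreal (a * f y)" using G(1) by (intro nn_integral_multc) auto
      also have "\<dots> \<le> ennreal g * ennreal (a * f y)" using G(3) by (rule mult_right_mono) simp
      also have "\<dots> = ennreal (g * a * f y)" using G(4) ac f by (simp add: ennreal_mult[symmetric] mult.assoc)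
      also have "\<dots> \<le> ennreal (\<gamma> * f y)" using \<gamma> f by (intro ennreal_leI mult_right_mono) auto
      finally have 1: "(\<integral>\<^sup>+\<omega>. ennreal (min (G \<omega> * (a * f y)) K) \<partial>M) \<le> ennreal (\<gamma> * f y)" .
      have "(\<integral>\<^sup>+\<omega>. ennreal (min (G \<omega> * (a * f y)) K) \<partial>M) \<le> (\<integral>\<^sup>+\<omega>. ennreal K \<partial>M)"
        by (intro nn_integral_mono ennreal_leI) auto
      \<comment> \<open>The mean of a minimum is at most the minimum of the means: the bound by
        \<open>K\<close> joins the one without truncation.\<close>
      then have "(\<integral>\<^sup>+\<omega>. ennreal (min (G \<omega> * (a * f y)) K) \<partial>M) \<le> ennreal K" by (simp add: M.emeasure_space_1)
      with 1 show "(\<integral>\<^sup>+\<omega>. ennreal (min (G \<omega> * (a * f y)) K) \<partial>M) \<le> ennreal (min (\<gamma> * f y) K)"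
        by (simp add: min_def)
      show "(\<integral>\<^sup>+\<omega>. ennreal (G \<omega>) \<partial>M) * ennreal c \<le> ennreal (g * c)"
        using mult_right_mono[OF G(3), of "ennreal c"] G(4) ac by (simp add: ennreal_mult)
    qed
    finally show "(\<integral>\<^sup>+\<omega>. ennreal (min (f (\<Phi> (y, \<omega>))) K) \<partial>M) \<le> ennreal (min (\<gamma> * f y) K) + ennreal (g * c)" .
  qed
  also have "\<dots> = (\<integral>\<^sup>+y. ennreal (min (\<gamma> * f y) K) \<partial>\<pi>) + ennreal (g * c)"
    using f\<pi> by (subst nn_integral_add) (auto simp: \<pi>.emeasure_space_1)
  finally show "(\<integral>\<^sup>+y. ennreal (min (f y) K) \<partial>\<pi>) \<le> (\<integral>\<^sup>+y. ennreal (min (\<gamma> * f y) K) \<partial>\<pi>) + ennreal (g * c)" .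
qed (use f G ac \<gamma> in auto)

text \<open>Jensen's inequality for the concave power \<open>s\<close> of the random variable \<open>exp (q x)\<close>.\<close>

lemma nn_integral_exp_power_le:
  fixes x :: "'a \<Rightarrow> real"
  assumes M: "prob_space M" and x: "x \<in> borel_measurable M"
    and le: "(\<integral>\<^sup>+\<omega>. ennreal (exp (q * x \<omega>)) \<partial>M) \<le> ennreal (exp l)" and s: "0 \<le> s" "s \<le> 1"
  shows "(\<integral>\<^sup>+\<omega>. ennreal (exp (s * q * x \<omega>)) \<partial>M) \<le> ennreal (exp (s * l))"
proof -
  interpret prob_space M by (rule M)
  \<comment> \<open>Convexity between 0 and \<open>q * x - l\<close>. Centring at \<open>l\<close>
    makes the two terms add up to exactly \<open>exp (s * l)\<close>.\<close>
  have "exp (s * q * x \<omega>) \<le> s * exp (s * l - l) * exp (q * x \<omega>) + (1 - s) * exp (s * l)" for \<omega>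
  proof -
    have "exp ((1 - s) * 0 + s * (q * x \<omega> - l)) \<le> (1 - s) * exp 0 + s * exp (q * x \<omega> - l)"
      using convex_onD[OF exp_convex, of s 0 "q * x \<omega> - l"] s by simp
    then have "exp (s * l) * exp (s * (q * x \<omega> - l)) \<le> exp (s * l) * ((1 - s) + s * exp (q * x \<omega> - l))"
      by (intro mult_left_mono) auto
    moreover have "exp (s * l) * exp (s * (q * x \<omega> - l)) = exp (s * q * x \<omega>)"
      by (simp add: exp_add[symmetric] algebra_simps)
    moreover have "exp (s * l) * ((1 - s) + s * exp (q * x \<omega> - l))
        = s * exp (s * l - l) * exp (q * x \<omega>) + (1 - s) * exp (s * l)"
      by (simp add: exp_diff field_simps)
    ultimately show ?thesis by simp
  qed
  then have "(\<integral>\<^sup>+\<omega>. ennreal (exp (s * q * x \<omega>)) \<partial>M)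
    \<le> (\<integral>\<^sup>+\<omega>. ennreal (s * exp (s * l - l)) * ennreal (exp (q * x \<omega>)) + ennreal ((1 - s) * exp (s * l)) \<partial>M)"
    using s by (intro nn_integral_mono)
      (simp add: ennreal_mult[symmetric] ennreal_plus[symmetric] ennreal_leI del: ennreal_plus)
  also have "\<dots> = ennreal (s * exp (s * l - l)) * (\<integral>\<^sup>+\<omega>. ennreal (exp (q * x \<omega>)) \<partial>M) + ennreal ((1 - s) * exp (s * l))"
    using x by (subst nn_integral_add) (auto simp: nn_integral_cmult emeasure_space_1)
  also have "\<dots> \<le> ennreal (s * exp (s * l - l)) * ennreal (exp l) + ennreal ((1 - s) * exp (s * l))"
    using le by (intro add_mono mult_left_mono) auto
  also have "\<dots> = ennreal (s * exp (s * l - l) * exp l + (1 - s) * exp (s * l))"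
    using s by (simp add: ennreal_mult[symmetric] ennreal_plus[symmetric] del: ennreal_plus)
  also have "s * exp (s * l - l) * exp l + (1 - s) * exp (s * l) = exp (s * l)"
    by (simp add: exp_diff algebra_simps)
  finally show ?thesis .
qed

section \<open>Weights and the inverse of the reflection matrix\<close>

lemma mat_vec_sum:
  assumes "A \<in> carrier_mat d e" "i < d"
  shows "(A *\<^sub>v vec e v) $ i = (\<Sum>j<e. A $$ (i, j) * v j)"
  using assms by (simp add: mult_mat_vec_def scalar_prod_def lessThan_atLeast0)

lemma abs_le_max_norm: "i < dim_vec v \<Longrightarrow> \<bar>v $ i\<bar> \<le> max_norm v"
  unfolding max_norm_def by (intro Max_ge) auto

text \<open>
  The weights are \<open>w = \<Sum>n. \<rho>^-n (Q^T)^n 1\<close>, which turn the power bound into a one-step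
  contraction because \<open>Q^T w = \<rho> (w - 1)\<close>.
\<close>

lemma contraction_weights_from_power_bound:
  fixes \<beta> \<kappa> :: real
  assumes \<beta>: "0 < \<beta>" "\<beta> < 1" and Q: "substochastic d Q"
    and pow: "\<And>n. max_norm (transpose_mat (Q ^\<^sub>m n) *\<^sub>v vec d (\<lambda>_. 1)) \<le> \<kappa> * (1 - \<beta>) ^ n"
  defines "\<rho> \<equiv> 1 - \<beta> / 2"
  obtains w where "skorokhod_problem d Q w \<rho>" "\<And>i. i < d \<Longrightarrow> w i \<le> \<kappa> / (1 - (1 - \<beta>) / \<rho>)"
proof -
  have Qc: "Q \<in> carrier_mat d d" and Q0: "\<And>i j. i < d \<Longrightarrow> j < d \<Longrightarrow> 0 \<le> Q $$ (i, j)"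
    using Q by (auto simp: substochastic_def)
  have rho: "0 < \<rho>" "\<rho> < 1" "1 - \<beta> < \<rho>" using \<beta> by (auto simp: \<rho>_def)
  \<comment> \<open>The vector \<open>(Q^T)^n 1\<close>, written as column sums of the
    power.\<close>
  define u where "u n i = (\<Sum>j<d. (Q ^\<^sub>m n) $$ (j, i))" for n i
  have u0: "u 0 i = 1" if "i < d" for i
  proof -
    have "u 0 i = (\<Sum>j<d. if j = i then 1 else 0)" unfolding u_def using Qc that by (intro sum.cong) auto
    then show ?thesis using that by simp
  qed
  have uS: "u (Suc n) i = (\<Sum>j<d. Q $$ (j, i) * u n j)" if i: "i < d" for n i
  proof -
    have "u (Suc n) i = (\<Sum>k<d. \<Sum>j<d. (Q ^\<^sub>m n) $$ (k, j) * Q $$ (j, i))"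
      unfolding u_def using Qc i
      by (intro sum.cong) (auto simp: scalar_prod_def lessThan_atLeast0 carrier_matD[OF pow_carrier_mat[OF Qc]])
    also have "\<dots> = (\<Sum>j<d. \<Sum>k<d. (Q ^\<^sub>m n) $$ (k, j) * Q $$ (j, i))" by (rule sum.swap)
    also have "\<dots> = (\<Sum>j<d. Q $$ (j, i) * u n j)"
      by (simp add: u_def sum_distrib_left mult.commute)
    finally show ?thesis .
  qed
  have u_nonneg: "0 \<le> u n i" if "i < d" for n i
    using that
  proof (induction n arbitrary: i)
    case (Suc n)
    then show ?case unfolding uS[OF Suc.prems] using Q0 by (intro sum_nonneg mult_nonneg_nonneg) auto
  qed (simp add: u0)
  have u_le: "u n i \<le> \<kappa> * (1 - \<beta>) ^ n" if i: "i < d" for n i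
  proof -
    have c: "transpose_mat (Q ^\<^sub>m n) \<in> carrier_mat d d" using pow_carrier_mat[OF Qc] by simp
    have "(transpose_mat (Q ^\<^sub>m n) *\<^sub>v vec d (\<lambda>_. 1)) $ i = u n i"
      unfolding mat_vec_sum[OF c i] u_def using i carrier_matD[OF pow_carrier_mat[OF Qc, of n]] by (intro sum.cong) auto
    moreover have "dim_vec (transpose_mat (Q ^\<^sub>m n) *\<^sub>v vec d (\<lambda>_. 1)) = d"
      unfolding dim_mult_mat_vec by (rule carrier_matD(1)[OF c])
    ultimately have "\<bar>u n i\<bar> \<le> max_norm (transpose_mat (Q ^\<^sub>m n) *\<^sub>v vec d (\<lambda>_. 1))"
      using abs_le_max_norm[of i "transpose_mat (Q ^\<^sub>m n) *\<^sub>v vec d (\<lambda>_. 1)"] i by metis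
    then show ?thesis using pow[of n] by simp
  qed
  \<comment> \<open>The series for \<open>w\<close> converges geometrically because
    \<open>\<rho> = 1 - \<beta> / 2\<close> lies strictly between \<open>1 - \<beta>\<close> and
    1.\<close>
  define r where "r = (1 - \<beta>) / \<rho>"
  have r: "0 < r" "r < 1" using rho \<beta> by (auto simp: r_def)
  define v where "v i n = u n i / \<rho> ^ n" for i n
  have v_le: "v i n \<le> \<kappa> * r ^ n" "0 \<le> v i n" if "i < d" for i n
    using u_le[OF that, of n] u_nonneg[OF that, of n] rho by (simp_all add: v_def r_def power_divide divide_right_mono)
  have geo: "summable (\<lambda>n. \<kappa> * r ^ n)" using r by (intro summable_mult summable_geometric) auto
  have sv: "summable (v i)" if "i < d" for i
    by (rule summable_comparison_test[OF _ geo]) (use v_le[OF that] in auto)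
  define w where "w i = suminf (v i)" for i
  have w_eq: "w i = 1 + (\<Sum>n. v i (Suc n))" if "i < d" for i
    using suminf_split_head[OF sv[OF that]] u0[OF that] by (simp add: w_def v_def)
  have tail: "\<rho> * v i (Suc n) = (\<Sum>j<d. Q $$ (j, i) * v j n)" if "i < d" for i n
  proof -
    have "\<rho> * v i (Suc n) = u (Suc n) i / \<rho> ^ n" using rho by (simp add: v_def)
    then show ?thesis unfolding uS[OF that] by (simp add: sum_divide_distrib v_def)
  qed
  have Qw: "(\<Sum>j<d. Q $$ (j, i) * w j) = \<rho> * (w i - 1)" if i: "i < d" for i
  proof -
    have "(\<Sum>j<d. Q $$ (j, i) * w j) = (\<Sum>j<d. \<Sum>n. Q $$ (j, i) * v j n)"
      unfolding w_def using sv by (intro sum.cong) (auto intro: suminf_mult[symmetric])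
    also have "\<dots> = (\<Sum>n. \<Sum>j<d. Q $$ (j, i) * v j n)"
      using sv by (intro suminf_sum[symmetric] summable_mult) auto
    also have "\<dots> = (\<Sum>n. \<rho> * v i (Suc n))" by (simp add: tail[OF i])
    also have "\<dots> = \<rho> * (\<Sum>n. v i (Suc n))"
      using sv[OF i] by (intro suminf_mult) (simp add: summable_Suc_iff)
    finally show ?thesis using w_eq[OF i] by simp
  qed
  have "skorokhod_problem d Q w \<rho>"
  proof
    show "0 \<le> Q $$ (j, i)" if "i < d" "j < d" for i j using Q0 that by simp
    show "1 \<le> w i" if "i < d" for i
      unfolding w_eq[OF that] using sv[OF that] v_le(2)[OF that]
      by (simp add: suminf_nonneg summable_Suc_iff)
    show "(\<Sum>j<d. Q $$ (j, i) * w j) \<le> \<rho> * w i" if "i < d" for i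
      unfolding Qw[OF that] using rho by (intro mult_left_mono) auto
  qed (use rho Qc in auto)
  moreover have "w i \<le> \<kappa> / (1 - (1 - \<beta>) / \<rho>)" if "i < d" for i
  proof -
    have "w i \<le> (\<Sum>n. \<kappa> * r ^ n)"
      unfolding w_def using v_le(1)[OF that] sv[OF that] geo by (intro suminf_le) auto
    also have "\<dots> = \<kappa> / (1 - r)"
      using r suminf_geometric[of r] suminf_mult[OF summable_geometric[of r], of \<kappa>] by simp
    finally show ?thesis by (simp add: r_def)
  qed
  ultimately show ?thesis using that by blast
qed

lemma reflection_inverse_of_mat_inverse:
  assumes Q: "skorokhod_problem d Q w \<rho>" and inv: "is_mat_inverse d (reflection_matrix d Q) Rinv"
    and nonneg: "\<And>i j. i < d \<Longrightarrow> j < d \<Longrightarrow> 0 \<le> Rinv $$ (i, j)"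
  shows "reflection_inverse d (\<lambda>i j. Q $$ (j, i)) w \<rho> (\<lambda>i j. Rinv $$ (i, j))"
proof -
  interpret skorokhod_problem d Q w \<rho> by (rule Q)
  let ?R = "reflection_matrix d Q"
  have R: "?R \<in> carrier_mat d d"
    using local.Q by (auto simp: reflection_matrix_def intro!: minus_carrier_mat)
  have Ri: "Rinv \<in> carrier_mat d d" and one: "?R * Rinv = 1\<^sub>m d" "Rinv * ?R = 1\<^sub>m d"
    using inv R by (auto simp: is_mat_inverse_def inverts_mat_def)
  have vecR: "?R *\<^sub>v vec d v = vec d (\<lambda>j. v j - (\<Sum>k<d. Q $$ (k, j) * v k))" for v
  proof (rule eq_vecI)
    fix i assume "i < dim_vec (vec d (\<lambda>j. v j - (\<Sum>k<d. Q $$ (k, j) * v k)))"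
    then have "i < d" by simp
    then show "(?R *\<^sub>v vec d v) $ i = vec d (\<lambda>j. v j - (\<Sum>k<d. Q $$ (k, j) * v k)) $ i"
      by (simp only: reflection_matrix_mult[OF local.Q] index_vec)
  qed (use carrier_matD(1)[OF R] in \<open>simp only: dim_mult_mat_vec dim_vec\<close>)
  have vecRi: "Rinv *\<^sub>v vec d v = vec d (\<lambda>i. \<Sum>j<d. Rinv $$ (i, j) * v j)" for v
  proof (rule eq_vecI)
    fix i assume "i < dim_vec (vec d (\<lambda>i. \<Sum>j<d. Rinv $$ (i, j) * v j))"
    then have "i < d" by simp
    then show "(Rinv *\<^sub>v vec d v) $ i = vec d (\<lambda>i. \<Sum>j<d. Rinv $$ (i, j) * v j) $ i"
      by (simp only: mat_vec_sum[OF Ri] index_vec)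
  qed (use carrier_matD(1)[OF Ri] in \<open>simp only: dim_mult_mat_vec dim_vec\<close>)
  show ?thesis
  proof (unfold_locales)
    show "0 \<le> Rinv $$ (i, j)" if "i < d" "j < d" for i j using nonneg that .
    fix i :: nat and v :: "nat \<Rightarrow> real" assume i: "i < d"
    have "Rinv *\<^sub>v (?R *\<^sub>v vec d v) = vec d v"
      using assoc_mult_mat_vec[OF Ri R, of "vec d v"] one by simp
    then have "(Rinv *\<^sub>v (?R *\<^sub>v vec d v)) $ i = v i" using i by simp
    then show "(\<Sum>j<d. Rinv $$ (i, j) * (v j - (\<Sum>k<d. Q $$ (k, j) * v k))) = v i"
      unfolding vecR mat_vec_sum[OF Ri i] .
    have "?R *\<^sub>v (Rinv *\<^sub>v vec d v) = vec d v"
      using assoc_mult_mat_vec[OF R Ri, of "vec d v"] one by simp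
    then have "(?R *\<^sub>v (Rinv *\<^sub>v vec d v)) $ i = v i" using i by simp
    then show "(\<Sum>j<d. Rinv $$ (i, j) * v j) - (\<Sum>k<d. Q $$ (k, i) * (\<Sum>j<d. Rinv $$ (k, j) * v j)) = v i"
      unfolding vecRi reflection_matrix_mult[OF local.Q i] .
  qed
qed

text \<open>Cauchy-Schwarz with the weights \<open>Ri i k\<close>, whose sum is bounded by
  \<open>row_sum_le\<close>. Only diagonal entries of \<open>C C^T\<close> enter, and the bound does
  not grow with the dimension.\<close>

lemma (in reflection_inverse) workload_variance_le:
  assumes i: "i < d" and c: "w i \<le> c" and b: "0 \<le> b"
    and C: "\<And>k. k < d \<Longrightarrow> (\<Sum>j<d. (C k j)\<^sup>2) \<le> b"
  shows "(\<Sum>j<d. (\<Sum>k<d. Ri i k * C k j)\<^sup>2) \<le> (c / (1 - \<rho>))\<^sup>2 * b"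
proof -
  let ?s = "\<Sum>k<d. Ri i k"
  have s: "0 \<le> ?s" "?s \<le> c / (1 - \<rho>)" using Ri_nonneg i row_sum_le[OF i c] by (auto intro: sum_nonneg)
  have "(\<Sum>k<d. Ri i k * C k j)\<^sup>2 \<le> ?s * (\<Sum>k<d. Ri i k * (C k j)\<^sup>2)" for j
  proof -
    have "(\<Sum>k<d. Ri i k * C k j)\<^sup>2 = (\<Sum>k<d. sqrt (Ri i k) * (sqrt (Ri i k) * C k j))\<^sup>2"
      using Ri_nonneg i by (intro arg_cong[where f = "\<lambda>x. x\<^sup>2"] sum.cong) (auto simp: mult.assoc[symmetric])
    also have "\<dots> \<le> (\<Sum>k<d. (sqrt (Ri i k))\<^sup>2) * (\<Sum>k<d. (sqrt (Ri i k) * C k j)\<^sup>2)"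
      by (rule Cauchy_Schwarz_ineq_sum)
    also have "\<dots> = ?s * (\<Sum>k<d. Ri i k * (C k j)\<^sup>2)"
      using Ri_nonneg i by (intro arg_cong2[where f = "(*)"] sum.cong) (auto simp: power_mult_distrib)
    finally show ?thesis .
  qed
  then have "(\<Sum>j<d. (\<Sum>k<d. Ri i k * C k j)\<^sup>2) \<le> (\<Sum>j<d. ?s * (\<Sum>k<d. Ri i k * (C k j)\<^sup>2))"
    by (intro sum_mono)
  also have "\<dots> = ?s * (\<Sum>j<d. \<Sum>k<d. Ri i k * (C k j)\<^sup>2)" by (simp only: sum_distrib_left)
  also have "(\<Sum>j<d. \<Sum>k<d. Ri i k * (C k j)\<^sup>2) = (\<Sum>k<d. \<Sum>j<d. Ri i k * (C k j)\<^sup>2)" by (rule sum.swap)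
  also have "\<dots> = (\<Sum>k<d. Ri i k * (\<Sum>j<d. (C k j)\<^sup>2))" by (simp only: sum_distrib_left)
  also have "\<dots> \<le> (\<Sum>k<d. Ri i k * b)" using C Ri_nonneg i by (intro sum_mono mult_left_mono) auto
  also have "\<dots> = ?s * b" by (simp only: sum_distrib_right)
  finally have "(\<Sum>j<d. (\<Sum>k<d. Ri i k * C k j)\<^sup>2) \<le> ?s * (?s * b)" using s by (simp add: mult_left_mono)
  also have "\<dots> = ?s\<^sup>2 * b" by (simp add: power2_eq_square)
  also have "\<dots> \<le> (c / (1 - \<rho>))\<^sup>2 * b" using s b by (intro mult_right_mono power_mono) auto
  finally show ?thesis .
qed

section \<open>Parameters of the drift argument\<close>

text \<open>
  The parameters of the drift argument in dimension \<open>d\<close>, where \<open>l = ln d\<close>: blocks of length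
  \<open>\<tau> = \<kappa>\<^sup>2 l\<close> make the workload decrease by \<open>\<delta> \<tau> \<sim> \<kappa>\<^sup>2 l\<close>, which dominates the oscillation of the
  noise, of order \<open>\<kappa> l\<close>, as soon as \<open>\<kappa>\<close> is large.
\<close>

locale drift_parameters =
  fixes \<rho> \<delta> V l :: real
  assumes rho: "1 / 2 \<le> \<rho>" "\<rho> < 1" and delta: "0 < \<delta>" and V: "0 \<le> V" and l: "ln 2 \<le> l"
begin

text \<open>\<open>exp (c2 * l)\<close> bounds the moment of the oscillation at
  \<open>1 / \<kappa>\<close>, and \<open>exp (- c3 * l)\<close> is at most
  \<open>(1 - \<rho>) / 2\<close>. \<open>\<kappa>\<close> adds the lower bounds that
  \<open>drift_large\<close> and \<open>tail_small\<close> ask for. \<open>rate\<close> is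
  \<open>1 / \<kappa>\<close> for oscillations divided by \<open>1 - \<rho>\<close>.
  \<open>\<epsilon>\<close> is tuned so that the power \<open>\<theta> / rate\<close> of
  \<open>exp (c2 * l)\<close> is \<open>1 / \<rho>\<close>. The potential uses
  \<open>\<theta> / 2\<close>, the stationary law \<open>\<theta>\<close>: the other half absorbs
  the square of the workload.\<close>

definition "c2 = 4 + 2 * V"
definition "c3 = ln (2 / (1 - \<rho>)) / ln 2"
definition "\<kappa> = 8 * c2 / ((1 - \<rho>)\<^sup>2 * \<delta>) + 4 * (c2 + c3) / ((1 - \<rho>) * \<delta>)"
definition "rate = (1 - \<rho>) / \<kappa>"
definition "\<epsilon> = rate * ln (1 / \<rho>) / c2"
definition "\<tau> = \<kappa>\<^sup>2 * l"
definition "\<theta> = \<epsilon> / l"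
definition "\<zeta> = rate - \<theta> / 2"

lemma l_pos: "0 < l"
  using l ln_gt_zero[of "2 :: real"] by linarith

lemma rho_pos: "0 < \<rho>"
  using rho by linarith

lemma ln_rho: "0 < ln (1 / \<rho>)" "ln (1 / \<rho>) \<le> ln 2"
proof -
  show "0 < ln (1 / \<rho>)" using rho by (intro ln_gt_zero) (simp add: field_simps)
  show "ln (1 / \<rho>) \<le> ln 2" using rho rho_pos by (subst ln_le_cancel_iff) (simp_all add: field_simps)
qed

lemma c2_pos: "4 \<le> c2" using V by (simp add: c2_def)

lemma c3_pos: "0 < c3"
  unfolding c3_def using rho by (intro divide_pos_pos ln_gt_zero) (simp_all add: field_simps)

lemma kappa: "8 * c2 / ((1 - \<rho>)\<^sup>2 * \<delta>) \<le> \<kappa>" "4 * (c2 + c3) / ((1 - \<rho>) * \<delta>) \<le> \<kappa>" "0 < \<kappa>"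
proof -
  have a: "0 < 8 * c2 / ((1 - \<rho>)\<^sup>2 * \<delta>)" using c2_pos rho delta by (intro divide_pos_pos) auto
  have b: "0 < 4 * (c2 + c3) / ((1 - \<rho>) * \<delta>)" using c2_pos c3_pos rho delta by (intro divide_pos_pos) auto
  show "8 * c2 / ((1 - \<rho>)\<^sup>2 * \<delta>) \<le> \<kappa>" "4 * (c2 + c3) / ((1 - \<rho>) * \<delta>) \<le> \<kappa>" "0 < \<kappa>"
    using a b by (auto simp: \<kappa>_def)
qed

lemma rate_pos: "0 < rate" using kappa rho by (simp add: rate_def)

lemma eps_pos: "0 < \<epsilon>"
  unfolding \<epsilon>_def using rate_pos ln_rho c2_pos by (intro divide_pos_pos mult_pos_pos) auto

lemma tau_pos: "0 < \<tau>" using kappa l_pos by (simp add: \<tau>_def)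

lemma theta_pos: "0 < \<theta>" using eps_pos l_pos by (simp add: \<theta>_def)

lemma theta_le_rate: "\<theta> \<le> rate"
proof -
  have "1 * l \<le> c2 * l" using c2_pos l_pos by (intro mult_right_mono) auto
  then have "ln (1 / \<rho>) \<le> c2 * l" using ln_rho l by linarith
  then have "rate * ln (1 / \<rho>) \<le> rate * (c2 * l)" using rate_pos by (intro mult_left_mono) auto
  then show ?thesis using c2_pos l_pos by (simp add: \<theta>_def \<epsilon>_def field_simps)
qed

lemma zeta: "rate / 2 \<le> \<zeta>" "0 \<le> \<zeta>" "\<theta> / 2 + \<zeta> = rate"
  using theta_le_rate rate_pos by (auto simp: \<zeta>_def)

lemma theta_ratio: "\<theta> / rate * (c2 * l) = ln (1 / \<rho>)"
  using rate_pos c2_pos l_pos by (simp add: \<theta>_def \<epsilon>_def)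

text \<open>The first summand of \<open>\<kappa>\<close> is made for this. The factor 4 leaves the 2
  of \<open>potential_step\<close> after \<open>\<theta>\<close> is halved.\<close>

lemma drift_large: "4 * ln (1 / \<rho>) \<le> \<theta> * (1 - \<rho>) * (\<delta> * \<tau>) / 2"
proof -
  have "8 * c2 \<le> \<kappa> * ((1 - \<rho>)\<^sup>2 * \<delta>)" using kappa(1) rho delta by (simp add: pos_divide_le_eq)
  then have "4 * ln (1 / \<rho>) * (2 * c2) \<le> ln (1 / \<rho>) * (\<kappa> * ((1 - \<rho>)\<^sup>2 * \<delta>))"
    using mult_left_mono[of "8 * c2" "\<kappa> * ((1 - \<rho>)\<^sup>2 * \<delta>)" "ln (1 / \<rho>)"] ln_rho by simp
  then have "4 * ln (1 / \<rho>) \<le> ln (1 / \<rho>) * (\<kappa> * ((1 - \<rho>)\<^sup>2 * \<delta>)) / (2 * c2)"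
    using c2_pos by (simp add: pos_le_divide_eq)
  also have "\<dots> = \<theta> * (1 - \<rho>) * (\<delta> * \<tau>) / 2"
    using kappa(3) l_pos c2_pos by (simp add: \<theta>_def \<epsilon>_def \<tau>_def rate_def power2_eq_square field_simps)
  finally show ?thesis .
qed

text \<open>\<open>l\<close> cancels, so the constant of the stationary moment bound does not depend
  on the dimension.\<close>

lemma drift_constant: "\<theta> * (\<delta> * \<tau>) / 2 = \<epsilon> * \<delta> * \<kappa>\<^sup>2 / 2"
  using l_pos by (simp add: \<theta>_def \<tau>_def)

text \<open>With the second summand of \<open>\<kappa>\<close>, and \<open>\<zeta>\<close> at least
  half of \<open>rate\<close>, the drift over half a block outweighs the moment of the oscillation
  by \<open>exp (c3 * l)\<close>.\<close>

lemma tail_small: "exp (c2 * l - \<zeta> * (\<delta> * \<tau>) / 2) \<le> (1 - \<rho>) / 2"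
proof -
  have "4 * (c2 + c3) \<le> \<kappa> * ((1 - \<rho>) * \<delta>)" using kappa(2) rho delta by (simp add: pos_divide_le_eq)
  then have "(c2 + c3) * l \<le> \<kappa> * ((1 - \<rho>) * \<delta>) / 4 * l" using l_pos by (intro mult_right_mono) auto
  also have "\<dots> = rate / 2 * (\<delta> * \<tau>) / 2"
    using kappa(3) by (simp add: rate_def \<tau>_def power2_eq_square field_simps)
  also have "\<dots> \<le> \<zeta> * (\<delta> * \<tau>) / 2"
    using zeta(1) delta tau_pos by (intro divide_right_mono mult_right_mono) auto
  finally have 1: "c2 * l - \<zeta> * (\<delta> * \<tau>) / 2 \<le> - (c3 * l)" by (simp add: algebra_simps)
  have "c3 * ln 2 \<le> c3 * l" using c3_pos l by (intro mult_left_mono) auto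
  then have "ln (2 / (1 - \<rho>)) \<le> c3 * l" by (simp add: c3_def)
  then have "c2 * l - \<zeta> * (\<delta> * \<tau>) / 2 \<le> ln ((1 - \<rho>) / 2)" using 1 rho by (simp add: ln_div)
  then have "exp (c2 * l - \<zeta> * (\<delta> * \<tau>) / 2) \<le> exp (ln ((1 - \<rho>) / 2))" by simp
  then show ?thesis using rho by simp
qed

lemma moment_constant:
  fixes d :: nat
  assumes "2 \<le> d" "l = ln (real d)"
  shows "8 * real d * exp (2 * (1 / \<kappa>)\<^sup>2 * V * \<tau>) \<le> exp (c2 * l)"
proof -
  have d: "exp l = real d" using assms by simp
  \<comment> \<open>The 4 in \<open>c2\<close>: for \<open>d \<ge> 2\<close> the prefactor
    \<open>8 * d\<close> is at most \<open>d^4\<close>.\<close>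
  have "2 ^ 3 \<le> real d ^ 3" using assms by (intro power_mono) auto
  then have "8 * real d \<le> real d ^ 3 * real d" by (intro mult_right_mono) auto
  also have "\<dots> = exp (4 * l)" using exp_of_nat_mult[of 4 l] d by (simp add: power_numeral_reduce)
  finally have "8 * real d \<le> exp (4 * l)" .
  moreover have "2 * (1 / \<kappa>)\<^sup>2 * V * \<tau> = 2 * V * l"
    using kappa(3) by (simp add: \<tau>_def power2_eq_square)
  ultimately have "8 * real d * exp (2 * (1 / \<kappa>)\<^sup>2 * V * \<tau>) \<le> exp (4 * l) * exp (2 * V * l)"
    by (simp only: mult_right_mono exp_ge_zero)
  then show ?thesis by (simp add: exp_add[symmetric] c2_def algebra_simps)
qed

end

section \<open>Pathwise bounds for reflected Brownian motion\<close>

text \<open>\<open>c\<close> bounds all weights, so a drift of at most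
  \<open>- (\<delta> * c)\<close> is at most \<open>- \<delta>\<close> in units of
  \<open>w\<close>.\<close>

locale reflected_brownian_motion =
  skorokhod_problem d Q w \<rho> +
  reflection_inverse d "\<lambda>i j. Q $$ (j, i)" w \<rho> "\<lambda>i j. Rinv $$ (i, j)" +
  brownian_noise M d B "\<lambda>i j. \<Sum>k<d. Rinv $$ (i, k) * C $$ (k, j)" V
  for d :: nat and Q :: "real mat" and w :: "nat \<Rightarrow> real" and \<rho> :: real and Rinv :: "real mat"
    and M :: "'w measure" and B :: "'w \<Rightarrow> real \<Rightarrow> nat \<Rightarrow> real" and C :: "real mat" and V :: real +
  fixes \<mu> :: "real vec" and c \<delta> :: real
  assumes \<mu>: "\<mu> \<in> carrier_vec d" and C: "C \<in> carrier_mat d d"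
    and w_le: "\<And>i. i < d \<Longrightarrow> w i \<le> c" and delta: "0 < \<delta>"
    and drift: "\<And>i. i < d \<Longrightarrow> (\<Sum>k<d. Rinv $$ (i, k) * \<mu> $ k) \<le> - (\<delta> * c)"
begin

abbreviation X :: "'w \<Rightarrow> real \<Rightarrow> nat \<Rightarrow> real" where
  "X \<omega> \<equiv> driving_path d \<mu> C (B \<omega>)"

abbreviation reflected :: "real \<Rightarrow> (nat \<Rightarrow> real) \<Rightarrow> 'w \<Rightarrow> nat \<Rightarrow> real" where
  "reflected t y \<omega> \<equiv> reflected_path d (reflection_matrix d Q) t y (X \<omega>)"

definition mean :: "nat \<Rightarrow> real" where
  "mean i = (\<Sum>k<d. Rinv $$ (i, k) * \<mu> $ k)"

lemma X_eq: "i < d \<Longrightarrow> X \<omega> t i = t * \<mu> $ i + (\<Sum>j<d. C $$ (i, j) * B \<omega> t j)"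
  using \<mu> C mat_vec_sum[OF C, of i "B \<omega> t"] by (simp add: driving_path_def)

lemma workload_X: "i < d \<Longrightarrow> workload (X \<omega> t) i = noise \<omega> t i + t * mean i"
proof -
  assume i: "i < d"
  have "(\<Sum>k<d. \<Sum>j<d. Rinv $$ (i, k) * (C $$ (k, j) * B \<omega> t j))
      = (\<Sum>j<d. \<Sum>k<d. Rinv $$ (i, k) * (C $$ (k, j) * B \<omega> t j))"
    by (rule sum.swap)
  moreover have "workload (X \<omega> t) i = (\<Sum>k<d. \<Sum>j<d. Rinv $$ (i, k) * (C $$ (k, j) * B \<omega> t j)) + t * mean i"
    by (simp add: workload_def X_eq mean_def distrib_left sum.distrib sum_distrib_left mult.left_commute)
  moreover have "noise \<omega> t i = (\<Sum>j<d. \<Sum>k<d. Rinv $$ (i, k) * (C $$ (k, j) * B \<omega> t j))"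
    by (simp add: noise_def sum_distrib_right mult.assoc)
  ultimately show ?thesis by simp
qed

lemma X_measurable: "0 \<le> t \<Longrightarrow> i < d \<Longrightarrow> (\<lambda>\<omega>. X \<omega> t i) \<in> borel_measurable M"
  by (simp only: X_eq) (intro borel_measurable_add borel_measurable_sum borel_measurable_times borel_measurable_const B_measurable, auto)

lemma X_continuous: "\<omega> \<in> space M \<Longrightarrow> i < d \<Longrightarrow> continuous_on {0..t} (\<lambda>s. X \<omega> s i)"
  by (simp only: X_eq) (intro continuous_intros continuous_on_subset[OF B_continuous], auto)

lemma X_start: "\<omega> \<in> space M \<Longrightarrow> i < d \<Longrightarrow> X \<omega> 0 i = 0"
  using bm by (simp add: X_eq standard_brownian_motion_def)

text \<open>Supplies the hypothesis \<open>fluct\<close> of the block estimates: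
  \<open>w i \<ge> 1\<close> serves the noise and \<open>w i \<le> c\<close> the drift.\<close>

lemma workload_fluctuation:
  assumes \<omega>: "\<omega> \<in> space M" and i: "i < d" and T: "0 < T" "0 \<le> r"
    and st: "r \<le> s" "s \<le> t" "t \<le> r + T"
  shows "workload (X \<omega> t) i - workload (X \<omega> s) i \<le> (oscillation d (noise \<omega>) r T - \<delta> * (t - s)) * w i"
proof -
  let ?o = "oscillation d (noise \<omega>) r T"
  have o: "0 \<le> ?o" "noise \<omega> t i - noise \<omega> s i \<le> ?o"
    using oscillation_nonneg[OF d T(1) noise_continuous_on[OF \<omega> T(2)]]
      increment_le_oscillation[OF d T(1) noise_continuous_on[OF \<omega> T(2)] i st] by auto
  have "(t - s) * mean i \<le> (t - s) * (- (\<delta> * c))"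
    using st drift[OF i] by (intro mult_left_mono) (auto simp: mean_def)
  also have "\<dots> \<le> - (\<delta> * (t - s)) * w i"
    using mult_left_mono[OF w_le[OF i], of "\<delta> * (t - s)"] delta st by (simp add: algebra_simps)
  finally have "(t - s) * mean i \<le> - (\<delta> * (t - s)) * w i" .
  moreover have "?o * 1 \<le> ?o * w i" using o w_ge_1[OF i] by (intro mult_left_mono) auto
  moreover have "workload (X \<omega> t) i - workload (X \<omega> s) i = (noise \<omega> t i - noise \<omega> s i) + (t - s) * mean i"
    using i by (simp add: workload_X algebra_simps)
  ultimately show ?thesis using o(2) by (simp add: left_diff_distrib)
qed

definition height :: "(nat \<Rightarrow> real) \<Rightarrow> real" where
  "height y = Max ((\<lambda>i. workload y i / w i) ` {..<d})"

lemma workload_le_height: "i < d \<Longrightarrow> workload y i \<le> height y * w i"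
proof -
  assume i: "i < d"
  then have "workload y i / w i \<le> height y" unfolding height_def by (intro Max_ge) auto
  then show ?thesis using w_pos[OF i] by (simp add: pos_divide_le_eq)
qed

lemma height_attained: obtains i where "i < d" "height y = workload y i / w i"
proof -
  have "height y \<in> (\<lambda>i. workload y i / w i) ` {..<d}" unfolding height_def using d by (intro Max_in) auto
  then show ?thesis using that by auto
qed

lemma height_nonneg: "(\<And>i. i < d \<Longrightarrow> 0 \<le> y i) \<Longrightarrow> 0 \<le> height y"
  by (rule height_attained[of y]) (auto intro!: divide_nonneg_pos workload_nonneg w_pos)

lemma height_measurable: "height \<in> borel_measurable (state_space d)"
  unfolding height_def workload_def
  by (intro borel_measurable_Max borel_measurable_divide borel_measurable_sum borel_measurable_times
      borel_measurable_const measurable_component_singleton) auto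

lemma exp_height_drift:
  assumes \<omega>: "\<omega> \<in> space M" and y: "\<And>i. i < d \<Longrightarrow> 0 \<le> y i" and T: "0 < T" and \<theta>: "0 \<le> \<theta>"
  shows "exp (\<theta> * height (reflected T y \<omega>)) \<le> exp (\<theta> * (oscillation d (noise \<omega>) 0 T / (1 - \<rho>)))
    * (exp (- \<theta> * (1 - \<rho>) * (\<delta> * T) / 2) * exp (\<theta> * height y) + exp (\<theta> * (\<delta> * T) / 2))"
proof -
  obtain Y L where r: "reflects T (\<lambda>s i. y i + X \<omega> s i) Y L"
    and Y: "\<And>i. i < d \<Longrightarrow> reflected T y \<omega> i = Y T i"
    by (rule reflected_path_reflects[OF less_imp_le[OF T] X_continuous[OF \<omega>] X_start[OF \<omega>] y]) blast+
  obtain i where i: "i < d" "height (reflected T y \<omega>) = workload (reflected T y \<omega>) i / w i"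
    by (rule height_attained)
  have "workload (reflected T y \<omega>) i = workload (Y T) i" by (rule workload_cong) (rule Y)
  then have h: "height (reflected T y \<omega>) = workload (Y T) i / w i" using i by simp
  show ?thesis unfolding h
  proof (rule exp_workload_block[OF r refl X_start[OF \<omega>]])
    show "0 \<le> oscillation d (noise \<omega>) 0 T"
      by (rule oscillation_nonneg[OF d T noise_continuous_on[OF \<omega>]]) auto
    show "workload (X \<omega> t) j - workload (X \<omega> s) j \<le> (oscillation d (noise \<omega>) 0 T - \<delta> * (t - s)) * w j"
      if "j < d" "0 \<le> s" "s \<le> t" "t \<le> T" for j s t
      using workload_fluctuation[OF \<omega> that(1) T, of 0 s t] that by simp
  qed (use T \<theta> delta i y in \<open>auto intro: height_nonneg workload_le_height\<close>)
qed

lemma squared_gap_le: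
  assumes \<omega>: "\<omega> \<in> space M" and y: "\<And>i. i < d \<Longrightarrow> 0 \<le> y i" and T: "0 < T" "real k * T \<le> t"
    and par: "0 \<le> \<theta>" "0 \<le> \<zeta>" "2 * ln (1 / \<rho>) \<le> \<theta> * (1 - \<rho>) * (\<delta> * T) / 2"
  shows "(max_norm (vec d (\<lambda>i. reflected t y \<omega> i - reflected t (\<lambda>_. 0) \<omega> i)))\<^sup>2
    \<le> c\<^sup>2 * ((height y)\<^sup>2 * exp (\<theta> * height y) *
        (\<Prod>b<k. potential_factor \<rho> \<theta> \<zeta> (\<delta> * T) (oscillation d (noise \<omega>) (real b * T) T / (1 - \<rho>))))"
proof -
  have t: "0 \<le> t" using T by (meson less_imp_le mult_nonneg_nonneg of_nat_0_le_iff order_trans)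
  obtain Y L where r: "reflects t (\<lambda>s i. y i + X \<omega> s i) Y L"
    and Y: "\<And>i. i < d \<Longrightarrow> reflected t y \<omega> i = Y t i"
    by (rule reflected_path_reflects[OF t X_continuous[OF \<omega>] X_start[OF \<omega>] y]) blast+
  obtain Y' L' where r': "reflects t (\<lambda>s i. 0 + X \<omega> s i) Y' L'"
    and Y': "\<And>i. i < d \<Longrightarrow> reflected t (\<lambda>_. 0) \<omega> i = Y' t i"
    by (rule reflected_path_reflects[OF t X_continuous[OF \<omega>] X_start[OF \<omega>] order.refl]) blast+
  let ?v = "vec d (\<lambda>i. reflected t y \<omega> i - reflected t (\<lambda>_. 0) \<omega> i)"
  let ?P = "\<Prod>b<k. potential_factor \<rho> \<theta> \<zeta> (\<delta> * T) (oscillation d (noise \<omega>) (real b * T) T / (1 - \<rho>))"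
  have "max_norm ?v \<in> (\<lambda>i. \<bar>?v $ i\<bar>) ` {..<d}" unfolding max_norm_def dim_vec using d by (intro Max_in) auto
  then obtain i where i: "i < d" "max_norm ?v = \<bar>Y t i - Y' t i\<bar>" using Y Y' by auto
  have "\<bar>Y t i - Y' t i\<bar>\<^sup>2 \<le> (w i)\<^sup>2 * ((height y)\<^sup>2 * exp (\<theta> * height y) * ?P)"
  proof (rule gap_after_blocks[OF r r', where \<tau> = T and y = y
        and G = "\<lambda>b. oscillation d (noise \<omega>) (real b * T) T"])
    show "0 \<le> oscillation d (noise \<omega>) (real b * T) T" for b
      using T by (intro oscillation_nonneg[OF d T(1) noise_continuous_on[OF \<omega>]]) auto
    show "workload (\<lambda>i. 0 + X \<omega> q i) j - workload (\<lambda>i. 0 + X \<omega> s i) j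
        \<le> (oscillation d (noise \<omega>) (real b * T) T - \<delta> * (q - s)) * w j"
      if "j < d" "real b * T \<le> s" "s \<le> q" "q \<le> real (Suc b) * T" for b j s q
      using workload_fluctuation[OF \<omega> that(1) T(1), of "real b * T" s q] that T by (simp add: algebra_simps)
  qed (use T delta i y par X_start[OF \<omega>] in \<open>auto intro: height_nonneg workload_le_height\<close>)
  also have "\<dots> \<le> c\<^sup>2 * ((height y)\<^sup>2 * exp (\<theta> * height y) * ?P)"
  proof (rule mult_right_mono)
    show "(w i)\<^sup>2 \<le> c\<^sup>2" using w_le[OF i(1)] w_pos[OF i(1)] by (intro power_mono) auto
    have "0 \<le> ?P" by (intro prod_nonneg) (simp add: potential_factor_def)
    then show "0 \<le> (height y)\<^sup>2 * exp (\<theta> * height y) * ?P" by simp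
  qed
  finally show ?thesis using i(2) by simp
qed

end

section \<open>The second moment of the gap\<close>

context drift_parameters
begin

text \<open>Jensen's inequality with the power \<open>s * \<theta> / rate\<close>: a moment
  polynomial in \<open>d\<close> becomes a constant. This fixes the order \<open>1 / l\<close> of
  \<open>\<theta>\<close>.\<close>

lemma exp_moment_le:
  fixes x :: "'a \<Rightarrow> real"
  assumes M: "prob_space M" and x: "x \<in> borel_measurable M"
    and le: "(\<integral>\<^sup>+\<omega>. ennreal (exp (rate * x \<omega>)) \<partial>M) \<le> ennreal (exp (c2 * l))"
    and s: "0 \<le> s" "s \<le> 1"
  shows "(\<integral>\<^sup>+\<omega>. ennreal (exp (s * \<theta> * x \<omega>)) \<partial>M) \<le> ennreal (1 / \<rho>)"
proof -
  have r: "0 \<le> \<theta> / rate" "\<theta> / rate \<le> 1" using theta_pos theta_le_rate rate_pos by auto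
  have eq: "s * (\<theta> / rate) * rate = s * \<theta>" using rate_pos by simp
  from nn_integral_exp_power_le[OF M x le mult_nonneg_nonneg[OF s(1) r(1)] mult_le_one[OF s(2) r]]
  have "(\<integral>\<^sup>+\<omega>. ennreal (exp (s * \<theta> * x \<omega>)) \<partial>M) \<le> ennreal (exp (s * (\<theta> / rate) * (c2 * l)))"
    unfolding eq .
  also have "s * (\<theta> / rate) * (c2 * l) = s * ln (1 / \<rho>)" by (simp only: mult.assoc theta_ratio)
  also have "ennreal (exp (s * ln (1 / \<rho>))) \<le> ennreal (exp (ln (1 / \<rho>)))"
    using s ln_rho(1) mult_right_mono[of s 1 "ln (1 / \<rho>)"] by (intro ennreal_leI) simp
  also have "exp (ln (1 / \<rho>)) = 1 / \<rho>" using rho_pos by simp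
  finally show ?thesis .
qed

text \<open>The first summand has mean at most \<open>\<rho>^2 * (1 / \<rho>) = \<rho>\<close>, the
  second at most \<open>(1 - \<rho>) / 2\<close> by \<open>tail_small\<close>; the total stays below
  1.\<close>

lemma potential_factor_moment_le:
  fixes x :: "'a \<Rightarrow> real"
  assumes M: "prob_space M" and x: "x \<in> borel_measurable M"
    and le: "(\<integral>\<^sup>+\<omega>. ennreal (exp (rate * x \<omega>)) \<partial>M) \<le> ennreal (exp (c2 * l))"
  shows "(\<integral>\<^sup>+\<omega>. ennreal (potential_factor \<rho> (\<theta> / 2) \<zeta> (\<delta> * \<tau>) (x \<omega>)) \<partial>M) \<le> ennreal ((1 + \<rho>) / 2)"
proof -
  let ?e = "exp (- (\<zeta> * (\<delta> * \<tau>) / 2))"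
  have "potential_factor \<rho> (\<theta> / 2) \<zeta> (\<delta> * \<tau>) (x \<omega>) = \<rho>\<^sup>2 * exp (1 / 2 * \<theta> * x \<omega>) + ?e * exp (rate * x \<omega>)" for \<omega>
    unfolding potential_factor_def zeta(3) by (simp add: exp_add[symmetric] algebra_simps)
  then have "(\<integral>\<^sup>+\<omega>. ennreal (potential_factor \<rho> (\<theta> / 2) \<zeta> (\<delta> * \<tau>) (x \<omega>)) \<partial>M)
    = (\<integral>\<^sup>+\<omega>. ennreal (\<rho>\<^sup>2) * ennreal (exp (1 / 2 * \<theta> * x \<omega>)) + ennreal ?e * ennreal (exp (rate * x \<omega>)) \<partial>M)"
    by (simp only: ennreal_plus ennreal_mult mult_nonneg_nonneg exp_ge_zero zero_le_power2)
  also have "\<dots> = ennreal (\<rho>\<^sup>2) * (\<integral>\<^sup>+\<omega>. ennreal (exp (1 / 2 * \<theta> * x \<omega>)) \<partial>M)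
      + ennreal ?e * (\<integral>\<^sup>+\<omega>. ennreal (exp (rate * x \<omega>)) \<partial>M)"
    using x by (subst nn_integral_add) (auto simp: nn_integral_cmult)
  also have "\<dots> \<le> ennreal (\<rho>\<^sup>2) * ennreal (1 / \<rho>) + ennreal ?e * ennreal (exp (c2 * l))"
    using exp_moment_le[OF M x le, of "1 / 2"] le by (intro add_mono mult_left_mono) auto
  also have "\<dots> = ennreal (\<rho>\<^sup>2 * (1 / \<rho>) + ?e * exp (c2 * l))"
    using rho_pos by (simp add: ennreal_plus ennreal_mult[symmetric] del: ennreal_plus[symmetric])
  also have "\<dots> \<le> ennreal (\<rho> + (1 - \<rho>) / 2)"
  proof (intro ennreal_leI add_mono)
    show "\<rho>\<^sup>2 * (1 / \<rho>) \<le> \<rho>" using rho_pos by (simp add: power2_eq_square)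
    show "?e * exp (c2 * l) \<le> (1 - \<rho>) / 2" using tail_small by (simp add: exp_add[symmetric] algebra_simps)
  qed
  also have "\<rho> + (1 - \<rho>) / 2 = (1 + \<rho>) / 2" by (simp add: field_simps)
  finally show ?thesis .
qed

end

context reflected_brownian_motion
begin

lemma second_moment_le:
  assumes dp: "drift_parameters \<rho> \<delta> V (ln (real d))" and d2: "2 \<le> d"
    and ind: "independent_of_process M d Z X"
    and stat: "stationary_distribution M d (reflection_matrix d Q) X (distr M (state_space d) Z)"
    and t: "0 \<le> t"
  defines "e0 \<equiv> drift_parameters.\<epsilon> \<rho> \<delta> V" and "k0 \<equiv> drift_parameters.\<kappa> \<rho> \<delta> V"
  shows "(\<integral>\<^sup>+\<omega>. ennreal ((max_norm (vec d (\<lambda>i. reflected t (Z \<omega>) \<omega> i - reflected t (\<lambda>_. 0) \<omega> i)))\<^sup>2) \<partial>M)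
    \<le> ennreal (c\<^sup>2 * (8 * (ln (real d))\<^sup>2 / e0\<^sup>2 * (1 / \<rho> * exp (e0 * \<delta> * k0\<^sup>2 / 2) / (1 - \<rho>)))
        * ((1 + \<rho>) / 2) ^ nat \<lfloor>t / (k0\<^sup>2 * ln (real d))\<rfloor>)"
proof -
  interpret drift_parameters \<rho> \<delta> V "ln (real d)" by (rule dp)
  let ?q = "(1 + \<rho>) / 2" and ?k = "nat \<lfloor>t / \<tau>\<rfloor>"
  let ?F = "\<lambda>x. potential_factor \<rho> (\<theta> / 2) \<zeta> (\<delta> * \<tau>) (x / (1 - \<rho>))"
  let ?\<pi> = "distr M (state_space d) Z"
  have Z: "Z \<in> M \<rightarrow>\<^sub>M state_space d" using ind unfolding independent_of_process_def by auto
  have rate_eq: "rate * (x / (1 - \<rho>)) = 1 / \<kappa> * x" for x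
    using rho kappa(3) by (simp add: rate_def)
  have "(\<integral>\<^sup>+\<omega>. ennreal (?F (grid_oscillation d (noise \<omega>) (real b * \<tau>) \<tau> n)) \<partial>M) \<le> ennreal ?q"
    if n: "0 < n" for b n
  proof (rule potential_factor_moment_le[OF prob_space_axioms])
    show "(\<lambda>\<omega>. grid_oscillation d (noise \<omega>) (real b * \<tau>) \<tau> n / (1 - \<rho>)) \<in> borel_measurable M"
      using tau_pos by (intro borel_measurable_divide grid_oscillation_measurable borel_measurable_const) auto
    have "(\<integral>\<^sup>+\<omega>. ennreal (exp (1 / \<kappa> * grid_oscillation d (noise \<omega>) (real b * \<tau>) \<tau> n)) \<partial>M)
      \<le> ennreal (8 * real d * exp (2 * (1 / \<kappa>)\<^sup>2 * V * \<tau>))"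
      using tau_pos n by (intro grid_oscillation_moment) auto
    also have "\<dots> \<le> ennreal (exp (c2 * ln (real d)))" using moment_constant[OF d2] by (intro ennreal_leI) simp
    finally show "(\<integral>\<^sup>+\<omega>. ennreal (exp (rate * (grid_oscillation d (noise \<omega>) (real b * \<tau>) \<tau> n / (1 - \<rho>)))) \<partial>M)
      \<le> ennreal (exp (c2 * ln (real d)))"
      unfolding rate_eq .
  qed
  note grid = this
  \<comment> \<open>The noise costs a factor \<open>1 / \<rho>\<close> and the drift gains at least
    \<open>\<rho>^2\<close>, so \<open>\<gamma> = \<rho>\<close> is a contraction factor for one
    block.\<close>
  have stationary: "(\<integral>\<^sup>+y. ennreal (exp (\<theta> * height y)) \<partial>?\<pi>) \<le> ennreal (1 / \<rho> * exp (\<theta> * (\<delta> * \<tau>) / 2) / (1 - \<rho>))"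
  proof (rule stationary_moment_bound)
    let ?G = "\<lambda>\<omega>. exp (\<theta> * (oscillation d (noise \<omega>) 0 \<tau> / (1 - \<rho>)))"
    show "prob_space ?\<pi>" by (rule prob_space_distr[OF Z])
    show "distr (?\<pi> \<Otimes>\<^sub>M M) (state_space d) (\<lambda>(y, \<omega>). reflected \<tau> y \<omega>) = ?\<pi>"
      using stat tau_pos unfolding stationary_distribution_def by simp
    show "(\<lambda>(y, \<omega>). reflected \<tau> y \<omega>) x \<in> space (state_space d)" for x
      by (auto simp: space_PiM reflected_path_def split: prod.split)
    show "(\<lambda>y. exp (\<theta> * height y)) \<in> borel_measurable (state_space d)"
      by (intro measurable_compose[OF _ borel_measurable_exp] borel_measurable_times borel_measurable_const height_measurable)
    have om: "(\<lambda>\<omega>. oscillation d (noise \<omega>) 0 \<tau> / (1 - \<rho>)) \<in> borel_measurable M"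
      using tau_pos by (intro borel_measurable_divide oscillation_measurable borel_measurable_const) auto
    then show "?G \<in> borel_measurable M"
      by (intro measurable_compose[OF _ borel_measurable_exp] borel_measurable_times borel_measurable_const)
    have "(\<integral>\<^sup>+\<omega>. ennreal (exp (1 / \<kappa> * oscillation d (noise \<omega>) 0 \<tau>)) \<partial>M) \<le> ennreal (8 * real d * exp (2 * (1 / \<kappa>)\<^sup>2 * V * \<tau>))"
      using tau_pos by (intro oscillation_moment) auto
    also have "\<dots> \<le> ennreal (exp (c2 * ln (real d)))" using moment_constant[OF d2] by (intro ennreal_leI) simp
    finally have "(\<integral>\<^sup>+\<omega>. ennreal (exp (rate * (oscillation d (noise \<omega>) 0 \<tau> / (1 - \<rho>)))) \<partial>M) \<le> ennreal (exp (c2 * ln (real d)))"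
      unfolding rate_eq .
    from exp_moment_le[OF prob_space_axioms om this, of 1]
    show "(\<integral>\<^sup>+\<omega>. ennreal (?G \<omega>) \<partial>M) \<le> ennreal (1 / \<rho>)" by simp
    have "AE y in ?\<pi>. \<forall>i<d. 0 \<le> y i" using stat unfolding stationary_distribution_def by blast
    then show "AE y in ?\<pi>. \<forall>\<omega>\<in>space M. exp (\<theta> * height ((\<lambda>(y, \<omega>). reflected \<tau> y \<omega>) (y, \<omega>)))
        \<le> ?G \<omega> * (exp (- \<theta> * (1 - \<rho>) * (\<delta> * \<tau>) / 2) * exp (\<theta> * height y) + exp (\<theta> * (\<delta> * \<tau>) / 2))"
      by eventually_elim (use exp_height_drift tau_pos theta_pos in auto)
    have "ln (1 / \<rho>) = - ln \<rho>" using rho_pos by (simp add: ln_div)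
    then have "exp (- \<theta> * (1 - \<rho>) * (\<delta> * \<tau>) / 2) \<le> exp (2 * ln \<rho>)"
      using drift_large ln_rho(1) unfolding exp_le_cancel_iff by simp
    also have "\<dots> = \<rho>\<^sup>2" using rho_pos exp_of_nat_mult[of 2 "ln \<rho>"] by simp
    finally have "exp (- \<theta> * (1 - \<rho>) * (\<delta> * \<tau>) / 2) \<le> \<rho>\<^sup>2" .
    then show "1 / \<rho> * exp (- \<theta> * (1 - \<rho>) * (\<delta> * \<tau>) / 2) \<le> \<rho>"
      using rho_pos by (simp add: field_simps power2_eq_square)
  qed (use rho rho_pos prob_space_axioms in auto)
  \<comment> \<open>The potential at time 0. With \<open>x = \<theta> / 2 * height y\<close>, the
    inequality \<open>x^2 / 2 \<le> exp x\<close> trades the square for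
    \<open>8 / \<theta>^2\<close> and the remaining half of \<open>\<theta>\<close>.\<close>
  define h where "h y = (height y)\<^sup>2 * exp (\<theta> / 2 * height y)" for y
  have hm: "h \<in> borel_measurable (state_space d)"
    unfolding h_def
    by (intro borel_measurable_times borel_measurable_power measurable_compose[OF _ borel_measurable_exp]
        borel_measurable_const height_measurable)
  have h0: "0 \<le> h y" for y by (simp add: h_def)
  have pos: "AE \<omega> in M. \<forall>i<d. 0 \<le> Z \<omega> i"
    using stat AE_distrD[OF Z] unfolding stationary_distribution_def by blast
  have h_le: "(\<integral>\<^sup>+\<omega>. ennreal (h (Z \<omega>)) \<partial>M)
      \<le> ennreal (8 / \<theta>\<^sup>2 * (1 / \<rho> * exp (\<theta> * (\<delta> * \<tau>) / 2) / (1 - \<rho>)))"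
  proof -
    have "(\<integral>\<^sup>+\<omega>. ennreal (h (Z \<omega>)) \<partial>M) \<le> (\<integral>\<^sup>+\<omega>. ennreal (8 / \<theta>\<^sup>2) * ennreal (exp (\<theta> * height (Z \<omega>))) \<partial>M)"
    proof (rule nn_integral_mono_AE, use pos in eventually_elim)
      fix \<omega> assume "\<forall>i<d. 0 \<le> Z \<omega> i"
      then have n: "0 \<le> height (Z \<omega>)" by (intro height_nonneg) auto
      let ?x = "\<theta> / 2 * height (Z \<omega>)"
      have x0: "0 \<le> ?x" using n theta_pos by simp
      then have "?x\<^sup>2 / 2 \<le> exp ?x"
        using exp_lower_Taylor_quadratic[OF x0] by linarith
      then have "(height (Z \<omega>))\<^sup>2 \<le> 8 / \<theta>\<^sup>2 * exp ?x"
        using theta_pos by (simp add: field_simps power2_eq_square)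
      then have "h (Z \<omega>) \<le> 8 / \<theta>\<^sup>2 * exp ?x * exp ?x" unfolding h_def by (intro mult_right_mono) auto
      also have "\<dots> = 8 / \<theta>\<^sup>2 * exp (\<theta> * height (Z \<omega>))" by (simp add: exp_add[symmetric])
      finally show "ennreal (h (Z \<omega>)) \<le> ennreal (8 / \<theta>\<^sup>2) * ennreal (exp (\<theta> * height (Z \<omega>)))"
        by (simp add: ennreal_mult[symmetric] ennreal_leI)
    qed
    also have "\<dots> = ennreal (8 / \<theta>\<^sup>2) * (\<integral>\<^sup>+\<omega>. ennreal (exp (\<theta> * height (Z \<omega>))) \<partial>M)"
      by (intro nn_integral_cmult measurable_compose[OF Z] measurable_compose[OF _ measurable_ennreal]
          measurable_compose[OF _ borel_measurable_exp] borel_measurable_times borel_measurable_const height_measurable)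
    also have "(\<integral>\<^sup>+\<omega>. ennreal (exp (\<theta> * height (Z \<omega>))) \<partial>M) = (\<integral>\<^sup>+y. ennreal (exp (\<theta> * height y)) \<partial>?\<pi>)"
      by (intro nn_integral_distr[symmetric] Z measurable_compose[OF _ measurable_ennreal]
          measurable_compose[OF _ borel_measurable_exp] borel_measurable_times borel_measurable_const) (simp add: height_measurable)
    also have "ennreal (8 / \<theta>\<^sup>2) * \<dots> \<le> ennreal (8 / \<theta>\<^sup>2) * ennreal (1 / \<rho> * exp (\<theta> * (\<delta> * \<tau>) / 2) / (1 - \<rho>))"
      using stationary by (intro mult_left_mono) auto
    also have "\<dots> = ennreal (8 / \<theta>\<^sup>2 * (1 / \<rho> * exp (\<theta> * (\<delta> * \<tau>) / 2) / (1 - \<rho>)))"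
      using rho rho_pos by (intro ennreal_mult[symmetric]) auto
    finally show ?thesis .
  qed
  have kt: "real ?k * \<tau> \<le> t"
  proof -
    have "0 \<le> t / \<tau>" using t tau_pos by simp
    then have "real ?k \<le> t / \<tau>" by (simp add: of_nat_nat)
    then show ?thesis using tau_pos by (simp add: pos_le_divide_eq)
  qed
  have "(\<integral>\<^sup>+\<omega>. ennreal ((max_norm (vec d (\<lambda>i. reflected t (Z \<omega>) \<omega> i - reflected t (\<lambda>_. 0) \<omega> i)))\<^sup>2) \<partial>M)
    \<le> (\<integral>\<^sup>+\<omega>. ennreal (c\<^sup>2) * ennreal (h (Z \<omega>) * (\<Prod>b<?k. ?F (oscillation d (noise \<omega>) (real b * \<tau>) \<tau>))) \<partial>M)"
  proof (rule nn_integral_mono_AE, use pos AE_space in eventually_elim)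
    fix \<omega> assume \<omega>: "\<forall>i<d. 0 \<le> Z \<omega> i" "\<omega> \<in> space M"
    let ?p = "\<Prod>b<?k. ?F (oscillation d (noise \<omega>) (real b * \<tau>) \<tau>)"
    have "0 \<le> ?p" by (intro prod_nonneg) (simp add: potential_factor_def)
    moreover have "(max_norm (vec d (\<lambda>i. reflected t (Z \<omega>) \<omega> i - reflected t (\<lambda>_. 0) \<omega> i)))\<^sup>2 \<le> c\<^sup>2 * (h (Z \<omega>) * ?p)"
      unfolding h_def
      by (rule squared_gap_le[OF \<omega>(2) _ tau_pos kt]) (use \<omega>(1) theta_pos zeta drift_large in auto)
    ultimately show "ennreal ((max_norm (vec d (\<lambda>i. reflected t (Z \<omega>) \<omega> i - reflected t (\<lambda>_. 0) \<omega> i)))\<^sup>2)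
      \<le> ennreal (c\<^sup>2) * ennreal (h (Z \<omega>) * ?p)"
      using h0 by (simp add: ennreal_mult[symmetric] ennreal_leI)
  qed
  also have "\<dots> = ennreal (c\<^sup>2) * (\<integral>\<^sup>+\<omega>. ennreal (h (Z \<omega>) * (\<Prod>b<?k. ?F (oscillation d (noise \<omega>) (real b * \<tau>) \<tau>))) \<partial>M)"
  proof (rule nn_integral_cmult)
    have Fm: "?F \<in> borel_measurable borel" unfolding potential_factor_def by measurable
    show "(\<lambda>\<omega>. ennreal (h (Z \<omega>) * (\<Prod>b<?k. ?F (oscillation d (noise \<omega>) (real b * \<tau>) \<tau>)))) \<in> borel_measurable M"
      using tau_pos by (intro measurable_compose[OF _ measurable_ennreal] borel_measurable_times borel_measurable_prod
          measurable_compose[OF Z hm] measurable_compose[OF _ Fm] oscillation_measurable) auto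
  qed
  also have "\<dots> \<le> ennreal (c\<^sup>2) * ((\<integral>\<^sup>+\<omega>. ennreal (h (Z \<omega>)) \<partial>M) * ennreal ?q ^ ?k)"
  proof (intro mult_left_mono)
    show "(\<integral>\<^sup>+\<omega>. ennreal (h (Z \<omega>) * (\<Prod>b<?k. ?F (oscillation d (noise \<omega>) (real b * \<tau>) \<tau>))) \<partial>M)
      \<le> (\<integral>\<^sup>+\<omega>. ennreal (h (Z \<omega>)) \<partial>M) * ennreal ?q ^ ?k"
    proof (rule independent_oscillation_product[OF ind X_measurable])
      \<comment> \<open>Applying \<open>R^-1\<close> to \<open>X\<close> and subtracting the mean
        drift recovers the noise.\<close>
      show "noise \<omega> s i = (\<Sum>j<d. Rinv $$ (i, j) * X \<omega> s j) - s * mean i" if "i < d" for \<omega> s i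
        using workload_X[OF that, of \<omega> s] by (simp add: workload_def)
      show "continuous_on UNIV ?F"
        unfolding potential_factor_def using rho by (intro continuous_intros) auto
      show "0 \<le> ?F x" for x by (simp add: potential_factor_def)
    qed (use tau_pos hm h0 grid in auto)
  qed simp
  also have "\<dots> \<le> ennreal (c\<^sup>2) * (ennreal (8 / \<theta>\<^sup>2 * (1 / \<rho> * exp (\<theta> * (\<delta> * \<tau>) / 2) / (1 - \<rho>))) * ennreal ?q ^ ?k)"
    using h_le by (intro mult_left_mono mult_right_mono) auto
  also have "\<dots> = ennreal (c\<^sup>2 * (8 / \<theta>\<^sup>2 * (1 / \<rho> * exp (\<theta> * (\<delta> * \<tau>) / 2) / (1 - \<rho>)) * ?q ^ ?k))"
  proof -
    have "ennreal x * (ennreal a * ennreal b ^ k) = ennreal (x * (a * b ^ k))"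
      if "0 \<le> x" "0 \<le> a" "0 \<le> b" for x a b :: real and k
      using that by (simp add: ennreal_mult ennreal_power)
    then show ?thesis using rho rho_pos by auto
  qed
  also have "8 / \<theta>\<^sup>2 = 8 * (ln (real d))\<^sup>2 / \<epsilon>\<^sup>2"
    by (simp add: \<theta>_def power_divide)
  finally show ?thesis
    unfolding drift_constant unfolding \<tau>_def assms(6,7) by (simp only: mult.assoc)
qed

end

text \<open>Rounding down the number of blocks loses at most one factor \<open>q\<close>, which goes
  into the prefactor.\<close>

lemma power_floor_le:
  fixes q x :: real
  assumes "0 < q" "q < 1" "0 \<le> x"
  shows "q ^ nat \<lfloor>x\<rfloor> \<le> exp (ln q * x) / q"
proof -
  have "q ^ nat \<lfloor>x\<rfloor> = exp (ln q * real (nat \<lfloor>x\<rfloor>))"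
    using assms(1) exp_of_nat2_mult[of "ln q" "nat \<lfloor>x\<rfloor>"] by (simp only: exp_ln)
  also have "ln q * real (nat \<lfloor>x\<rfloor>) \<le> ln q * (x - 1)"
    using assms by (intro mult_left_mono_neg) (auto simp: of_nat_nat)
  finally have "q ^ nat \<lfloor>x\<rfloor> \<le> exp (ln q * (x - 1))" by simp
  also have "\<dots> = exp (ln q * x) / q" using assms by (simp add: right_diff_distrib exp_diff)
  finally show ?thesis .
qed

theorem lemma6:
  fixes \<beta>\<^sub>0 \<kappa>\<^sub>0 \<delta>\<^sub>0 b\<^sub>0 :: real
  assumes "0 < \<beta>\<^sub>0" "\<beta>\<^sub>0 < 1" "0 < \<kappa>\<^sub>0" "0 < \<delta>\<^sub>0" "0 < b\<^sub>0"
  shows "\<exists>C\<^sub>2>0. \<exists>\<xi>\<^sub>1>0. \<forall>d\<ge>2.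
    \<forall>(\<mu> :: real vec) (\<Sigma> :: real mat) (Q :: real mat) (R :: real mat) (Rinv :: real mat).
      \<mu> \<in> carrier_vec d \<and> \<Sigma> \<in> carrier_mat d d \<and>
      substochastic d Q \<and> R = reflection_matrix d Q \<and>
      is_mat_inverse d R Rinv \<and> (\<forall>i<d. \<forall>j<d. 0 \<le> Rinv $$ (i, j)) \<and>
      (\<forall>n. max_norm (transpose_mat (Q ^\<^sub>m n) *\<^sub>v vec d (\<lambda>_. 1)) \<le> \<kappa>\<^sub>0 * (1 - \<beta>\<^sub>0) ^ n) \<and>
      (\<forall>i<d. (Rinv *\<^sub>v \<mu>) $ i < - \<delta>\<^sub>0) \<and>
      (\<forall>i<d. inverse b\<^sub>0 \<le> \<Sigma> $$ (i, i) \<and> \<Sigma> $$ (i, i) \<le> b\<^sub>0) \<longrightarrow>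
      (\<forall>(M :: 'w measure) (C :: real mat) B X Yinf.
        C \<in> carrier_mat d d \<and> C * transpose_mat C = \<Sigma> \<and>
        standard_brownian_motion M d B \<and>
        X = (\<lambda>\<omega>. driving_path d \<mu> C (B \<omega>)) \<and>
        independent_of_process M d Yinf X \<and>
        stationary_distribution M d R X (distr M (state_space d) Yinf) \<longrightarrow>
        (\<forall>t\<ge>0.
          (\<integral>\<^sup>+\<omega>. ennreal ((max_norm (vec d (\<lambda>i.
               reflected_path d R t (Yinf \<omega>) (X \<omega>) i
             - reflected_path d R t (\<lambda>_. 0) (X \<omega>) i)))\<^sup>2) \<partial>M)
          \<le> ennreal (C\<^sub>2 * real d ^ 3 * exp (- \<xi>\<^sub>1 * (t / ln (real d))))))"
proof -
  \<comment> \<open>All constants come from \<open>\<beta>\<^sub>0\<close>,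
    \<open>\<kappa>\<^sub>0\<close>, \<open>\<delta>\<^sub>0\<close>, \<open>b\<^sub>0\<close>:
    \<open>c\<close> bounds the weights, \<open>\<delta> * c = \<delta>\<^sub>0\<close> is the
    drift, \<open>V\<close> bounds the variance of the noise, and \<open>q\<close> is the mean
    factor of a block.\<close>
  define \<rho> where "\<rho> = 1 - \<beta>\<^sub>0 / 2"
  define c where "c = \<kappa>\<^sub>0 / (1 - (1 - \<beta>\<^sub>0) / \<rho>)"
  define \<delta> where "\<delta> = \<delta>\<^sub>0 / c"
  define V where "V = (c / (1 - \<rho>))\<^sup>2 * b\<^sub>0"
  define q where "q = (1 + \<rho>) / 2"
  define \<epsilon> where "\<epsilon> = drift_parameters.\<epsilon> \<rho> \<delta> V"
  define \<kappa> where "\<kappa> = drift_parameters.\<kappa> \<rho> \<delta> V"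
  define K where "K = c\<^sup>2 * (8 / \<epsilon>\<^sup>2 * (1 / \<rho> * exp (\<epsilon> * \<delta> * \<kappa>\<^sup>2 / 2) / (1 - \<rho>)))"
  have rho: "1 / 2 \<le> \<rho>" "\<rho> < 1" "0 < \<rho>" "1 - \<beta>\<^sub>0 < \<rho>" using assms by (auto simp: \<rho>_def)
  have c: "0 < c" unfolding c_def using rho assms by (intro divide_pos_pos) auto
  have delta: "0 < \<delta>" using c assms by (simp add: \<delta>_def)
  have V: "0 \<le> V" using assms by (simp add: V_def)
  have dp: "drift_parameters \<rho> \<delta> V l" if "ln 2 \<le> l" for l
    by unfold_locales (use rho delta V that in auto)
  \<comment> \<open>\<open>\<epsilon>\<close> and \<open>\<kappa>\<close> do not involve
    \<open>l\<close>, so they are available before \<open>d\<close>, and the instance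
    \<open>l = ln 2\<close> shows their positivity.\<close>
  have eps: "0 < \<epsilon>" and kappa: "0 < \<kappa>"
    using drift_parameters.eps_pos[OF dp[OF order.refl]] drift_parameters.kappa(3)[OF dp[OF order.refl]]
    by (simp_all add: \<epsilon>_def \<kappa>_def)
  have q: "0 < q" "q < 1" using rho by (auto simp: q_def)
  have K: "0 < K" unfolding K_def using c eps rho by simp
  have C2: "0 < K / q" using K q by simp
  have \<xi>1: "0 < - ln q / \<kappa>\<^sup>2" using q kappa by (intro divide_pos_pos) auto
  show ?thesis
  proof (rule exI[of _ "K / q"], rule conjI[OF C2], rule exI[of _ "- ln q / \<kappa>\<^sup>2"], rule conjI[OF \<xi>1], intro allI impI)
    fix d :: nat and \<mu> :: "real vec" and \<Sigma> Q R Rinv :: "real mat"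
      and M :: "'w measure" and C :: "real mat" and B X Yinf and t :: real
    assume d2: "2 \<le> d"
      and A: "\<mu> \<in> carrier_vec d \<and> \<Sigma> \<in> carrier_mat d d \<and>
      substochastic d Q \<and> R = reflection_matrix d Q \<and>
      is_mat_inverse d R Rinv \<and> (\<forall>i<d. \<forall>j<d. 0 \<le> Rinv $$ (i, j)) \<and>
      (\<forall>n. max_norm (transpose_mat (Q ^\<^sub>m n) *\<^sub>v vec d (\<lambda>_. 1)) \<le> \<kappa>\<^sub>0 * (1 - \<beta>\<^sub>0) ^ n) \<and>
      (\<forall>i<d. (Rinv *\<^sub>v \<mu>) $ i < - \<delta>\<^sub>0) \<and>
      (\<forall>i<d. inverse b\<^sub>0 \<le> \<Sigma> $$ (i, i) \<and> \<Sigma> $$ (i, i) \<le> b\<^sub>0)"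
      and P: "C \<in> carrier_mat d d \<and> C * transpose_mat C = \<Sigma> \<and>
        standard_brownian_motion M d B \<and>
        X = (\<lambda>\<omega>. driving_path d \<mu> C (B \<omega>)) \<and>
        independent_of_process M d Yinf X \<and>
        stationary_distribution M d R X (distr M (state_space d) Yinf)"
      and t: "0 \<le> t"
    have \<mu>: "\<mu> \<in> carrier_vec d" and Q: "substochastic d Q" and R: "R = reflection_matrix d Q"
      and inv: "is_mat_inverse d (reflection_matrix d Q) Rinv"
      and Ri0: "\<And>i j. i < d \<Longrightarrow> j < d \<Longrightarrow> 0 \<le> Rinv $$ (i, j)"
      and pow: "\<And>n. max_norm (transpose_mat (Q ^\<^sub>m n) *\<^sub>v vec d (\<lambda>_. 1)) \<le> \<kappa>\<^sub>0 * (1 - \<beta>\<^sub>0) ^ n"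
      and drift: "\<And>i. i < d \<Longrightarrow> (Rinv *\<^sub>v \<mu>) $ i < - \<delta>\<^sub>0"
      and var: "\<And>i. i < d \<Longrightarrow> \<Sigma> $$ (i, i) \<le> b\<^sub>0"
      using A by blast+
    have C: "C \<in> carrier_mat d d" and CC: "C * transpose_mat C = \<Sigma>"
      and bm: "standard_brownian_motion M d B"
      and X: "X = (\<lambda>\<omega>. driving_path d \<mu> C (B \<omega>))"
      using P by blast+
    obtain w where w: "skorokhod_problem d Q w \<rho>" "\<And>i. i < d \<Longrightarrow> w i \<le> c"
      using contraction_weights_from_power_bound[OF assms(1,2) Q pow] unfolding \<rho>_def c_def by blast
    interpret RI: reflection_inverse d "\<lambda>i j. Q $$ (j, i)" w \<rho> "\<lambda>i j. Rinv $$ (i, j)"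
      by (rule reflection_inverse_of_mat_inverse[OF w(1) inv Ri0])
    have Rc: "Rinv \<in> carrier_mat d d" using inv by (simp add: is_mat_inverse_def)
    have Crow: "(\<Sum>j<d. (C $$ (k, j))\<^sup>2) \<le> b\<^sub>0" if k: "k < d" for k
    proof -
      have "\<Sigma> $$ (k, k) = (\<Sum>j<d. (C $$ (k, j))\<^sup>2)"
        unfolding CC[symmetric] using C k by (simp add: scalar_prod_def lessThan_atLeast0 power2_eq_square)
      then show ?thesis using var[OF k] by simp
    qed
    have noise: "brownian_noise M d B (\<lambda>i j. \<Sum>k<d. Rinv $$ (i, k) * C $$ (k, j)) V"
    proof
      show "(\<Sum>j<d. (\<Sum>k<d. Rinv $$ (i, k) * C $$ (k, j))\<^sup>2) \<le> V" if "i < d" for i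
        unfolding V_def using assms(5) by (intro RI.workload_variance_le that w(2) Crow) auto
    qed (use bm d2 in auto)
    interpret reflected_brownian_motion d Q w \<rho> Rinv M B C V \<mu> c \<delta>
    proof (intro reflected_brownian_motion.intro reflected_brownian_motion_axioms.intro)
      show "(\<Sum>k<d. Rinv $$ (i, k) * \<mu> $ k) \<le> - (\<delta> * c)" if i: "i < d" for i
      proof -
        have "\<mu> = vec d (\<lambda>k. \<mu> $ k)" using \<mu> by auto
        then have "(Rinv *\<^sub>v \<mu>) $ i = (\<Sum>k<d. Rinv $$ (i, k) * \<mu> $ k)"
          using mat_vec_sum[OF Rc i, of "\<lambda>k. \<mu> $ k"] by simp
        then show ?thesis using drift[OF i] c by (simp add: \<delta>_def)
      qed
    qed (use w noise RI.reflection_inverse_axioms \<mu> C delta in auto)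
    let ?l = "ln (real d)"
    have l: "ln 2 \<le> ?l" "0 < ?l" using d2 by auto
    let ?x = "t / (\<kappa>\<^sup>2 * ?l)"
    have x: "0 \<le> ?x" using t l by simp
    have "(\<integral>\<^sup>+\<omega>. ennreal ((max_norm (vec d (\<lambda>i.
               reflected_path d R t (Yinf \<omega>) (X \<omega>) i
             - reflected_path d R t (\<lambda>_. 0) (X \<omega>) i)))\<^sup>2) \<partial>M)
       \<le> ennreal (c\<^sup>2 * (8 * ?l\<^sup>2 / \<epsilon>\<^sup>2 * (1 / \<rho> * exp (\<epsilon> * \<delta> * \<kappa>\<^sup>2 / 2) / (1 - \<rho>))) * q ^ nat \<lfloor>?x\<rfloor>)"
      unfolding X R \<epsilon>_def \<kappa>_def q_def
      by (rule second_moment_le[OF dp[OF l(1)] d2 _ _ t]) (use P X R in auto)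
    also have "c\<^sup>2 * (8 * ?l\<^sup>2 / \<epsilon>\<^sup>2 * (1 / \<rho> * exp (\<epsilon> * \<delta> * \<kappa>\<^sup>2 / 2) / (1 - \<rho>))) * q ^ nat \<lfloor>?x\<rfloor>
        = K * ?l\<^sup>2 * q ^ nat \<lfloor>?x\<rfloor>"
      by (simp add: K_def)
    also have "ennreal \<dots> \<le> ennreal (K * real d ^ 3 * (exp (ln q * ?x) / q))"
    proof (intro ennreal_leI mult_mono)
      \<comment> \<open>The estimate produces \<open>(ln d)^2\<close>, which is majorised by
        \<open>d^3\<close>.\<close>
      have "?l \<le> real d" using ln_le_minus_one[of "real d"] d2 by simp
      then have "?l\<^sup>2 \<le> real d ^ 2" using l by (intro power_mono) auto
      also have "\<dots> \<le> real d ^ 3" using d2 by (intro power_increasing) auto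
      finally show "?l\<^sup>2 \<le> real d ^ 3" .
      show "q ^ nat \<lfloor>?x\<rfloor> \<le> exp (ln q * ?x) / q" using q x by (rule power_floor_le)
    qed (use K q in auto)
    also have "K * real d ^ 3 * (exp (ln q * ?x) / q) = K / q * real d ^ 3 * exp (- (- ln q / \<kappa>\<^sup>2) * (t / ?l))"
      by simp
    finally show "(\<integral>\<^sup>+\<omega>. ennreal ((max_norm (vec d (\<lambda>i.
               reflected_path d R t (Yinf \<omega>) (X \<omega>) i
             - reflected_path d R t (\<lambda>_. 0) (X \<omega>) i)))\<^sup>2) \<partial>M)
      \<le> ennreal (K / q * real d ^ 3 * exp (- (- ln q / \<kappa>\<^sup>2) * (t / ln (real d))))" .
  qed
qed

end
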